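(* Let $\mathbb F$ be a field of characteristic $p>0$. The opposite category $\Gamma_{\mathrm{alg}}^{op}$ of the category of divided power algebras over $\mathbb F$ is equipped with a Rosický tangent structure given by: (i) the tangent bundle functor $\mathsf T^\circ:\Gamma_{\mathrm{alg}}^{op}\to\Gamma_{\mathrm{alg}}^{op}$, $\mathsf T^\circ A=\Gamma^+_A(\Omega^1_A)$, the free divided power $A$-algebra on the module $\Omega^1_A$ of strongly abelian Kähler differentials of $A$; (ii) a natural projection whose opposite $p^\circ_A:A\to\mathsf T^\circ A$ is $p^\circ_A(a)=a$, the $n$-fold pushout of which is denoted $\mathsf T^\circ_nA$ and equals $(\mathsf T^\circ A)^{\coprod_A n}$, the $n$-fold coproduct of $\mathsf T^\circ A$ in divided power algebras under $A$ (so $\mathsf T^\circ_2A$ is generated by elements $a$, $\mathsf d_1a$ from the first summand and $\mathsf d_2a$ from the second); (iii) a natural sum map whose opposite $s^\circ_A:\mathsf T^\circ A\to\mathsf T^\circ_2A$ is given by $s^\circ_A(a)=a$, $s^\circ_A(\mathsf da)=\mathsf d_1a+\mathsf d_2a$; (iv) a natural zero map whose opposite $z^\circ_A:\mathsf T^\circ A\to A$ is given by $z^\circ_A(a)=a$, $z_A^\circ(\mathsf da)=0$; (v) a natural vertical lift whose opposite $l^\circ_A:(\mathsf T^\circ)^2A\to\mathsf T^\circ A$ is given by $l^\circ_A(a)=a$, $l^\circ_A(\mathsf da)=l^\circ_A(\mathsf d'a)=0$, $l^\circ_A(\mathsf d'\mathsf da)=\mathsf da$; (vi) a natural canonical flip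 whose opposite $c^\circ_A:(\mathsf T^\circ)^2A\to(\mathsf T^\circ)^2A$ is given by $c^\circ_A(a)=a$, $c^\circ_A(\mathsf da)=\mathsf d'a$, $c^\circ_A(\mathsf d'a)=\mathsf da$, $c^\circ_A(\mathsf d'\mathsf da)=\mathsf d'\mathsf da$; (vii) a natural negative map whose opposite $n^\circ_A:\mathsf T^\circ A\to\mathsf T^\circ A$ is given by $n^\circ_A(a)=a$, $n^\circ_A(\mathsf da)=-\mathsf da$. Here $a$ ranges over $A$, and all maps are the morphisms of divided power algebras determined by the indicated values on generators.
   Context: Divided power algebras. A divided power algebra over $\mathbb F$ is a commutative associative non-unital $\mathbb F$-algebra $(A,* )$ (product also written by concatenation) with functions $a\mapsto a^{[n]}$, $A\to A$, for all integers $n\ge1$, such that for all $a,b\in A$, $\lambda\in\mathbb F$: $(\lambda a)^{[n]}=\lambda^na^{[n]}$; $a^{[m]}*a^{[n]}=\binom{m+n}{m}a^{[m+n]}$; $(a+b)^{[n]}=a^{[n]}+\sum_{l=1}^{n-1}a^{[l]}*b^{[n-l]}+b^{[n]}$; $a^{[1]}=a$; $(a*b)^{[n]}=n!\,a^{[n]}*b^{[n]}=a^{*n}*b^{[n]}=a^{[n]}*b^{*n}$; $(a^{[n]})^{[m]}=\frac{(mn)!}{m!(n!)^m}a^{[mn]}$. Morphisms are algebra morphisms commuting with all $(-)^{[n]}$. $\Gamma_{\mathrm{alg}}$ is the resulting category; $U(A)$ is the underlying commutative (non-unital) algebra of $A$; modules over $U(A)$ are taken in the non-unital sense. Free divided power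 $A$-algebra. A divided power $A$-algebra is a morphism $f:A\to B$ of divided power algebras; $B$ is then a $U(A)$-module via $f$. The functor sending $f:A\to B$ to the $U(A)$-module $B$ has a left adjoint, denoted $M\mapsto\Gamma^+_A(M)$. Strongly abelian Kähler differentials. $\Omega_{U(A)}$ is the quotient of the free $U(A)$-module on symbols $\mathsf da$ ($a\in A$) by $\mathsf d(a+\lambda b)=\mathsf da+\lambda\,\mathsf db$ and $\mathsf d(ab)=a\,\mathsf db+b\,\mathsf da$ ($a,b\in A$, $\lambda\in\mathbb F$). $\Omega^1_A$ is the quotient of $\Omega_{U(A)}$ by the submodule generated by the elements $\mathsf d(a^{[n]})-a^{[n-1]}\mathsf da$, $a\in A$, $n\ge2$. The functor $\mathsf T^\circ$. $\mathsf T^\circ A=\Gamma^+_A(\Omega^1_A)$ is generated, as a divided power algebra, by (the images of) $a$ and $\mathsf da$ for $a\in A$. On morphisms $f:A\to B$ of divided power algebras, $\mathsf T^\circ(f)(a)=f(a)$, $\mathsf T^\circ(f)(\mathsf da)=\mathsf d(f(a))$. The iterate $(\mathsf T^\circ)^2A=\mathsf T^\circ(\mathsf T^\circ A)$ is generated by $a,\mathsf da,\mathsf d'a,\mathsf d'\mathsf da$ for $a\in A$, where $\mathsf d'$ is the universal derivation for the outer application of $\mathsf T^\circ$. Rosický tangent structure on a category $\mathbb X$ (Cockett–Cruttwell; here used with $\mathbb X=\Gamma_{\mathrm{alg}}^{op}$). Data: a functor $\mathsf T:\mathbb X\to\mathbb X$ and natural transformations $p_A:\mathsf TA\to A$, $s_A:\mathsf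 T_2A\to \mathsf TA$, $z_A:A\to\mathsf TA$, $l_A:\mathsf TA\to\mathsf T^2A$, $c_A:\mathsf T^2A\to\mathsf T^2A$, $n_A:\mathsf TA\to\mathsf TA$, where for each $n$ the $n$-fold pullback $\mathsf T_nA$ of $p_A$ over $A$ (projections $q_j:\mathsf T_nA\to\mathsf TA$) exists and is preserved by each iterate $\mathsf T^m$. Axioms: - $(p_A,s_A,z_A)$ makes $p_A$ a commutative monoid in the slice $\mathbb X/A$, and $p_A n_A=p_A$, $s_A\langle 1,n_A\rangle=z_Ap_A$; - $\mathsf T(p_A)l_A=z_Ap_A$, $l_As_A=\mathsf T(s_A)\langle l_Aq_1,l_Aq_2\rangle$, $l_Az_A=\mathsf T(z_A)z_A$; - $p_{\mathsf TA}c_A=\mathsf T(p_A)$, $c_A\mathsf T(s_A)=s_{\mathsf TA}\langle c_A\mathsf T(q_1),c_A\mathsf T(q_2)\rangle$, $c_A\mathsf T(z_A)=z_{\mathsf TA}$; - $c_Ac_A=1$, $c_Al_A=l_A$, $\mathsf T(l_A)l_A=l_{\mathsf TA}l_A$, $\mathsf T(c_A)c_{\mathsf TA}\mathsf T(c_A)=c_{\mathsf TA}\mathsf T(c_A)c_{\mathsf TA}$, $c_{\mathsf TA}\mathsf T(c_A)l_{\mathsf TA}=\mathsf T(l_A)c_A$; - (universality) the map $\mathsf T(s_A)\langle l_Aq_1,z_{\mathsf TA}q_2\rangle:\mathsf T_2A\to\mathsf T^2A$, together with $p_Aq_1=p_Aq_2:\mathsf T_2A\to A$, exhibits $\mathsf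 T_2A$ as the pullback of $\mathsf T(p_A):\mathsf T^2A\to\mathsf TA$ along $z_A:A\to\mathsf TA$. *)

theory Defs
  imports "HOL-Algebra.Coset" "HOL-Algebra.FiniteProduct"
    "HOL-Computational_Algebra.Computational_Algebra"
begin

section \<open>Categories and tangent structures\<close>

record ('o, 'm) cat =
  ob :: "'o set"
  ar :: "'m set"
  src :: "'m \<Rightarrow> 'o"
  trg :: "'m \<Rightarrow> 'o"
  idn :: "'o \<Rightarrow> 'm"
  cmp :: "'m \<Rightarrow> 'm \<Rightarrow> 'm"  (infixr \<open>\<bullet>\<index>\<close> 65)

definition hom_set :: "('o, 'm) cat \<Rightarrow> 'o \<Rightarrow> 'o \<Rightarrow> 'm set" where
  "hom_set C A B = {f \<in> ar C. src C f = A \<and> trg C f = B}"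

definition opposite :: "('o, 'm) cat \<Rightarrow> ('o, 'm) cat" where
  "opposite C = \<lparr>ob = ob C, ar = ar C, src = trg C, trg = src C, idn = idn C,
                 cmp = (\<lambda>g f. cmp C f g)\<rparr>"

locale category =
  fixes C :: "('o, 'm) cat" (structure)
  assumes src_ob: "f \<in> ar C \<Longrightarrow> src C f \<in> ob C"
    and trg_ob: "f \<in> ar C \<Longrightarrow> trg C f \<in> ob C"
    and id_hom: "A \<in> ob C \<Longrightarrow> idn C A \<in> hom_set C A A"
    and comp_hom: "f \<in> hom_set C A B \<Longrightarrow> g \<in> hom_set C B D \<Longrightarrow> g \<bullet> f \<in> hom_set C A D"
    and comp_id_right: "f \<in> hom_set C A B \<Longrightarrow> f \<bullet> idn C A = f"
    and comp_id_left: "f \<in> hom_set C A B \<Longrightarrow> idn C B \<bullet> f = f"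
    and comp_assoc: "f \<in> hom_set C A B \<Longrightarrow> g \<in> hom_set C B D \<Longrightarrow> h \<in> hom_set C D E
                       \<Longrightarrow> (h \<bullet> g) \<bullet> f = h \<bullet> (g \<bullet> f)"

locale endofunctor = category +
  fixes T :: "'o \<Rightarrow> 'o" and Ta :: "'m \<Rightarrow> 'm"
  assumes functor_ob: "A \<in> ob C \<Longrightarrow> T A \<in> ob C"
    and functor_hom: "f \<in> hom_set C A B \<Longrightarrow> Ta f \<in> hom_set C (T A) (T B)"
    and functor_id: "A \<in> ob C \<Longrightarrow> Ta (idn C A) = idn C (T A)"
    and functor_comp: "f \<in> hom_set C A B \<Longrightarrow> g \<in> hom_set C B D \<Longrightarrow> Ta (g \<bullet> f) = Ta g \<bullet> Ta f"

definition nat_transf ::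
  "('o, 'm) cat \<Rightarrow> ('o \<Rightarrow> 'o) \<Rightarrow> ('m \<Rightarrow> 'm) \<Rightarrow> ('o \<Rightarrow> 'o) \<Rightarrow> ('m \<Rightarrow> 'm) \<Rightarrow> ('o \<Rightarrow> 'm) \<Rightarrow> bool" where
  "nat_transf C Fo Fa Go Ga \<eta> \<longleftrightarrow>
     (\<forall>A \<in> ob C. \<eta> A \<in> hom_set C (Fo A) (Go A)) \<and>
     (\<forall>f \<in> ar C. cmp C (\<eta> (trg C f)) (Fa f) = cmp C (Ga f) (\<eta> (src C f)))"

definition is_pullback :: "('o, 'm) cat \<Rightarrow> 'm \<Rightarrow> 'm \<Rightarrow> 'o \<Rightarrow> 'm \<Rightarrow> 'm \<Rightarrow> bool" where
  "is_pullback C f g P u v \<longleftrightarrow>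
     f \<in> ar C \<and> g \<in> ar C \<and> trg C f = trg C g \<and>
     u \<in> hom_set C P (src C f) \<and> v \<in> hom_set C P (src C g) \<and> cmp C f u = cmp C g v \<and>
     (\<forall>X u' v'. u' \<in> hom_set C X (src C f) \<and> v' \<in> hom_set C X (src C g) \<and> cmp C f u' = cmp C g v'
        \<longrightarrow> (\<exists>!h. h \<in> hom_set C X P \<and> cmp C u h = u' \<and> cmp C v h = v'))"

text \<open>The \<open>n\<close>-fold pullback of \<open>p : E \<rightarrow> A\<close> with itself over \<open>A\<close>: the object \<open>P\<close> with projections
  \<open>q 1, \<dots>, q n\<close> to \<open>E\<close>.  The leg \<open>b : P \<rightarrow> A\<close> is determined by the \<open>q j\<close> if \<open>n > 0\<close>;
  for \<open>n = 0\<close> it makes the empty pullback over \<open>A\<close> equal to \<open>A\<close> up to isomorphism.\<close>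

definition is_fibre_power :: "('o, 'm) cat \<Rightarrow> 'm \<Rightarrow> nat \<Rightarrow> 'o \<Rightarrow> 'm \<Rightarrow> (nat \<Rightarrow> 'm) \<Rightarrow> bool" where
  "is_fibre_power C p n P b q \<longleftrightarrow>
     p \<in> ar C \<and> b \<in> hom_set C P (trg C p) \<and>
     (\<forall>j\<in>{1..n}. q j \<in> hom_set C P (src C p) \<and> cmp C p (q j) = b) \<and>
     (\<forall>X r u. r \<in> hom_set C X (trg C p) \<and>
        (\<forall>j\<in>{1..n}. u j \<in> hom_set C X (src C p) \<and> cmp C p (u j) = r)
        \<longrightarrow> (\<exists>!h. h \<in> hom_set C X P \<and> cmp C b h = r \<and> (\<forall>j\<in>{1..n}. cmp C (q j) h = u j)))"

text \<open>The arrow \<open>\<langle>u, v\<rangle>\<close> into a twofold pullback with projections \<open>q1\<close>, \<open>q2\<close>.\<close>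

definition pairing :: "('o, 'm) cat \<Rightarrow> 'm \<Rightarrow> 'm \<Rightarrow> 'm \<Rightarrow> 'm \<Rightarrow> 'm" where
  "pairing C q1 q2 u v =
     (THE h. h \<in> hom_set C (src C u) (src C q1) \<and> cmp C q1 h = u \<and> cmp C q2 h = v)"

text \<open>The \<open>n\<close>-fold coproduct, in the category under \<open>A\<close>, of the objects \<open>X j : A \<rightarrow> X\<^sub>j\<close>,
  \<open>j = 1, \<dots>, n\<close>, with structure arrow \<open>b : A \<rightarrow> P\<close> and injections \<open>\<iota> j : X\<^sub>j \<rightarrow> P\<close>.\<close>

definition is_coproduct_under ::
  "('o, 'm) cat \<Rightarrow> 'o \<Rightarrow> nat \<Rightarrow> (nat \<Rightarrow> 'm) \<Rightarrow> 'o \<Rightarrow> 'm \<Rightarrow> (nat \<Rightarrow> 'm) \<Rightarrow> bool" where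
  "is_coproduct_under C A n X P b \<iota> \<longleftrightarrow>
     A \<in> ob C \<and> (\<forall>j\<in>{1..n}. X j \<in> ar C \<and> src C (X j) = A) \<and>
     b \<in> hom_set C A P \<and>
     (\<forall>j\<in>{1..n}. \<iota> j \<in> hom_set C (trg C (X j)) P \<and> cmp C (\<iota> j) (X j) = b) \<and>
     (\<forall>Y r u. r \<in> hom_set C A Y \<and>
        (\<forall>j\<in>{1..n}. u j \<in> hom_set C (trg C (X j)) Y \<and> cmp C (u j) (X j) = r)
        \<longrightarrow> (\<exists>!h. h \<in> hom_set C P Y \<and> cmp C h b = r \<and> (\<forall>j\<in>{1..n}. cmp C h (\<iota> j) = u j)))"

text \<open>\<open>Tn k A\<close> is the \<open>k\<close>-fold pullback of \<open>p A\<close>, with projections \<open>q k 1 A, \<dots>, q k k A\<close>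
  and map \<open>b k A\<close> to \<open>A\<close>.\<close>

locale rosicky_tangent_structure = endofunctor +
  fixes p :: "'o \<Rightarrow> 'm"
    and Tn :: "nat \<Rightarrow> 'o \<Rightarrow> 'o" and b :: "nat \<Rightarrow> 'o \<Rightarrow> 'm" and q :: "nat \<Rightarrow> nat \<Rightarrow> 'o \<Rightarrow> 'm"
    and s z l c n :: "'o \<Rightarrow> 'm"
  assumes p_natural: "nat_transf C T Ta (\<lambda>A. A) (\<lambda>f. f) p"
    and fibre_powers: "A \<in> ob C \<Longrightarrow> is_fibre_power C (p A) k (Tn k A) (b k A) (\<lambda>j. q k j A)"
    and fibre_powers_preserved: "A \<in> ob C \<Longrightarrow>
          is_fibre_power C ((Ta ^^ m) (p A)) k ((T ^^ m) (Tn k A)) ((Ta ^^ m) (b k A))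
            (\<lambda>j. (Ta ^^ m) (q k j A))"
    and s_natural: "nat_transf C (Tn 2)
          (\<lambda>f. pairing C (q 2 1 (trg C f)) (q 2 2 (trg C f))
                 (Ta f \<bullet> q 2 1 (src C f)) (Ta f \<bullet> q 2 2 (src C f)))
          T Ta s"
    and z_natural: "nat_transf C (\<lambda>A. A) (\<lambda>f. f) T Ta z"
    and l_natural: "nat_transf C T Ta (\<lambda>A. T (T A)) (\<lambda>f. Ta (Ta f)) l"
    and c_natural: "nat_transf C (\<lambda>A. T (T A)) (\<lambda>f. Ta (Ta f)) (\<lambda>A. T (T A)) (\<lambda>f. Ta (Ta f)) c"
    and n_natural: "nat_transf C T Ta T Ta n"

    and sum_over: "A \<in> ob C \<Longrightarrow> p A \<bullet> s A = b 2 A"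
    and zero_over: "A \<in> ob C \<Longrightarrow> p A \<bullet> z A = idn C A"
    and sum_assoc: "A \<in> ob C \<Longrightarrow>
          s A \<bullet> pairing C (q 2 1 A) (q 2 2 A)
                  (s A \<bullet> pairing C (q 2 1 A) (q 2 2 A) (q 3 1 A) (q 3 2 A)) (q 3 3 A)
        = s A \<bullet> pairing C (q 2 1 A) (q 2 2 A)
                  (q 3 1 A) (s A \<bullet> pairing C (q 2 1 A) (q 2 2 A) (q 3 2 A) (q 3 3 A))"
    and sum_comm: "A \<in> ob C \<Longrightarrow> s A \<bullet> pairing C (q 2 1 A) (q 2 2 A) (q 2 2 A) (q 2 1 A) = s A"
    and sum_zero: "A \<in> ob C \<Longrightarrow>
          s A \<bullet> pairing C (q 2 1 A) (q 2 2 A) (idn C (T A)) (z A \<bullet> p A) = idn C (T A)"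
    and neg_over: "A \<in> ob C \<Longrightarrow> p A \<bullet> n A = p A"
    and sum_neg: "A \<in> ob C \<Longrightarrow>
          s A \<bullet> pairing C (q 2 1 A) (q 2 2 A) (idn C (T A)) (n A) = z A \<bullet> p A"

    and lift_proj: "A \<in> ob C \<Longrightarrow> Ta (p A) \<bullet> l A = z A \<bullet> p A"
    and lift_sum: "A \<in> ob C \<Longrightarrow>
          l A \<bullet> s A = Ta (s A) \<bullet>
            pairing C (Ta (q 2 1 A)) (Ta (q 2 2 A)) (l A \<bullet> q 2 1 A) (l A \<bullet> q 2 2 A)"
    and lift_zero: "A \<in> ob C \<Longrightarrow> l A \<bullet> z A = Ta (z A) \<bullet> z A"

    and flip_proj: "A \<in> ob C \<Longrightarrow> p (T A) \<bullet> c A = Ta (p A)"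
    and flip_sum: "A \<in> ob C \<Longrightarrow>
          c A \<bullet> Ta (s A) = s (T A) \<bullet>
            pairing C (q 2 1 (T A)) (q 2 2 (T A)) (c A \<bullet> Ta (q 2 1 A)) (c A \<bullet> Ta (q 2 2 A))"
    and flip_zero: "A \<in> ob C \<Longrightarrow> c A \<bullet> Ta (z A) = z (T A)"

    and flip_flip: "A \<in> ob C \<Longrightarrow> c A \<bullet> c A = idn C (T (T A))"
    and flip_lift: "A \<in> ob C \<Longrightarrow> c A \<bullet> l A = l A"
    and lift_lift: "A \<in> ob C \<Longrightarrow> Ta (l A) \<bullet> l A = l (T A) \<bullet> l A"
    and flip_braid: "A \<in> ob C \<Longrightarrow>
          Ta (c A) \<bullet> c (T A) \<bullet> Ta (c A) = c (T A) \<bullet> Ta (c A) \<bullet> c (T A)"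
    and flip_flip_lift: "A \<in> ob C \<Longrightarrow>
          c (T A) \<bullet> Ta (c A) \<bullet> l (T A) = Ta (l A) \<bullet> c A"

    and lift_universal: "A \<in> ob C \<Longrightarrow>
          is_pullback C (Ta (p A)) (z A) (Tn 2 A)
            (Ta (s A) \<bullet>
              pairing C (Ta (q 2 1 A)) (Ta (q 2 2 A)) (l A \<bullet> q 2 1 A) (z (T A) \<bullet> q 2 2 A))
            (p A \<bullet> q 2 1 A)"


section \<open>Non-unital algebras and their modules\<close>

record ('f, 'a) vec = "'a partial_object" +
  vzero :: "'a"  (\<open>\<zero>\<index>\<close>)
  vadd :: "'a \<Rightarrow> 'a \<Rightarrow> 'a"  (infixl \<open>\<oplus>\<index>\<close> 65)
  vscale :: "'f \<Rightarrow> 'a \<Rightarrow> 'a"  (infixr \<open>\<cdot>\<index>\<close> 75)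

definition additive :: "('f, 'a, 'z) vec_scheme \<Rightarrow> 'a monoid" where
  "additive V = \<lparr>carrier = carrier V, monoid.mult = vadd V, one = vzero V\<rparr>"

definition vneg :: "('f, 'a, 'z) vec_scheme \<Rightarrow> 'a \<Rightarrow> 'a" where
  "vneg V x = inv\<^bsub>additive V\<^esub> x"

definition vminus :: "('f, 'a, 'z) vec_scheme \<Rightarrow> 'a \<Rightarrow> 'a \<Rightarrow> 'a" where
  "vminus V x y = vadd V x (vneg V y)"

locale vect =
  fixes V :: "('f::field, 'a, 'z) vec_scheme" (structure)
  assumes additive_group: "comm_group (additive V)"
    and scale_closed: "x \<in> carrier V \<Longrightarrow> k \<cdot> x \<in> carrier V"
    and scale_one: "x \<in> carrier V \<Longrightarrow> 1 \<cdot> x = x"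
    and scale_scale: "x \<in> carrier V \<Longrightarrow> k \<cdot> k' \<cdot> x = (k * k') \<cdot> x"
    and scale_add_left: "x \<in> carrier V \<Longrightarrow> (k + k') \<cdot> x = k \<cdot> x \<oplus> k' \<cdot> x"
    and scale_add_right: "x \<in> carrier V \<Longrightarrow> y \<in> carrier V \<Longrightarrow> k \<cdot> (x \<oplus> y) = k \<cdot> x \<oplus> k \<cdot> y"

record ('f, 'a) nalg = "('f, 'a) vec" +
  amult :: "'a \<Rightarrow> 'a \<Rightarrow> 'a"  (infixl \<open>\<star>\<index>\<close> 70)

locale comm_nalg = vect A for A :: "('f::field, 'a, 'z) nalg_scheme" (structure) +
  assumes mult_closed: "x \<in> carrier A \<Longrightarrow> y \<in> carrier A \<Longrightarrow> x \<star> y \<in> carrier A"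
    and mult_assoc: "x \<in> carrier A \<Longrightarrow> y \<in> carrier A \<Longrightarrow> w \<in> carrier A
                       \<Longrightarrow> (x \<star> y) \<star> w = x \<star> (y \<star> w)"
    and mult_comm: "x \<in> carrier A \<Longrightarrow> y \<in> carrier A \<Longrightarrow> x \<star> y = y \<star> x"
    and mult_add: "x \<in> carrier A \<Longrightarrow> y \<in> carrier A \<Longrightarrow> w \<in> carrier A
                       \<Longrightarrow> x \<star> (y \<oplus> w) = x \<star> y \<oplus> x \<star> w"
    and mult_scale: "x \<in> carrier A \<Longrightarrow> y \<in> carrier A \<Longrightarrow> x \<star> (k \<cdot> y) = k \<cdot> (x \<star> y)"

text \<open>\<open>npow A n x\<close> is the \<open>n\<close>-th power of \<open>x\<close>; as there is no unit, it is meant for \<open>n \<ge> 1\<close>.\<close>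

definition npow :: "('f, 'a, 'z) nalg_scheme \<Rightarrow> nat \<Rightarrow> 'a \<Rightarrow> 'a" where
  "npow A n x = (amult A x ^^ (n - 1)) x"

record ('f, 'r, 'a) umod = "('f, 'a) vec" +
  act :: "'r \<Rightarrow> 'a \<Rightarrow> 'a"

locale umodule = comm_nalg A + M: vect M
  for A :: "('f::field, 'r, 'z) nalg_scheme" and M :: "('f, 'r, 'a) umod" +
  assumes act_closed: "a \<in> carrier A \<Longrightarrow> m \<in> carrier M \<Longrightarrow> act M a m \<in> carrier M"
    and act_act: "a \<in> carrier A \<Longrightarrow> a' \<in> carrier A \<Longrightarrow> m \<in> carrier M
                    \<Longrightarrow> act M (a \<star>\<^bsub>A\<^esub> a') m = act M a (act M a' m)"
    and act_add_left: "a \<in> carrier A \<Longrightarrow> a' \<in> carrier A \<Longrightarrow> m \<in> carrier M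
                    \<Longrightarrow> act M (a \<oplus>\<^bsub>A\<^esub> a') m = act M a m \<oplus>\<^bsub>M\<^esub> act M a' m"
    and act_add_right: "a \<in> carrier A \<Longrightarrow> m \<in> carrier M \<Longrightarrow> m' \<in> carrier M
                    \<Longrightarrow> act M a (m \<oplus>\<^bsub>M\<^esub> m') = act M a m \<oplus>\<^bsub>M\<^esub> act M a m'"
    and act_scale_left: "a \<in> carrier A \<Longrightarrow> m \<in> carrier M
                    \<Longrightarrow> act M (k \<cdot>\<^bsub>A\<^esub> a) m = k \<cdot>\<^bsub>M\<^esub> act M a m"
    and act_scale_right: "a \<in> carrier A \<Longrightarrow> m \<in> carrier M
                    \<Longrightarrow> act M a (k \<cdot>\<^bsub>M\<^esub> m) = k \<cdot>\<^bsub>M\<^esub> act M a m"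

definition umod_hom ::
  "('f::field, 'r, 'z) nalg_scheme \<Rightarrow> ('f, 'r, 'a) umod \<Rightarrow> ('f, 'r, 'b) umod \<Rightarrow> ('a \<Rightarrow> 'b) set" where
  "umod_hom A M N = {h \<in> carrier M \<rightarrow>\<^sub>E carrier N.
     (\<forall>x\<in>carrier M. \<forall>y\<in>carrier M. h (x \<oplus>\<^bsub>M\<^esub> y) = h x \<oplus>\<^bsub>N\<^esub> h y) \<and>
     (\<forall>k. \<forall>x\<in>carrier M. h (k \<cdot>\<^bsub>M\<^esub> x) = k \<cdot>\<^bsub>N\<^esub> h x) \<and>
     (\<forall>a\<in>carrier A. \<forall>x\<in>carrier M. h (act M a x) = act N a (h x))}"

text \<open>The free non-unital \<open>A\<close>-module on a set \<open>S\<close> of symbols is the free module on \<open>S\<close> over the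
  unitalization \<open>\<bbbF> \<oplus> A\<close>; its elements are the finitely supported families of pairs in \<open>\<bbbF> \<times> A\<close>.\<close>

definition free_umod ::
  "('f::field, 'r, 'z) nalg_scheme \<Rightarrow> 's set \<Rightarrow> ('f, 'r, 's \<Rightarrow> 'f \<times> 'r) umod" where
  "free_umod A S =
     \<lparr>carrier = {v. (\<forall>s. snd (v s) \<in> carrier A) \<and> finite {s. v s \<noteq> (0, \<zero>\<^bsub>A\<^esub>)} \<and>
                    {s. v s \<noteq> (0, \<zero>\<^bsub>A\<^esub>)} \<subseteq> S},
      vzero = (\<lambda>s. (0, \<zero>\<^bsub>A\<^esub>)),
      vadd = (\<lambda>v w s. (fst (v s) + fst (w s), snd (v s) \<oplus>\<^bsub>A\<^esub> snd (w s))),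
      vscale = (\<lambda>k v s. (k * fst (v s), k \<cdot>\<^bsub>A\<^esub> snd (v s))),
      act = (\<lambda>a v s. (0, fst (v s) \<cdot>\<^bsub>A\<^esub> a \<oplus>\<^bsub>A\<^esub> a \<star>\<^bsub>A\<^esub> snd (v s)))\<rparr>"

definition free_gen :: "('f::field, 'r, 'z) nalg_scheme \<Rightarrow> 's \<Rightarrow> 's \<Rightarrow> 'f \<times> 'r" where
  "free_gen A x = (\<lambda>s. if s = x then (1, \<zero>\<^bsub>A\<^esub>) else (0, \<zero>\<^bsub>A\<^esub>))"

definition is_submodule ::
  "('f::field, 'r, 'z) nalg_scheme \<Rightarrow> ('f, 'r, 'a) umod \<Rightarrow> 'a set \<Rightarrow> bool" where
  "is_submodule A M N \<longleftrightarrow> N \<subseteq> carrier M \<and> \<zero>\<^bsub>M\<^esub> \<in> N \<and>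
     (\<forall>x\<in>N. \<forall>y\<in>N. x \<oplus>\<^bsub>M\<^esub> y \<in> N) \<and> (\<forall>k. \<forall>x\<in>N. k \<cdot>\<^bsub>M\<^esub> x \<in> N) \<and>
     (\<forall>a\<in>carrier A. \<forall>x\<in>N. act M a x \<in> N)"

definition submodule_generated ::
  "('f::field, 'r, 'z) nalg_scheme \<Rightarrow> ('f, 'r, 'a) umod \<Rightarrow> 'a set \<Rightarrow> 'a set" where
  "submodule_generated A M R = \<Inter>{N. is_submodule A M N \<and> R \<subseteq> N}"

definition residue_class :: "('f::field, 'a, 'z) vec_scheme \<Rightarrow> 'a set \<Rightarrow> 'a \<Rightarrow> 'a set" where
  "residue_class M N x = N #>\<^bsub>additive M\<^esub> x"

definition quotient_umod :: "('f::field, 'r, 'a) umod \<Rightarrow> 'a set \<Rightarrow> ('f, 'r, 'a set) umod" where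
  "quotient_umod M N =
     \<lparr>carrier = carrier (additive M Mod N),
      vzero = \<one>\<^bsub>additive M Mod N\<^esub>,
      vadd = monoid.mult (additive M Mod N),
      vscale = (\<lambda>k X. \<Union>x\<in>X. residue_class M N (k \<cdot>\<^bsub>M\<^esub> x)),
      act = (\<lambda>a X. \<Union>x\<in>X. residue_class M N (act M a x))\<rparr>"

text \<open>The module of Kaehler differentials \<open>\<Omega>\<close> of the underlying algebra and its universal derivation.\<close>

definition kaehler_relations :: "('f::field, 'a, 'z) nalg_scheme \<Rightarrow> ('a \<Rightarrow> 'f \<times> 'a) set" where
  "kaehler_relations A =
     (let F = free_umod A (carrier A); d = free_gen A in
      {vminus F (d (a \<oplus>\<^bsub>A\<^esub> k \<cdot>\<^bsub>A\<^esub> b)) (d a \<oplus>\<^bsub>F\<^esub> k \<cdot>\<^bsub>F\<^esub> d b) | a b k.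
         a \<in> carrier A \<and> b \<in> carrier A} \<union>
      {vminus F (d (a \<star>\<^bsub>A\<^esub> b)) (act F a (d b) \<oplus>\<^bsub>F\<^esub> act F b (d a)) | a b.
         a \<in> carrier A \<and> b \<in> carrier A})"

definition kaehler ::
  "('f::field, 'a, 'z) nalg_scheme \<Rightarrow> ('f, 'a, ('a \<Rightarrow> 'f \<times> 'a) set) umod" where
  "kaehler A = quotient_umod (free_umod A (carrier A))
     (submodule_generated A (free_umod A (carrier A)) (kaehler_relations A))"

definition kaehler_d :: "('f::field, 'a, 'z) nalg_scheme \<Rightarrow> 'a \<Rightarrow> ('a \<Rightarrow> 'f \<times> 'a) set" where
  "kaehler_d A a = residue_class (free_umod A (carrier A))
     (submodule_generated A (free_umod A (carrier A)) (kaehler_relations A)) (free_gen A a)"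


section \<open>Divided power algebras\<close>

record ('f, 'a) dpa = "('f, 'a) nalg" +
  dpow :: "nat \<Rightarrow> 'a \<Rightarrow> 'a"

text \<open>Only the divided powers with index at least 1 are meaningful.\<close>

locale dp_algebra = comm_nalg A for A :: "('f::field, 'a) dpa" (structure) +
  assumes dpow_closed: "n \<ge> 1 \<Longrightarrow> a \<in> carrier A \<Longrightarrow> dpow A n a \<in> carrier A"
    and dpow_scale: "n \<ge> 1 \<Longrightarrow> a \<in> carrier A \<Longrightarrow> dpow A n (k \<cdot> a) = k ^ n \<cdot> dpow A n a"
    and dpow_mult_dpow: "m \<ge> 1 \<Longrightarrow> n \<ge> 1 \<Longrightarrow> a \<in> carrier A \<Longrightarrow>
          dpow A m a \<star> dpow A n a = of_nat ((m + n) choose m) \<cdot> dpow A (m + n) a"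
    and dpow_add: "n \<ge> 1 \<Longrightarrow> a \<in> carrier A \<Longrightarrow> b \<in> carrier A \<Longrightarrow>
          dpow A n (a \<oplus> b) =
            dpow A n a \<oplus> finprod (additive A) (\<lambda>i. dpow A i a \<star> dpow A (n - i) b) {1..<n} \<oplus> dpow A n b"
    and dpow_one: "a \<in> carrier A \<Longrightarrow> dpow A 1 a = a"
    and dpow_mult: "n \<ge> 1 \<Longrightarrow> a \<in> carrier A \<Longrightarrow> b \<in> carrier A \<Longrightarrow>
          dpow A n (a \<star> b) = of_nat (fact n) \<cdot> (dpow A n a \<star> dpow A n b)"
    and dpow_mult_left: "n \<ge> 1 \<Longrightarrow> a \<in> carrier A \<Longrightarrow> b \<in> carrier A \<Longrightarrow>
          dpow A n (a \<star> b) = npow A n a \<star> dpow A n b"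
    and dpow_mult_right: "n \<ge> 1 \<Longrightarrow> a \<in> carrier A \<Longrightarrow> b \<in> carrier A \<Longrightarrow>
          dpow A n (a \<star> b) = dpow A n a \<star> npow A n b"
    and dpow_dpow: "m \<ge> 1 \<Longrightarrow> n \<ge> 1 \<Longrightarrow> a \<in> carrier A \<Longrightarrow>
          dpow A m (dpow A n a) = of_nat (fact (m * n) div (fact m * fact n ^ m)) \<cdot> dpow A (m * n) a"

definition dp_hom :: "('f::field, 'a) dpa \<Rightarrow> ('f, 'b) dpa \<Rightarrow> ('a \<Rightarrow> 'b) set" where
  "dp_hom A B = {h \<in> carrier A \<rightarrow>\<^sub>E carrier B.
     (\<forall>x\<in>carrier A. \<forall>y\<in>carrier A. h (x \<oplus>\<^bsub>A\<^esub> y) = h x \<oplus>\<^bsub>B\<^esub> h y) \<and>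
     (\<forall>k. \<forall>x\<in>carrier A. h (k \<cdot>\<^bsub>A\<^esub> x) = k \<cdot>\<^bsub>B\<^esub> h x) \<and>
     (\<forall>x\<in>carrier A. \<forall>y\<in>carrier A. h (x \<star>\<^bsub>A\<^esub> y) = h x \<star>\<^bsub>B\<^esub> h y) \<and>
     (\<forall>n\<ge>1. \<forall>x\<in>carrier A. h (dpow A n x) = dpow B n (h x))}"

text \<open>The category of divided power algebras over \<open>'f\<close> whose carriers are subsets of the universe
  type \<open>'u\<close>, which has to be large enough for free objects to exist in it.  An arrow is a
  triple of source, extensional function and target.\<close>

type_synonym ('f, 'u) dp_arrow = "('f, 'u) dpa \<times> ('u \<Rightarrow> 'u) \<times> ('f, 'u) dpa"

abbreviation fn :: "('f, 'u) dp_arrow \<Rightarrow> 'u \<Rightarrow> 'u" where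
  "fn f \<equiv> fst (snd f)"

definition Gamma_alg :: "(('f::field, 'u) dpa, ('f, 'u) dp_arrow) cat" where
  "Gamma_alg =
     \<lparr>ob = {A. dp_algebra A},
      ar = {(A, f, B). dp_algebra A \<and> dp_algebra B \<and> f \<in> dp_hom A B},
      src = fst,
      trg = (\<lambda>f. snd (snd f)),
      idn = (\<lambda>A. (A, \<lambda>x\<in>carrier A. x, A)),
      cmp = (\<lambda>g f. (fst f, compose (carrier (fst f)) (fn g) (fn f), snd (snd g)))\<rparr>"

text \<open>The algebra \<open>B\<close> as a module over \<open>A\<close> along \<open>f\<close>.\<close>

definition as_module :: "('f::field, 'b) dpa \<Rightarrow> ('a \<Rightarrow> 'b) \<Rightarrow> ('f, 'a, 'b) umod" where
  "as_module B f =
     \<lparr>carrier = carrier B, vzero = \<zero>\<^bsub>B\<^esub>, vadd = vadd B, vscale = vscale B,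
      act = (\<lambda>a x. f a \<star>\<^bsub>B\<^esub> x)\<rparr>"

text \<open>\<open>i : A \<rightarrow> B\<close>, together with \<open>\<eta> : M \<rightarrow> B\<close>, is the value at \<open>M\<close> of the left adjoint of the
  functor from divided power \<open>A\<close>-algebras to \<open>A\<close>-modules; \<open>\<eta>\<close> is the unit of the adjunction.\<close>

definition is_free_dp_algebra ::
  "('f::field, 'u) dpa \<Rightarrow> ('f, 'u, 'a) umod \<Rightarrow> ('f, 'u) dpa \<Rightarrow> ('u \<Rightarrow> 'u) \<Rightarrow> ('a \<Rightarrow> 'u) \<Rightarrow> bool" where
  "is_free_dp_algebra A M B i \<eta> \<longleftrightarrow>
     dp_algebra B \<and> i \<in> dp_hom A B \<and> \<eta> \<in> umod_hom A M (as_module B i) \<and>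
     (\<forall>D g \<theta>. dp_algebra (D :: ('f, 'u) dpa) \<and> g \<in> dp_hom A D \<and> \<theta> \<in> umod_hom A M (as_module D g)
        \<longrightarrow> (\<exists>!h. h \<in> dp_hom B D \<and> (\<forall>a\<in>carrier A. h (i a) = g a) \<and>
                  (\<forall>m\<in>carrier M. h (\<eta> m) = \<theta> m)))"

definition Gamma_plus ::
  "('f::field, 'u) dpa \<Rightarrow> ('f, 'u, 'a) umod \<Rightarrow> ('f, 'u) dpa \<times> ('u \<Rightarrow> 'u) \<times> ('a \<Rightarrow> 'u)" where
  "Gamma_plus A M = (SOME (B, i, \<eta>). is_free_dp_algebra A M B i \<eta>)"


section \<open>Strongly abelian differentials and the tangent bundle\<close>

definition Omega1_relations :: "('f::field, 'a) dpa \<Rightarrow> ('a \<Rightarrow> 'f \<times> 'a) set set" where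
  "Omega1_relations A =
     {vminus (kaehler A) (kaehler_d A (dpow A n a)) (act (kaehler A) (dpow A (n - 1) a) (kaehler_d A a)) | a n.
        a \<in> carrier A \<and> n \<ge> 2}"

definition Omega1 :: "('f::field, 'a) dpa \<Rightarrow> ('f, 'a, ('a \<Rightarrow> 'f \<times> 'a) set set) umod" where
  "Omega1 A = quotient_umod (kaehler A) (submodule_generated A (kaehler A) (Omega1_relations A))"

definition Omega1_d :: "('f::field, 'a) dpa \<Rightarrow> 'a \<Rightarrow> ('a \<Rightarrow> 'f \<times> 'a) set set" where
  "Omega1_d A a =
     residue_class (kaehler A) (submodule_generated A (kaehler A) (Omega1_relations A)) (kaehler_d A a)"

definition tan_ob :: "('f::field, 'u) dpa \<Rightarrow> ('f, 'u) dpa" where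
  "tan_ob A = fst (Gamma_plus A (Omega1 A))"

text \<open>\<open>tan_in A a\<close> and \<open>tan_d A a\<close> are the elements of \<open>tan_ob A\<close> written \<open>a\<close> and \<open>da\<close>.  In
  \<open>tan_ob (tan_ob A)\<close>, the elements written \<open>a\<close>, \<open>da\<close>, \<open>d'a\<close>, \<open>d'da\<close> are, with \<open>T = tan_ob A\<close>,
  \<open>tan_in T (tan_in A a)\<close>, \<open>tan_in T (tan_d A a)\<close>, \<open>tan_d T (tan_in A a)\<close>, \<open>tan_d T (tan_d A a)\<close>.\<close>

definition tan_unit :: "('f::field, 'u) dpa \<Rightarrow> ('u \<Rightarrow> 'f \<times> 'u) set set \<Rightarrow> 'u" where
  "tan_unit A = snd (snd (Gamma_plus A (Omega1 A)))"

definition tan_in :: "('f::field, 'u) dpa \<Rightarrow> 'u \<Rightarrow> 'u" where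
  "tan_in A = fst (snd (Gamma_plus A (Omega1 A)))"

definition tan_d :: "('f::field, 'u) dpa \<Rightarrow> 'u \<Rightarrow> 'u" where
  "tan_d A a = tan_unit A (Omega1_d A a)"

text \<open>The structure maps below are arrows of the category of divided power algebras, hence opposites
  of the arrows of the tangent structure.\<close>

definition tan_proj :: "('f::field, 'u) dpa \<Rightarrow> ('f, 'u) dp_arrow" where
  "tan_proj A = (A, tan_in A, tan_ob A)"

definition tan_copower ::
  "nat \<Rightarrow> ('f::field, 'u) dpa \<Rightarrow> ('f, 'u) dpa \<times> ('f, 'u) dp_arrow \<times> (nat \<Rightarrow> ('f, 'u) dp_arrow)" where
  "tan_copower k A = (SOME (P, b, \<iota>). is_coproduct_under Gamma_alg A k (\<lambda>j. tan_proj A) P b \<iota>)"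

definition tan_n :: "nat \<Rightarrow> ('f::field, 'u) dpa \<Rightarrow> ('f, 'u) dpa" where
  "tan_n k A = fst (tan_copower k A)"

definition tan_n_base :: "nat \<Rightarrow> ('f::field, 'u) dpa \<Rightarrow> ('f, 'u) dp_arrow" where
  "tan_n_base k A = fst (snd (tan_copower k A))"

definition tan_n_inj :: "nat \<Rightarrow> nat \<Rightarrow> ('f::field, 'u) dpa \<Rightarrow> ('f, 'u) dp_arrow" where
  "tan_n_inj k j A = snd (snd (tan_copower k A)) j"

text \<open>\<open>tan_n_in k A a\<close> and \<open>tan_n_d k j A a\<close> are the elements \<open>a\<close> and \<open>d\<^sub>j a\<close> of \<open>tan_n k A\<close>.\<close>

definition tan_n_in :: "nat \<Rightarrow> ('f::field, 'u) dpa \<Rightarrow> 'u \<Rightarrow> 'u" where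
  "tan_n_in k A a = fn (tan_n_base k A) a"

definition tan_n_d :: "nat \<Rightarrow> nat \<Rightarrow> ('f::field, 'u) dpa \<Rightarrow> 'u \<Rightarrow> 'u" where
  "tan_n_d k j A a = fn (tan_n_inj k j A) (tan_d A a)"

definition on_generators_functor ::
  "('f::field, 'u) dp_arrow \<Rightarrow> ('u \<Rightarrow> 'u) \<Rightarrow> bool" where
  "on_generators_functor f h \<longleftrightarrow>
     (case f of (A, \<phi>, B) \<Rightarrow> h \<in> dp_hom (tan_ob A) (tan_ob B) \<and>
       (\<forall>a\<in>carrier A. h (tan_in A a) = tan_in B (\<phi> a) \<and> h (tan_d A a) = tan_d B (\<phi> a)))"

definition on_generators_sum :: "('f::field, 'u) dpa \<Rightarrow> ('u \<Rightarrow> 'u) \<Rightarrow> bool" where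
  "on_generators_sum A h \<longleftrightarrow> h \<in> dp_hom (tan_ob A) (tan_n 2 A) \<and>
     (\<forall>a\<in>carrier A. h (tan_in A a) = tan_n_in 2 A a \<and>
        h (tan_d A a) = tan_n_d 2 1 A a \<oplus>\<^bsub>tan_n 2 A\<^esub> tan_n_d 2 2 A a)"

definition on_generators_zero :: "('f::field, 'u) dpa \<Rightarrow> ('u \<Rightarrow> 'u) \<Rightarrow> bool" where
  "on_generators_zero A h \<longleftrightarrow> h \<in> dp_hom (tan_ob A) A \<and>
     (\<forall>a\<in>carrier A. h (tan_in A a) = a \<and> h (tan_d A a) = \<zero>\<^bsub>A\<^esub>)"

definition on_generators_lift :: "('f::field, 'u) dpa \<Rightarrow> ('u \<Rightarrow> 'u) \<Rightarrow> bool" where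
  "on_generators_lift A h \<longleftrightarrow> (let T = tan_ob A in h \<in> dp_hom (tan_ob T) T \<and>
     (\<forall>a\<in>carrier A.
        h (tan_in T (tan_in A a)) = tan_in A a \<and>
        h (tan_in T (tan_d A a)) = \<zero>\<^bsub>T\<^esub> \<and>
        h (tan_d T (tan_in A a)) = \<zero>\<^bsub>T\<^esub> \<and>
        h (tan_d T (tan_d A a)) = tan_d A a))"

definition on_generators_flip :: "('f::field, 'u) dpa \<Rightarrow> ('u \<Rightarrow> 'u) \<Rightarrow> bool" where
  "on_generators_flip A h \<longleftrightarrow> (let T = tan_ob A in h \<in> dp_hom (tan_ob T) (tan_ob T) \<and>
     (\<forall>a\<in>carrier A.
        h (tan_in T (tan_in A a)) = tan_in T (tan_in A a) \<and>
        h (tan_in T (tan_d A a)) = tan_d T (tan_in A a) \<and>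
        h (tan_d T (tan_in A a)) = tan_in T (tan_d A a) \<and>
        h (tan_d T (tan_d A a)) = tan_d T (tan_d A a)))"

definition on_generators_neg :: "('f::field, 'u) dpa \<Rightarrow> ('u \<Rightarrow> 'u) \<Rightarrow> bool" where
  "on_generators_neg A h \<longleftrightarrow> h \<in> dp_hom (tan_ob A) (tan_ob A) \<and>
     (\<forall>a\<in>carrier A. h (tan_in A a) = tan_in A a \<and> h (tan_d A a) = vneg (tan_ob A) (tan_d A a))"

definition tan_ar :: "('f::field, 'u) dp_arrow \<Rightarrow> ('f, 'u) dp_arrow" where
  "tan_ar f = (tan_ob (fst f), THE h. on_generators_functor f h, tan_ob (snd (snd f)))"

definition tan_sum :: "('f::field, 'u) dpa \<Rightarrow> ('f, 'u) dp_arrow" where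
  "tan_sum A = (tan_ob A, THE h. on_generators_sum A h, tan_n 2 A)"

definition tan_zero :: "('f::field, 'u) dpa \<Rightarrow> ('f, 'u) dp_arrow" where
  "tan_zero A = (tan_ob A, THE h. on_generators_zero A h, A)"

definition tan_lift :: "('f::field, 'u) dpa \<Rightarrow> ('f, 'u) dp_arrow" where
  "tan_lift A = (tan_ob (tan_ob A), THE h. on_generators_lift A h, tan_ob A)"

definition tan_flip :: "('f::field, 'u) dpa \<Rightarrow> ('f, 'u) dp_arrow" where
  "tan_flip A = (tan_ob (tan_ob A), THE h. on_generators_flip A h, tan_ob (tan_ob A))"

definition tan_neg :: "('f::field, 'u) dpa \<Rightarrow> ('f, 'u) dp_arrow" where
  "tan_neg A = (tan_ob A, THE h. on_generators_neg A h, tan_ob A)"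

end

theory Submission
  imports Defs
begin

text \<open>The dual numbers \<open>D[\<epsilon>]\<close> over a divided power algebra \<open>D\<close> carry the divided powers
  \<open>(x + u\<epsilon>)\<^sup>[\<^sup>n\<^sup>] = x\<^sup>[\<^sup>n\<^sup>] + x\<^sup>[\<^sup>n\<^sup>-\<^sup>1\<^sup>]u\<epsilon>\<close>, and a morphism \<open>A \<rightarrow> D[\<epsilon>]\<close> is the same as a morphism \<open>A \<rightarrow> D\<close>
  together with a strongly abelian derivation along it.  Hence the tangent functor is left adjoint to
  \<open>D \<mapsto> D[\<epsilon>]\<close>.  It follows that the functor preserves the coproducts defining \<open>T\<^sub>n\<close>, that a morphism out of an iterate
  of it is determined by its values on the generators \<open>a\<close>, \<open>da\<close>, \<open>d'a\<close>, \<open>d'da\<close>, \<open>\<dots>\<close>, and that lift and flip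
  come from the maps \<open>\<epsilon> \<mapsto> \<epsilon>\<epsilon>'\<close> and \<open>\<epsilon> \<leftrightarrow> \<epsilon>'\<close> on dual numbers.  All equations of a tangent structure
  can then be checked on generators; for universality, a morphism killing \<open>d'a\<close> makes \<open>d'da\<close> a derivation
  in \<open>a\<close>.\<close>

text \<open>Two obstacles shape the proof. There is no unit, so x^[0] = 1 is not an element and
  index 0 is used only through its action on other elements, as in \<open>dact\<close>. And the
  universal properties of free algebras and coproducts quantify only over algebras with carrier in
  the one type \<open>'u\<close>, while dual numbers live on pairs. Free algebras and coproducts are
  therefore not built by explicit formulas. They are term algebras modulo the identities true under
  all relevant valuations in algebras on \<open>'u\<close>, coded back into \<open>'u\<close>; a
  relation holds in them because it holds under each valuation. To extend a map into dual numbers,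
  these are replaced by an isomorphic copy on \<open>'u\<close>. To compare two maps, one uses the
  subalgebra where they agree: it lies inside the source, so the target may have any carrier
  type.\<close>

lemma additive_simps [simp]:
  "carrier (additive V) = carrier V" "monoid.mult (additive V) = vadd V" "one (additive V) = vzero V"
  by (simp_all add: additive_def)

section \<open>Vector spaces and non-unital algebras\<close>

sublocale vect \<subseteq> ad: comm_group "additive V"
  by (rule additive_group)

context vect
begin

lemma zero_closed [simp]: "\<zero> \<in> carrier V"
  using ad.one_closed by simp

lemma add_closed [simp]: "x \<in> carrier V \<Longrightarrow> y \<in> carrier V \<Longrightarrow> x \<oplus> y \<in> carrier V"
  using ad.m_closed[of x y] by simp

lemma neg_closed [simp]: "x \<in> carrier V \<Longrightarrow> vneg V x \<in> carrier V"
  using ad.inv_closed[of x] by (simp add: vneg_def)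

lemma add_zero [simp]: "x \<in> carrier V \<Longrightarrow> \<zero> \<oplus> x = x" "x \<in> carrier V \<Longrightarrow> x \<oplus> \<zero> = x"
  using ad.l_one[of x] ad.r_one[of x] by simp_all

lemma add_neg [simp]: "x \<in> carrier V \<Longrightarrow> vneg V x \<oplus> x = \<zero>" "x \<in> carrier V \<Longrightarrow> x \<oplus> vneg V x = \<zero>"
  using ad.l_inv[of x] ad.r_inv[of x] by (simp_all add: vneg_def)

lemma add_assoc: "x \<in> carrier V \<Longrightarrow> y \<in> carrier V \<Longrightarrow> w \<in> carrier V \<Longrightarrow> x \<oplus> y \<oplus> w = x \<oplus> (y \<oplus> w)"
  using ad.m_assoc[of x y w] by simp

lemma add_comm: "x \<in> carrier V \<Longrightarrow> y \<in> carrier V \<Longrightarrow> x \<oplus> y = y \<oplus> x"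
  using ad.m_comm[of x y] by simp

lemma add_lcomm: "x \<in> carrier V \<Longrightarrow> y \<in> carrier V \<Longrightarrow> w \<in> carrier V \<Longrightarrow> x \<oplus> (y \<oplus> w) = y \<oplus> (x \<oplus> w)"
  using ad.m_lcomm[of x y w] by simp

lemmas add_ac = add_assoc add_comm add_lcomm

lemma add_left_cancel:
  "x \<in> carrier V \<Longrightarrow> y \<in> carrier V \<Longrightarrow> w \<in> carrier V \<Longrightarrow> x \<oplus> y = x \<oplus> w \<longleftrightarrow> y = w"
  using ad.Units_l_cancel[of x y w] by simp

lemma double_eq_self: "x \<in> carrier V \<Longrightarrow> x \<oplus> x = x \<Longrightarrow> x = \<zero>"
  using add_left_cancel[of x x \<zero>] by simp

lemma neg_unique: "x \<in> carrier V \<Longrightarrow> y \<in> carrier V \<Longrightarrow> x \<oplus> y = \<zero> \<Longrightarrow> vneg V x = y"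
  using add_left_cancel[of x y "vneg V x"] by simp

lemma scale_closed' [simp]: "x \<in> carrier V \<Longrightarrow> k \<cdot> x \<in> carrier V"
  by (rule scale_closed)

lemma scale_zero [simp]: "k \<cdot> \<zero> = \<zero>"
  using scale_add_right[of \<zero> \<zero> k] by (intro double_eq_self) simp_all

lemma zero_scale [simp]: "x \<in> carrier V \<Longrightarrow> 0 \<cdot> x = \<zero>"
  using scale_add_left[of x 0 0] by (intro double_eq_self) simp_all

lemma one_scale [simp]: "x \<in> carrier V \<Longrightarrow> 1 \<cdot> x = x"
  by (rule scale_one)

lemma neg_eq_scale: "x \<in> carrier V \<Longrightarrow> vneg V x = (- 1) \<cdot> x"
  using scale_add_left[of x 1 "- 1"] by (intro neg_unique) simp_all

lemma minus_closed: "x \<in> carrier V \<Longrightarrow> y \<in> carrier V \<Longrightarrow> vminus V x y \<in> carrier V"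
  by (simp add: vminus_def)

lemma minus_eq_zero_iff: "x \<in> carrier V \<Longrightarrow> y \<in> carrier V \<Longrightarrow> vminus V x y = \<zero> \<longleftrightarrow> x = y"
  unfolding vminus_def using neg_unique[of "vneg V y" x] neg_unique[of "vneg V y" y]
  by (auto simp: add_comm)

lemma add_add_swap:
  "x \<in> carrier V \<Longrightarrow> y \<in> carrier V \<Longrightarrow> u \<in> carrier V \<Longrightarrow> w \<in> carrier V
    \<Longrightarrow> (x \<oplus> y) \<oplus> (u \<oplus> w) = (x \<oplus> u) \<oplus> (y \<oplus> w)"
  by (simp add: add_ac)

lemma finprod_in_carrier: "(\<And>i. i \<in> S \<Longrightarrow> f i \<in> carrier V) \<Longrightarrow> finprod (additive V) f S \<in> carrier V"
  using ad.finprod_closed[of f S] by auto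

lemma finprod_add:
  assumes "\<And>i. i \<in> S \<Longrightarrow> f i \<in> carrier V" "\<And>i. i \<in> S \<Longrightarrow> g i \<in> carrier V"
  shows "finprod (additive V) (\<lambda>i. f i \<oplus> g i) S = finprod (additive V) f S \<oplus> finprod (additive V) g S"
  using ad.finprod_multf[of f S g] assms by auto

end

text \<open>Inverses need no separate assumption: by distributivity and 0 x = 0, the element (-1) x
  is the negative of x.\<close>

lemma vectI:
  fixes V :: "('f::field, 'a, 'z) vec_scheme" (structure)
  assumes "\<zero> \<in> carrier V"
    and "\<And>x y. x \<in> carrier V \<Longrightarrow> y \<in> carrier V \<Longrightarrow> x \<oplus> y \<in> carrier V"
    and "\<And>x k. x \<in> carrier V \<Longrightarrow> k \<cdot> x \<in> carrier V"
    and "\<And>x. x \<in> carrier V \<Longrightarrow> \<zero> \<oplus> x = x"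
    and "\<And>x y. x \<in> carrier V \<Longrightarrow> y \<in> carrier V \<Longrightarrow> x \<oplus> y = y \<oplus> x"
    and "\<And>x y w. x \<in> carrier V \<Longrightarrow> y \<in> carrier V \<Longrightarrow> w \<in> carrier V \<Longrightarrow> x \<oplus> y \<oplus> w = x \<oplus> (y \<oplus> w)"
    and "\<And>x. x \<in> carrier V \<Longrightarrow> 0 \<cdot> x = \<zero>"
    and "\<And>x. x \<in> carrier V \<Longrightarrow> 1 \<cdot> x = x"
    and "\<And>x k k'. x \<in> carrier V \<Longrightarrow> k \<cdot> k' \<cdot> x = (k * k') \<cdot> x"
    and "\<And>x k k'. x \<in> carrier V \<Longrightarrow> (k + k') \<cdot> x = k \<cdot> x \<oplus> k' \<cdot> x"
    and "\<And>x y k. x \<in> carrier V \<Longrightarrow> y \<in> carrier V \<Longrightarrow> k \<cdot> (x \<oplus> y) = k \<cdot> x \<oplus> k \<cdot> y"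
  shows "vect V"
proof (rule vect.intro)
  have "\<exists>y \<in> carrier V. y \<oplus> x = \<zero>" if "x \<in> carrier V" for x
    using that assms(3)[of x "- 1"] assms(10)[of x "- 1" 1] assms(7,8)[of x] by auto
  then show "comm_group (additive V)"
    by (intro comm_groupI) (auto intro: assms)
qed (simp_all add: assms)

text \<open>Sums are products in the additive group. This carries the sum in the addition formula
  for divided powers through morphisms, projections and multiplications.\<close>

lemma additive_map_finprod:
  assumes "vect V" "vect W"
    and h: "h \<in> carrier V \<rightarrow> carrier W"
    and add: "\<And>x y. x \<in> carrier V \<Longrightarrow> y \<in> carrier V \<Longrightarrow> h (x \<oplus>\<^bsub>V\<^esub> y) = h x \<oplus>\<^bsub>W\<^esub> h y"
    and "finite S" and "\<And>i. i \<in> S \<Longrightarrow> f i \<in> carrier V"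
  shows "h (finprod (additive V) f S) = finprod (additive W) (\<lambda>i. h (f i)) S"
proof -
  interpret V: vect V by fact
  interpret W: vect W by fact
  show ?thesis
    using assms(5,6)
  proof (induction S)
    case empty
    have "h \<zero>\<^bsub>V\<^esub> = \<zero>\<^bsub>W\<^esub>"
      using add[of "\<zero>\<^bsub>V\<^esub>" "\<zero>\<^bsub>V\<^esub>"] h by (intro W.double_eq_self) auto
    then show ?case by simp
  next
    case (insert i S)
    have "finprod (additive V) f S \<in> carrier V"
      using insert by (intro V.finprod_in_carrier) auto
    then show ?case
      using insert h add by (subst V.ad.finprod_insert W.ad.finprod_insert; auto simp: Pi_iff)+
  qed
qed

context comm_nalg
begin

lemma mult_closed' [simp]: "x \<in> carrier A \<Longrightarrow> y \<in> carrier A \<Longrightarrow> x \<star> y \<in> carrier A"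
  by (rule mult_closed)

lemma mult_lcomm:
  "x \<in> carrier A \<Longrightarrow> y \<in> carrier A \<Longrightarrow> w \<in> carrier A \<Longrightarrow> x \<star> (y \<star> w) = y \<star> (x \<star> w)"
  using mult_assoc mult_comm by metis

lemmas mult_ac = mult_assoc mult_comm mult_lcomm

lemma add_mult:
  "x \<in> carrier A \<Longrightarrow> y \<in> carrier A \<Longrightarrow> w \<in> carrier A \<Longrightarrow> (x \<oplus> y) \<star> w = x \<star> w \<oplus> y \<star> w"
  by (simp add: mult_comm[of _ w] mult_add)

lemma scale_mult: "x \<in> carrier A \<Longrightarrow> y \<in> carrier A \<Longrightarrow> (k \<cdot> x) \<star> y = k \<cdot> (x \<star> y)"
  by (simp add: mult_comm[of _ y] mult_scale)

lemma mult_zero [simp]: "x \<in> carrier A \<Longrightarrow> x \<star> \<zero> = \<zero>" "x \<in> carrier A \<Longrightarrow> \<zero> \<star> x = \<zero>"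
  using mult_scale[of x \<zero> 0] scale_mult[of \<zero> x 0] by simp_all

lemma finprod_mult:
  assumes "finite S" "\<And>i. i \<in> S \<Longrightarrow> f i \<in> carrier A" "x \<in> carrier A"
  shows "finprod (additive A) f S \<star> x = finprod (additive A) (\<lambda>i. f i \<star> x) S"
  using assms by (intro additive_map_finprod) (auto simp: add_mult vect_axioms)

end

section \<open>Divided powers acting on an algebra\<close>

text \<open>Multiplication by \<open>x\<^sup>[\<^sup>n\<^sup>]\<close>; acting on \<open>w\<close> makes sense of \<open>x\<^sup>[\<^sup>0\<^sup>] = 1\<close> although there is no unit.\<close>

definition dact :: "('f, 'a) dpa \<Rightarrow> nat \<Rightarrow> 'a \<Rightarrow> 'a \<Rightarrow> 'a" where
  "dact A n x w = (if n = 0 then w else amult A (dpow A n x) w)"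

lemma dact_0 [simp]: "dact A 0 x w = w"
  by (simp add: dact_def)

context dp_algebra
begin

lemma dpow_closed' [simp]: "n \<ge> 1 \<Longrightarrow> a \<in> carrier A \<Longrightarrow> dpow A n a \<in> carrier A"
  "0 < n \<Longrightarrow> a \<in> carrier A \<Longrightarrow> dpow A n a \<in> carrier A"
  using dpow_closed[of n a] by simp_all

lemma dpow_Suc_closed [simp]: "a \<in> carrier A \<Longrightarrow> dpow A (Suc n) a \<in> carrier A"
  by simp

lemma dpow_1 [simp]: "a \<in> carrier A \<Longrightarrow> dpow A (Suc 0) a = a"
  using dpow_one by simp

lemma dact_closed [simp]: "x \<in> carrier A \<Longrightarrow> w \<in> carrier A \<Longrightarrow> dact A n x w \<in> carrier A"
  by (simp add: dact_def)

lemma dact_add_right: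
  "x \<in> carrier A \<Longrightarrow> u \<in> carrier A \<Longrightarrow> w \<in> carrier A \<Longrightarrow> dact A n x (u \<oplus> w) = dact A n x u \<oplus> dact A n x w"
  by (simp add: dact_def mult_add)

lemma dact_scale_right:
  "x \<in> carrier A \<Longrightarrow> w \<in> carrier A \<Longrightarrow> dact A n x (k \<cdot> w) = k \<cdot> dact A n x w"
  by (simp add: dact_def mult_scale)

lemma dact_scale:
  "x \<in> carrier A \<Longrightarrow> w \<in> carrier A \<Longrightarrow> dact A n (k \<cdot> x) w = k ^ n \<cdot> dact A n x w"
  by (simp add: dact_def dpow_scale scale_mult)

lemma dact_comm:
  "x \<in> carrier A \<Longrightarrow> y \<in> carrier A \<Longrightarrow> w \<in> carrier A \<Longrightarrow>
    dact A m x (dact A n y w) = dact A n y (dact A m x w)"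
  by (simp add: dact_def mult_lcomm)

lemma dpow_mult_eq_dact: "n \<ge> 1 \<Longrightarrow> dpow A n x \<star> w = dact A n x w"
  by (simp add: dact_def)

lemma dact_dact:
  assumes "x \<in> carrier A" "w \<in> carrier A"
  shows "dact A m x (dact A n x w) = of_nat ((m + n) choose m) \<cdot> dact A (m + n) x w"
  using assms
  by (auto simp: dact_def dpow_mult_dpow scale_mult simp flip: mult_assoc)

text \<open>Letting x^[0] act as the identity absorbs the two end terms of the addition formula into
  one uniform sum. For n = 0 these end terms coincide, hence the case distinction.\<close>

lemma dact_add:
  assumes "x \<in> carrier A" "y \<in> carrier A" "w \<in> carrier A"
  shows "dact A n (x \<oplus> y) w = finprod (additive A) (\<lambda>i. dact A i x (dact A (n - i) y w)) {0..n}"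
proof (cases "n = 0")
  case True
  have "finprod (additive A) (\<lambda>i. dact A i x (dact A (0 - i) y w)) {0::nat..0} = w"
    using ad.finprod_insert[of "{}" 0 "\<lambda>i. dact A i x (dact A (0 - i) y w)"] assms by simp
  then show ?thesis using True by simp
next
  case False
  let ?f = "\<lambda>i. dact A i x (dact A (n - i) y w)"
  have split: "{0..n} = insert 0 (insert n {1..<n})"
    using False by auto
  have cl: "finprod (additive A) ?f {1..<n} \<in> carrier A"
    using assms by (intro finprod_in_carrier) simp
  have cl': "finprod (additive A) (\<lambda>i. dpow A i x \<star> dpow A (n - i) y) {1..<n} \<in> carrier A"
    using assms by (intro finprod_in_carrier) simp
  have "finprod (additive A) ?f {0..n} = ?f 0 \<oplus> (?f n \<oplus> finprod (additive A) ?f {1..<n})"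
    unfolding split using assms False cl
    by (subst ad.finprod_insert; auto)+
  also have "finprod (additive A) ?f {1..<n}
      = finprod (additive A) (\<lambda>i. (dpow A i x \<star> dpow A (n - i) y) \<star> w) {1..<n}"
    using assms by (intro ad.finprod_cong') (auto simp: dact_def mult_assoc)
  also have "\<dots> = finprod (additive A) (\<lambda>i. dpow A i x \<star> dpow A (n - i) y) {1..<n} \<star> w"
    using assms by (intro finprod_mult[symmetric]) auto
  finally show ?thesis
    using assms False cl' by (simp add: dact_def dpow_add add_mult add_ac)
qed

text \<open>The factor x joins x^[n], and x x^[n] = (n+1) x^[n+1] turns n! into (n+1)!. In the dual
  numbers this is one half of the \<epsilon>-part of a divided power of a product; the other half is
  the same with x and y exchanged.\<close>

lemma dact_mult_mult:
  assumes "x \<in> carrier A" "y \<in> carrier A" "w \<in> carrier A"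
  shows "dact A n (x \<star> y) (x \<star> w) = of_nat (fact (Suc n)) \<cdot> (dpow A (Suc n) x \<star> dact A n y w)"
proof (cases "n = 0")
  case False
  have "dact A n (x \<star> y) (x \<star> w) = of_nat (fact n) \<cdot> ((dpow A n x \<star> dpow A n y) \<star> (x \<star> w))"
    using assms False by (simp add: dact_def dpow_mult scale_mult)
  also have "(dpow A n x \<star> dpow A n y) \<star> (x \<star> w) = (dpow A 1 x \<star> dpow A n x) \<star> (dpow A n y \<star> w)"
    using assms False by (simp add: mult_ac)
  also have "\<dots> = of_nat (Suc n) \<cdot> (dpow A (Suc n) x \<star> (dpow A n y \<star> w))"
    using assms False by (simp only: dpow_mult_dpow[OF order_refl]) (simp add: scale_mult)
  finally show ?thesis
    using assms False by (simp add: dact_def scale_scale algebra_simps)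
qed (use assms in simp)

end

text \<open>The two remaining axioms follow because \<open>n!\<cdot>x\<^sup>[\<^sup>n\<^sup>]\<close> is the \<open>n\<close>-th power of \<open>x\<close>.\<close>

lemma dp_algebraI:
  fixes A :: "('f::field, 'a) dpa" (structure)
  assumes "comm_nalg A"
    and closed: "\<And>n a. n \<ge> 1 \<Longrightarrow> a \<in> carrier A \<Longrightarrow> dpow A n a \<in> carrier A"
    and "\<And>n a k. n \<ge> 1 \<Longrightarrow> a \<in> carrier A \<Longrightarrow> dpow A n (k \<cdot> a) = k ^ n \<cdot> dpow A n a"
    and mult: "\<And>m n a. m \<ge> 1 \<Longrightarrow> n \<ge> 1 \<Longrightarrow> a \<in> carrier A \<Longrightarrow>
          dpow A m a \<star> dpow A n a = of_nat ((m + n) choose m) \<cdot> dpow A (m + n) a"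
    and "\<And>n a b. n \<ge> 1 \<Longrightarrow> a \<in> carrier A \<Longrightarrow> b \<in> carrier A \<Longrightarrow>
          dpow A n (a \<oplus> b) =
            dpow A n a \<oplus> finprod (additive A) (\<lambda>i. dpow A i a \<star> dpow A (n - i) b) {1..<n} \<oplus> dpow A n b"
    and one: "\<And>a. a \<in> carrier A \<Longrightarrow> dpow A 1 a = a"
    and prod: "\<And>n a b. n \<ge> 1 \<Longrightarrow> a \<in> carrier A \<Longrightarrow> b \<in> carrier A \<Longrightarrow>
          dpow A n (a \<star> b) = of_nat (fact n) \<cdot> (dpow A n a \<star> dpow A n b)"
    and "\<And>m n a. m \<ge> 1 \<Longrightarrow> n \<ge> 1 \<Longrightarrow> a \<in> carrier A \<Longrightarrow>
          dpow A m (dpow A n a) = of_nat (fact (m * n) div (fact m * fact n ^ m)) \<cdot> dpow A (m * n) a"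
  shows "dp_algebra A"
proof -
  interpret comm_nalg A by fact
  have npow: "npow A n x = of_nat (fact n) \<cdot> dpow A n x" if "n \<ge> 1" "x \<in> carrier A" for n x
    using that
  proof (induction n rule: nat_induct_at_least)
    case base
    then show ?case using one by (simp add: npow_def)
  next
    case (Suc n)
    have "npow A (Suc n) x = x \<star> npow A n x"
      using Suc by (cases n) (simp_all add: npow_def)
    also have "\<dots> = of_nat (fact n) \<cdot> (dpow A 1 x \<star> dpow A n x)"
      using Suc one closed by (simp add: mult_scale)
    also have "\<dots> = of_nat (fact (Suc n)) \<cdot> dpow A (Suc n) x"
      using Suc closed by (simp only: mult[OF order_refl]) (simp add: scale_scale algebra_simps)
    finally show ?case .
  qed
  show ?thesis
    by (rule dp_algebra.intro[OF assms(1)], unfold_locales)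
       (use assms in \<open>simp_all add: npow scale_mult mult_scale\<close>)
qed

section \<open>Morphisms of divided power algebras\<close>

lemma dp_algebra_vect: "dp_algebra A \<Longrightarrow> vect A"
  by (simp add: dp_algebra_def comm_nalg_def)

lemma dp_hom_closed: "h \<in> dp_hom A B \<Longrightarrow> x \<in> carrier A \<Longrightarrow> h x \<in> carrier B"
  by (auto simp: dp_hom_def)

lemma dp_hom_add: "h \<in> dp_hom A B \<Longrightarrow> x \<in> carrier A \<Longrightarrow> y \<in> carrier A \<Longrightarrow>
    h (x \<oplus>\<^bsub>A\<^esub> y) = h x \<oplus>\<^bsub>B\<^esub> h y"
  by (auto simp: dp_hom_def)

lemma dp_hom_scale: "h \<in> dp_hom A B \<Longrightarrow> x \<in> carrier A \<Longrightarrow> h (k \<cdot>\<^bsub>A\<^esub> x) = k \<cdot>\<^bsub>B\<^esub> h x"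
  by (auto simp: dp_hom_def)

lemma dp_hom_mult: "h \<in> dp_hom A B \<Longrightarrow> x \<in> carrier A \<Longrightarrow> y \<in> carrier A \<Longrightarrow>
    h (x \<star>\<^bsub>A\<^esub> y) = h x \<star>\<^bsub>B\<^esub> h y"
  by (auto simp: dp_hom_def)

lemma dp_hom_dpow: "h \<in> dp_hom A B \<Longrightarrow> n \<ge> 1 \<Longrightarrow> x \<in> carrier A \<Longrightarrow> h (dpow A n x) = dpow B n (h x)"
  by (auto simp: dp_hom_def)

lemma dp_hom_zero: "dp_algebra A \<Longrightarrow> dp_algebra B \<Longrightarrow> h \<in> dp_hom A B \<Longrightarrow> h \<zero>\<^bsub>A\<^esub> = \<zero>\<^bsub>B\<^esub>"
  using dp_hom_scale[of h A B "\<zero>\<^bsub>A\<^esub>" 0] dp_hom_closed[of h A B "\<zero>\<^bsub>A\<^esub>"]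
    vect.zero_closed[of A] vect.zero_scale[of A "\<zero>\<^bsub>A\<^esub>"] vect.zero_scale[of B "h \<zero>\<^bsub>A\<^esub>"]
  by (simp add: dp_algebra_vect)

lemma dp_hom_dact: "h \<in> dp_hom A B \<Longrightarrow> x \<in> carrier A \<Longrightarrow> w \<in> carrier A \<Longrightarrow> dp_algebra A \<Longrightarrow>
    h (dact A n x w) = dact B n (h x) (h w)"
  by (simp add: dact_def dp_hom_mult dp_hom_dpow dp_algebra.dpow_closed)

lemma dp_hom_eqI:
  "f \<in> dp_hom A B \<Longrightarrow> g \<in> dp_hom A B \<Longrightarrow> (\<And>x. x \<in> carrier A \<Longrightarrow> f x = g x) \<Longrightarrow> f = g"
  by (auto simp: dp_hom_def intro: PiE_ext)

lemma restrict_dp_hom: "h \<in> dp_hom A B \<Longrightarrow> restrict h (carrier A) = h"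
  by (auto simp: dp_hom_def intro: extensional_restrict)

lemma restrict_dp_homI:
  assumes "dp_algebra A"
    and "\<And>x. x \<in> carrier A \<Longrightarrow> f x \<in> carrier B"
    and "\<And>x y. x \<in> carrier A \<Longrightarrow> y \<in> carrier A \<Longrightarrow> f (x \<oplus>\<^bsub>A\<^esub> y) = f x \<oplus>\<^bsub>B\<^esub> f y"
    and "\<And>k x. x \<in> carrier A \<Longrightarrow> f (k \<cdot>\<^bsub>A\<^esub> x) = k \<cdot>\<^bsub>B\<^esub> f x"
    and "\<And>x y. x \<in> carrier A \<Longrightarrow> y \<in> carrier A \<Longrightarrow> f (x \<star>\<^bsub>A\<^esub> y) = f x \<star>\<^bsub>B\<^esub> f y"
    and "\<And>n x. n \<ge> 1 \<Longrightarrow> x \<in> carrier A \<Longrightarrow> f (dpow A n x) = dpow B n (f x)"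
  shows "restrict f (carrier A) \<in> dp_hom A B"
proof -
  interpret dp_algebra A by fact
  show ?thesis
    using assms(2-) by (auto simp: dp_hom_def)
qed

lemma id_dp_hom: "dp_algebra A \<Longrightarrow> (\<lambda>x\<in>carrier A. x) \<in> dp_hom A A"
  by (rule restrict_dp_homI) auto

lemma compose_dp_hom:
  assumes "dp_algebra A" "f \<in> dp_hom A B" "g \<in> dp_hom B D"
  shows "compose (carrier A) g f \<in> dp_hom A D"
  unfolding compose_def
  using assms
  by (intro restrict_dp_homI)
     (auto simp: dp_hom_closed dp_hom_add dp_hom_scale dp_hom_mult dp_hom_dpow)

text \<open>All axioms are equations, so they hold in F once they hold after every map of a
  point-separating family into divided power algebras. Preservation of zero is assumed separately
  because deriving it from preservation of scalars uses that 0 x is zero in F, which is not known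
  beforehand.\<close>

lemma dp_algebra_jointly_monic:
  fixes F :: "('f::field, 'a) dpa" (structure) and K :: "(('f, 'b) dpa \<times> ('a \<Rightarrow> 'b)) set"
  assumes closed: "\<zero> \<in> carrier F"
      "\<And>x y. x \<in> carrier F \<Longrightarrow> y \<in> carrier F \<Longrightarrow> x \<oplus> y \<in> carrier F"
      "\<And>x k. x \<in> carrier F \<Longrightarrow> k \<cdot> x \<in> carrier F"
      "\<And>x y. x \<in> carrier F \<Longrightarrow> y \<in> carrier F \<Longrightarrow> x \<star> y \<in> carrier F"
      "\<And>x n. n \<ge> 1 \<Longrightarrow> x \<in> carrier F \<Longrightarrow> dpow F n x \<in> carrier F"
    and K: "\<And>D h. (D, h) \<in> K \<Longrightarrow> dp_algebra D \<and> h \<in> dp_hom F D \<and> h \<zero> = \<zero>\<^bsub>D\<^esub>"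
    and mono: "\<And>x y. x \<in> carrier F \<Longrightarrow> y \<in> carrier F \<Longrightarrow>
        (\<And>D h. (D, h) \<in> K \<Longrightarrow> h x = h y) \<Longrightarrow> x = y"
  shows "dp_algebra F"
proof -
  {
    fix D h assume Dh: "(D, h) \<in> K"
    interpret D: dp_algebra D using K[OF Dh] by simp
    have h: "h \<in> dp_hom F D" using K[OF Dh] by simp
    note rules = dp_hom_closed[OF h] dp_hom_add[OF h] dp_hom_scale[OF h] dp_hom_mult[OF h]
      dp_hom_dpow[OF h] closed K[OF Dh, THEN conjunct2, THEN conjunct2]
    have "x \<in> carrier F \<Longrightarrow> h (\<zero> \<oplus> x) = h x"
      "x \<in> carrier F \<Longrightarrow> y \<in> carrier F \<Longrightarrow> h (x \<oplus> y) = h (y \<oplus> x)"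
      "x \<in> carrier F \<Longrightarrow> y \<in> carrier F \<Longrightarrow> w \<in> carrier F \<Longrightarrow> h (x \<oplus> y \<oplus> w) = h (x \<oplus> (y \<oplus> w))"
      "x \<in> carrier F \<Longrightarrow> h (0 \<cdot> x) = h \<zero>"
      "x \<in> carrier F \<Longrightarrow> h (1 \<cdot> x) = h x"
      "x \<in> carrier F \<Longrightarrow> h (k \<cdot> k' \<cdot> x) = h ((k * k') \<cdot> x)"
      "x \<in> carrier F \<Longrightarrow> h ((k + k') \<cdot> x) = h (k \<cdot> x \<oplus> k' \<cdot> x)"
      "x \<in> carrier F \<Longrightarrow> y \<in> carrier F \<Longrightarrow> h (k \<cdot> (x \<oplus> y)) = h (k \<cdot> x \<oplus> k \<cdot> y)" for x y w k k'
      using D.add_comm D.add_assoc D.scale_scale D.scale_add_left D.scale_add_right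
      by (simp_all add: rules)
  } note eqs = this
  have vect: "vect F"
    by (rule vectI; ((simp add: closed; fail) | (rule mono; ((simp add: closed; fail) | (rule eqs; assumption)))))
  {
    fix D h assume Dh: "(D, h) \<in> K"
    interpret D: dp_algebra D using K[OF Dh] by simp
    have h: "h \<in> dp_hom F D" using K[OF Dh] by simp
    note rules = dp_hom_closed[OF h] dp_hom_add[OF h] dp_hom_scale[OF h] dp_hom_mult[OF h]
      dp_hom_dpow[OF h] closed
    have "x \<in> carrier F \<Longrightarrow> y \<in> carrier F \<Longrightarrow> w \<in> carrier F \<Longrightarrow> h (x \<star> y \<star> w) = h (x \<star> (y \<star> w))"
      "x \<in> carrier F \<Longrightarrow> y \<in> carrier F \<Longrightarrow> h (x \<star> y) = h (y \<star> x)"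
      "x \<in> carrier F \<Longrightarrow> y \<in> carrier F \<Longrightarrow> w \<in> carrier F \<Longrightarrow> h (x \<star> (y \<oplus> w)) = h (x \<star> y \<oplus> x \<star> w)"
      "x \<in> carrier F \<Longrightarrow> y \<in> carrier F \<Longrightarrow> h (x \<star> (k \<cdot> y)) = h (k \<cdot> (x \<star> y))" for x y w k
      using D.mult_assoc D.mult_comm D.mult_add D.mult_scale
      by (simp_all add: rules)
  } note eqs2 = this
  have nalg: "comm_nalg F"
    by (rule comm_nalg.intro[OF vect], unfold_locales;
        ((simp add: closed; fail) | (rule mono; ((simp add: closed; fail) | (rule eqs2; assumption)))))
  interpret F: comm_nalg F by fact
  \<comment> \<open>The axioms are established in stages because the addition formula contains a sum
    in F, which can be handled only once F is known to have a commutative additive group.\<close>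
  have finprod_cl: "finprod (additive F) (\<lambda>i. dpow F i a \<star> dpow F (n - i) b) {1..<n} \<in> carrier F"
    if "a \<in> carrier F" "b \<in> carrier F" for a b n
    using that closed by (intro F.finprod_in_carrier) auto
  {
    fix D h assume Dh: "(D, h) \<in> K"
    interpret D: dp_algebra D using K[OF Dh] by simp
    have h: "h \<in> dp_hom F D" using K[OF Dh] by simp
    note rules = dp_hom_closed[OF h] dp_hom_add[OF h] dp_hom_scale[OF h] dp_hom_mult[OF h]
      dp_hom_dpow[OF h] closed
    have sum: "h (finprod (additive F) (\<lambda>i. dpow F i a \<star> dpow F (n - i) b) {1..<n})
        = finprod (additive D) (\<lambda>i. dpow D i (h a) \<star>\<^bsub>D\<^esub> dpow D (n - i) (h b)) {1..<n}"
      if "a \<in> carrier F" "b \<in> carrier F" for a b n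
      using that rules
      by (subst additive_map_finprod[OF vect D.vect_axioms])
         (auto intro!: D.ad.finprod_cong')
    have "n \<ge> 1 \<Longrightarrow> a \<in> carrier F \<Longrightarrow> h (dpow F n (k \<cdot> a)) = h (k ^ n \<cdot> dpow F n a)"
      "m \<ge> 1 \<Longrightarrow> n \<ge> 1 \<Longrightarrow> a \<in> carrier F \<Longrightarrow>
          h (dpow F m a \<star> dpow F n a) = h (of_nat ((m + n) choose m) \<cdot> dpow F (m + n) a)"
      "n \<ge> 1 \<Longrightarrow> a \<in> carrier F \<Longrightarrow> b \<in> carrier F \<Longrightarrow>
          h (dpow F n (a \<oplus> b)) =
            h (dpow F n a \<oplus> finprod (additive F) (\<lambda>i. dpow F i a \<star> dpow F (n - i) b) {1..<n} \<oplus> dpow F n b)"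
      "a \<in> carrier F \<Longrightarrow> h (dpow F 1 a) = h a"
      "n \<ge> 1 \<Longrightarrow> a \<in> carrier F \<Longrightarrow> b \<in> carrier F \<Longrightarrow>
          h (dpow F n (a \<star> b)) = h (of_nat (fact n) \<cdot> (dpow F n a \<star> dpow F n b))"
      "m \<ge> 1 \<Longrightarrow> n \<ge> 1 \<Longrightarrow> a \<in> carrier F \<Longrightarrow>
          h (dpow F m (dpow F n a)) = h (of_nat (fact (m * n) div (fact m * fact n ^ m)) \<cdot> dpow F (m * n) a)"
      for a b k m n
      using D.dpow_scale D.dpow_mult_dpow D.dpow_add D.dpow_one D.dpow_mult D.dpow_dpow
      by (simp_all add: rules finprod_cl[simplified] sum[simplified])
  } note eqs3 = this
  show ?thesis
    by (rule dp_algebraI[OF nalg];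
        ((simp add: closed; fail) | (rule mono; ((simp add: closed finprod_cl[simplified]; fail) | (rule eqs3; assumption)))))
qed

section \<open>Dual numbers\<close>

text \<open>The divided powers are forced by the addition formula when those of u\<epsilon> with
  index at least 2 vanish. For n = 1 the \<epsilon>-part must be u itself, which is what
  \<open>dact\<close> with index 0 gives.\<close>

definition dual :: "('f::field, 'a) dpa \<Rightarrow> ('f, 'a \<times> 'a) dpa" where
  "dual D = \<lparr>carrier = carrier D \<times> carrier D, vzero = (\<zero>\<^bsub>D\<^esub>, \<zero>\<^bsub>D\<^esub>),
     vadd = (\<lambda>x y. (fst x \<oplus>\<^bsub>D\<^esub> fst y, snd x \<oplus>\<^bsub>D\<^esub> snd y)),
     vscale = (\<lambda>k x. (k \<cdot>\<^bsub>D\<^esub> fst x, k \<cdot>\<^bsub>D\<^esub> snd x)),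
     amult = (\<lambda>x y. (fst x \<star>\<^bsub>D\<^esub> fst y, fst x \<star>\<^bsub>D\<^esub> snd y \<oplus>\<^bsub>D\<^esub> fst y \<star>\<^bsub>D\<^esub> snd x)),
     dpow = (\<lambda>n x. (dpow D n (fst x), dact D (n - 1) (fst x) (snd x)))\<rparr>"

lemma dual_simps [simp]:
  "carrier (dual D) = carrier D \<times> carrier D"
  "\<zero>\<^bsub>dual D\<^esub> = (\<zero>\<^bsub>D\<^esub>, \<zero>\<^bsub>D\<^esub>)"
  "x \<oplus>\<^bsub>dual D\<^esub> y = (fst x \<oplus>\<^bsub>D\<^esub> fst y, snd x \<oplus>\<^bsub>D\<^esub> snd y)"
  "k \<cdot>\<^bsub>dual D\<^esub> x = (k \<cdot>\<^bsub>D\<^esub> fst x, k \<cdot>\<^bsub>D\<^esub> snd x)"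
  "x \<star>\<^bsub>dual D\<^esub> y = (fst x \<star>\<^bsub>D\<^esub> fst y, fst x \<star>\<^bsub>D\<^esub> snd y \<oplus>\<^bsub>D\<^esub> fst y \<star>\<^bsub>D\<^esub> snd x)"
  "dpow (dual D) n x = (dpow D n (fst x), dact D (n - 1) (fst x) (snd x))"
  by (simp_all add: dual_def)

text \<open>The number of partitions of \<open>m * n\<close> points into \<open>m\<close> blocks of size \<open>n\<close>, computed by
  choosing first the block of the last point.\<close>

lemma fact_mult_eq:
  assumes "n \<ge> 1"
  shows "fact (m * n) = (fact m * fact n ^ m) * (\<Prod>j<m. (j * n + (n - 1)) choose (n - 1) :: nat)"
proof (induction m)
  case (Suc m)
  let ?B = "(m * n + (n - 1)) choose (n - 1)"
  have B: "fact (n - 1) * fact (m * n) * ?B = (fact (m * n + (n - 1)) :: nat)"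
    using binomial_fact_lemma[of "n - 1" "m * n + (n - 1)"] by simp
  have "fact (Suc m * n) = Suc m * n * fact (m * n + (n - 1))"
    using assms by (cases n) (simp_all add: algebra_simps)
  also have "\<dots> = Suc m * (n * fact (n - 1)) * fact (m * n) * ?B"
    by (simp only: B[symmetric] mult_ac)
  also have "n * fact (n - 1) = fact n"
    using assms by (simp add: fact_reduce)
  finally have "fact (Suc m * n) = Suc m * fact n * fact (m * n) * ?B" .
  then show ?case
    unfolding Suc by (simp add: algebra_simps)
qed simp

text \<open>A recursion for the coefficient of the iterated divided power. The binomial is written
  with lower index m n so that it matches the one produced by \<open>dact_dact\<close> when x^[mn]
  meets x^[n-1].\<close>

lemma fact_mult_div_Suc:
  assumes "n \<ge> 1"
  shows "fact (Suc m * n) div (fact (Suc m) * fact n ^ Suc m)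
       = fact (m * n) div (fact m * fact n ^ m) * ((m * n + (n - 1)) choose (m * n) :: nat)"
proof -
  have "(m * n + (n - 1)) choose (m * n) = (m * n + (n - 1)) choose (n - 1)"
    using binomial_symmetric[of "n - 1" "m * n + (n - 1)"] by simp
  then show ?thesis
    unfolding fact_mult_eq[OF assms] by simp
qed

lemma dp_algebra_dual:
  fixes D :: "('f::field, 'a) dpa"
  assumes "dp_algebra D"
  shows "dp_algebra (dual D)"
proof -
  interpret dp_algebra D by fact
  have vect: "vect (dual D)"
    by (rule vectI) (auto simp: add_ac scale_scale scale_add_left scale_add_right)
  have nalg: "comm_nalg (dual D)"
    by (rule comm_nalg.intro[OF vect], unfold_locales)
       (auto simp: mult_ac add_ac mult_add add_mult scale_mult mult_scale scale_add_right)
  \<comment> \<open>Sums of pairs are computed componentwise, since both projections are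
    additive.\<close>
  have fin: "finprod (additive (dual D)) f S
      = (finprod (additive D) (\<lambda>i. fst (f i)) S, finprod (additive D) (\<lambda>i. snd (f i)) S)"
    if "finite S" "\<And>i. i \<in> S \<Longrightarrow> f i \<in> carrier (dual D)" for f and S :: "nat set"
    using additive_map_finprod[OF vect vect_axioms, of fst S f]
      additive_map_finprod[OF vect vect_axioms, of snd S f] that
    by (auto simp: prod_eq_iff Pi_def)
  show ?thesis
  proof (rule dp_algebraI[OF nalg])
    fix m n :: nat and a assume mn: "m \<ge> 1" "n \<ge> 1" and a: "a \<in> carrier (dual D)"
    obtain x u where [simp]: "a = (x, u)" "x \<in> carrier D" "u \<in> carrier D" using a by auto
    obtain m' n' where [simp]: "m = Suc m'" "n = Suc n'"
      using mn by (metis Suc_pred' less_eq_Suc_le One_nat_def)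
    have "dpow D m x \<star>\<^bsub>D\<^esub> dact D n' x u \<oplus>\<^bsub>D\<^esub> dpow D n x \<star>\<^bsub>D\<^esub> dact D m' x u
        = (of_nat ((m + n') choose m) + of_nat ((n + m') choose n)) \<cdot>\<^bsub>D\<^esub> dact D (m + n') x u"
      using mn by (simp only: dpow_mult_eq_dact dact_dact \<open>x \<in> _\<close> \<open>u \<in> _\<close> scale_add_left dact_closed)
                  (simp add: add.commute)
    \<comment> \<open>By symmetry the second coefficient is m+n-1 choose m-1, so this is Pascal's
      rule.\<close>
    also have "of_nat ((m + n') choose m) + of_nat ((n + m') choose n) = (of_nat ((m + n) choose m) :: 'f)"
      using binomial_symmetric[of n "n + m'"] by (simp flip: of_nat_add add: add.commute)
    finally have "dpow D m x \<star>\<^bsub>D\<^esub> dact D n' x u \<oplus>\<^bsub>D\<^esub> dpow D n x \<star>\<^bsub>D\<^esub> dact D m' x u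
        = of_nat ((m + n) choose m) \<cdot>\<^bsub>D\<^esub> dact D (m + n') x u" .
    then show "dpow (dual D) m a \<star>\<^bsub>dual D\<^esub> dpow (dual D) n a
        = of_nat ((m + n) choose m) \<cdot>\<^bsub>dual D\<^esub> dpow (dual D) (m + n) a"
      using dpow_mult_dpow[OF mn, of x] by simp
  next
    fix n :: nat and a b assume n: "n \<ge> 1" and ab: "a \<in> carrier (dual D)" "b \<in> carrier (dual D)"
    obtain x u where [simp]: "a = (x, u)" "x \<in> carrier D" "u \<in> carrier D" using ab by auto
    obtain y v where [simp]: "b = (y, v)" "y \<in> carrier D" "v \<in> carrier D" using ab by auto
    obtain m where [simp]: "n = Suc m" using n by (cases n) auto
    \<comment> \<open>With n = m + 1, the \<epsilon>-part to be expanded is (x + y)^[m] (u + v). The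
      sum for u gives up its last term, which is the \<epsilon>-part of a^[n], and is then shifted
      by one; the sum for v gives up its first term, which is the \<epsilon>-part of b^[n]. What
      remains of both runs over the indices 1 to n - 1.\<close>
    let ?p = "\<lambda>i w. dact D i x (dact D (m - i) y w)"
    have "finprod (additive D) (\<lambda>i. ?p i u) {0..m} = finprod (additive D) (\<lambda>i. ?p i u) (insert m {0..<m})"
      by (rule arg_cong[where f = "finprod _ _"]) auto
    also have "\<dots> = dact D m x u \<oplus>\<^bsub>D\<^esub> finprod (additive D) (\<lambda>i. ?p i u) {0..<m}"
      by (subst ad.finprod_insert) auto
    also have "finprod (additive D) (\<lambda>i. ?p i u) {0..<m}
        = finprod (additive D) (\<lambda>i. dpow D (Suc m - i) y \<star>\<^bsub>D\<^esub> dact D (i - 1) x u) {1..<Suc m}"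
    proof -
      have "finprod (additive D) (\<lambda>i. dpow D (Suc m - i) y \<star>\<^bsub>D\<^esub> dact D (i - 1) x u) (Suc ` {0..<m})
          = finprod (additive D) (\<lambda>i. dpow D (Suc m - Suc i) y \<star>\<^bsub>D\<^esub> dact D (Suc i - 1) x u) {0..<m}"
        by (rule ad.finprod_reindex) auto
      also have "\<dots> = finprod (additive D) (\<lambda>i. ?p i u) {0..<m}"
        by (rule ad.finprod_cong') (auto simp: dpow_mult_eq_dact dact_comm)
      finally show ?thesis by simp
    qed
    finally have U: "dact D m (x \<oplus>\<^bsub>D\<^esub> y) u = dact D m x u \<oplus>\<^bsub>D\<^esub>
        finprod (additive D) (\<lambda>i. dpow D (Suc m - i) y \<star>\<^bsub>D\<^esub> dact D (i - 1) x u) {1..<Suc m}"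
      by (simp add: dact_add)
    have "finprod (additive D) (\<lambda>i. ?p i v) {0..m} = finprod (additive D) (\<lambda>i. ?p i v) (insert 0 {1..<Suc m})"
      by (rule arg_cong[where f = "finprod _ _"]) auto
    also have "\<dots> = dact D m y v \<oplus>\<^bsub>D\<^esub> finprod (additive D) (\<lambda>i. ?p i v) {1..<Suc m}"
      by (subst ad.finprod_insert) auto
    also have "finprod (additive D) (\<lambda>i. ?p i v) {1..<Suc m}
        = finprod (additive D) (\<lambda>i. dpow D i x \<star>\<^bsub>D\<^esub> dact D (Suc m - i - 1) y v) {1..<Suc m}"
      by (rule ad.finprod_cong') (auto simp: dpow_mult_eq_dact)
    finally have V: "dact D m (x \<oplus>\<^bsub>D\<^esub> y) v = dact D m y v \<oplus>\<^bsub>D\<^esub>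
        finprod (additive D) (\<lambda>i. dpow D i x \<star>\<^bsub>D\<^esub> dact D (Suc m - i - 1) y v) {1..<Suc m}"
      by (simp add: dact_add)
    define SU SV where "SU = finprod (additive D) (\<lambda>i. dpow D (Suc m - i) y \<star>\<^bsub>D\<^esub> dact D (i - 1) x u) {1..<Suc m}"
      and "SV = finprod (additive D) (\<lambda>i. dpow D i x \<star>\<^bsub>D\<^esub> dact D (Suc m - i - 1) y v) {1..<Suc m}"
    have S: "SU \<in> carrier D" "SV \<in> carrier D"
      unfolding SU_def SV_def by (rule finprod_in_carrier; auto)+
    have "dact D m (x \<oplus>\<^bsub>D\<^esub> y) (u \<oplus>\<^bsub>D\<^esub> v) = dact D m x u \<oplus>\<^bsub>D\<^esub> (SV \<oplus>\<^bsub>D\<^esub> SU) \<oplus>\<^bsub>D\<^esub> dact D m y v"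
      using S by (simp add: dact_add_right U[folded SU_def] V[folded SV_def] add_ac)
    also have "SV \<oplus>\<^bsub>D\<^esub> SU = finprod (additive D) (\<lambda>i. dpow D i x \<star>\<^bsub>D\<^esub> dact D (Suc m - i - 1) y v
          \<oplus>\<^bsub>D\<^esub> dpow D (Suc m - i) y \<star>\<^bsub>D\<^esub> dact D (i - 1) x u) {1..<Suc m}"
      unfolding SU_def SV_def by (subst finprod_add) auto
    finally have "dact D m (x \<oplus>\<^bsub>D\<^esub> y) (u \<oplus>\<^bsub>D\<^esub> v) = dact D m x u \<oplus>\<^bsub>D\<^esub>
        finprod (additive D) (\<lambda>i. dpow D i x \<star>\<^bsub>D\<^esub> dact D (Suc m - i - 1) y v
          \<oplus>\<^bsub>D\<^esub> dpow D (Suc m - i) y \<star>\<^bsub>D\<^esub> dact D (i - 1) x u) {1..<Suc m} \<oplus>\<^bsub>D\<^esub> dact D m y v" .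
    then show "dpow (dual D) n (a \<oplus>\<^bsub>dual D\<^esub> b) = dpow (dual D) n a \<oplus>\<^bsub>dual D\<^esub>
        finprod (additive (dual D)) (\<lambda>i. dpow (dual D) i a \<star>\<^bsub>dual D\<^esub> dpow (dual D) (n - i) b) {1..<n}
        \<oplus>\<^bsub>dual D\<^esub> dpow (dual D) n b"
      by (subst fin) (auto simp: dpow_add)
  next
    fix n :: nat and a b assume n: "n \<ge> 1" and ab: "a \<in> carrier (dual D)" "b \<in> carrier (dual D)"
    obtain x u where [simp]: "a = (x, u)" "x \<in> carrier D" "u \<in> carrier D" using ab by auto
    obtain y v where [simp]: "b = (y, v)" "y \<in> carrier D" "v \<in> carrier D" using ab by auto
    obtain m where [simp]: "n = Suc m" using n by (cases n) auto
    have "dact D m (x \<star>\<^bsub>D\<^esub> y) (y \<star>\<^bsub>D\<^esub> u) = of_nat (fact n) \<cdot>\<^bsub>D\<^esub> (dpow D n y \<star>\<^bsub>D\<^esub> dact D m x u)"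
      using dact_mult_mult[of y x u m] by (simp add: mult_comm)
    then show "dpow (dual D) n (a \<star>\<^bsub>dual D\<^esub> b)
        = of_nat (fact n) \<cdot>\<^bsub>dual D\<^esub> (dpow (dual D) n a \<star>\<^bsub>dual D\<^esub> dpow (dual D) n b)"
      using dpow_mult[OF n, of x y] dact_mult_mult[of x y v m]
      by (simp add: dact_add_right scale_add_right)
  next
    fix m n :: nat and a assume mn: "m \<ge> 1" "n \<ge> 1" and a: "a \<in> carrier (dual D)"
    obtain x u where [simp]: "a = (x, u)" "x \<in> carrier D" "u \<in> carrier D" using a by auto
    obtain m' where [simp]: "m = Suc m'" using mn by (cases m) auto
    \<comment> \<open>The exponent of x in the \<epsilon>-part of the composite splits into m - 1
      full blocks of size n, from the outer power, and n - 1 from the \<epsilon>-part of the inner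
      one.\<close>
    have 1: "Suc m' * n - 1 = m' * n + (n - 1)" using mn by simp
    have "dact D m' (dpow D n x) (dact D (n - 1) x u)
        = of_nat (fact (m * n) div (fact m * fact n ^ m)) \<cdot>\<^bsub>D\<^esub> dact D (m * n - 1) x u"
    proof (cases "m' = 0")
      case False
      then have "dact D m' (dpow D n x) (dact D (n - 1) x u)
          = of_nat (fact (m' * n) div (fact m' * fact n ^ m')) \<cdot>\<^bsub>D\<^esub>
              dact D (m' * n) x (dact D (n - 1) x u)"
        using mn by (simp add: dact_def[of D m'] dact_def[of D "m' * n"] dpow_dpow scale_mult del: of_nat_fact)
      also have "\<dots> = (of_nat (fact (m' * n) div (fact m' * fact n ^ m'))
            * of_nat ((m' * n + (n - 1)) choose (m' * n))) \<cdot>\<^bsub>D\<^esub> dact D (m' * n + (n - 1)) x u"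
        by (simp only: dact_dact scale_scale dact_closed \<open>x \<in> _\<close> \<open>u \<in> _\<close>)
      finally show ?thesis
        unfolding \<open>m = Suc m'\<close> 1 fact_mult_div_Suc[OF mn(2)] of_nat_mult .
    qed simp
    then show "dpow (dual D) m (dpow (dual D) n a)
        = of_nat (fact (m * n) div (fact m * fact n ^ m)) \<cdot>\<^bsub>dual D\<^esub> dpow (dual D) (m * n) a"
      using dpow_dpow[OF mn, of x] by simp
  qed (auto simp: dpow_scale dact_scale dact_scale_right scale_scale gr0_conv_Suc Suc_le_eq mult.commute)
qed


text \<open>A morphism to the dual numbers over \<open>D\<close> is a morphism \<open>g\<close> to \<open>D\<close> and a derivation along \<open>g\<close>
  that is compatible with divided powers, as the differentials of \<open>\<Omega>\<^sup>1\<close> are.\<close>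

definition dp_der :: "('f::field, 'a) dpa \<Rightarrow> ('f, 'b) dpa \<Rightarrow> ('a \<Rightarrow> 'b) \<Rightarrow> ('a \<Rightarrow> 'b) \<Rightarrow> bool" where
  "dp_der A D g \<delta> \<longleftrightarrow>
     (\<forall>x\<in>carrier A. \<delta> x \<in> carrier D) \<and>
     (\<forall>x\<in>carrier A. \<forall>y\<in>carrier A. \<delta> (x \<oplus>\<^bsub>A\<^esub> y) = \<delta> x \<oplus>\<^bsub>D\<^esub> \<delta> y) \<and>
     (\<forall>k. \<forall>x\<in>carrier A. \<delta> (k \<cdot>\<^bsub>A\<^esub> x) = k \<cdot>\<^bsub>D\<^esub> \<delta> x) \<and>
     (\<forall>x\<in>carrier A. \<forall>y\<in>carrier A. \<delta> (x \<star>\<^bsub>A\<^esub> y) = g x \<star>\<^bsub>D\<^esub> \<delta> y \<oplus>\<^bsub>D\<^esub> g y \<star>\<^bsub>D\<^esub> \<delta> x) \<and>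
     (\<forall>n\<ge>2. \<forall>x\<in>carrier A. \<delta> (dpow A n x) = dpow D (n - 1) (g x) \<star>\<^bsub>D\<^esub> \<delta> x)"

lemma dp_derD:
  assumes "dp_der A D g \<delta>"
  shows "x \<in> carrier A \<Longrightarrow> \<delta> x \<in> carrier D"
    and "x \<in> carrier A \<Longrightarrow> y \<in> carrier A \<Longrightarrow> \<delta> (x \<oplus>\<^bsub>A\<^esub> y) = \<delta> x \<oplus>\<^bsub>D\<^esub> \<delta> y"
    and "x \<in> carrier A \<Longrightarrow> \<delta> (k \<cdot>\<^bsub>A\<^esub> x) = k \<cdot>\<^bsub>D\<^esub> \<delta> x"
    and "x \<in> carrier A \<Longrightarrow> y \<in> carrier A \<Longrightarrow> \<delta> (x \<star>\<^bsub>A\<^esub> y) = g x \<star>\<^bsub>D\<^esub> \<delta> y \<oplus>\<^bsub>D\<^esub> g y \<star>\<^bsub>D\<^esub> \<delta> x"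
    and "n \<ge> 2 \<Longrightarrow> x \<in> carrier A \<Longrightarrow> \<delta> (dpow A n x) = dpow D (n - 1) (g x) \<star>\<^bsub>D\<^esub> \<delta> x"
  using assms by (auto simp: dp_der_def)

text \<open>Since index 0 acts as the identity, \<open>dact\<close> lets the rule for n at least 2
  cover n = 1 as well, which is the form of the divided powers of \<open>dual\<close>.\<close>

lemma dp_der_dpow:
  assumes "dp_algebra A" "dp_der A D g \<delta>" "n \<ge> 1" "x \<in> carrier A"
  shows "\<delta> (dpow A n x) = dact D (n - 1) (g x) (\<delta> x)"
  using assms dp_derD(5)[OF assms(2), of n x] dp_algebra.dpow_1[OF assms(1,4)]
  by (cases "n = 1") (auto simp: dact_def)

lemma dp_der_cong:
  assumes "dp_algebra A" "\<And>x. x \<in> carrier A \<Longrightarrow> g x = g' x" "\<And>x. x \<in> carrier A \<Longrightarrow> \<delta> x = \<delta>' x"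
  shows "dp_der A D g \<delta> \<longleftrightarrow> dp_der A D g' \<delta>'"
proof -
  interpret dp_algebra A by fact
  show ?thesis
    by (simp add: dp_der_def assms cong: conj_cong)
qed

lemma dp_der_iff_dual:
  assumes "dp_algebra A" "g \<in> dp_hom A D"
  shows "dp_der A D g \<delta> \<longleftrightarrow> (\<lambda>x\<in>carrier A. (g x, \<delta> x)) \<in> dp_hom A (dual D)"
proof
  assume d: "dp_der A D g \<delta>"
  show "(\<lambda>x\<in>carrier A. (g x, \<delta> x)) \<in> dp_hom A (dual D)"
    using assms
    by (intro restrict_dp_homI)
       (auto simp: dp_hom_closed dp_hom_add dp_hom_scale dp_hom_mult dp_hom_dpow dp_derD[OF d]
          dp_der_dpow[OF assms(1) d])
next
  interpret dp_algebra A by fact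
  let ?k = "\<lambda>x\<in>carrier A. (g x, \<delta> x)"
  assume k: "?k \<in> dp_hom A (dual D)"
  show "dp_der A D g \<delta>"
    unfolding dp_der_def
    using dp_hom_closed[OF k] dp_hom_add[OF k] dp_hom_scale[OF k] dp_hom_mult[OF k] dp_hom_dpow[OF k]
    by (auto simp: dact_def)
qed

lemma
  assumes "dp_algebra A" "k \<in> dp_hom A (dual D)"
  shows fst_dual_dp_hom: "(\<lambda>x\<in>carrier A. fst (k x)) \<in> dp_hom A D"
    and snd_dual_dp_der: "dp_der A D (\<lambda>x. fst (k x)) (\<lambda>x. snd (k x))"
proof -
  interpret dp_algebra A by fact
  note k = dp_hom_closed[OF assms(2)] dp_hom_add[OF assms(2)] dp_hom_scale[OF assms(2)]
    dp_hom_mult[OF assms(2)] dp_hom_dpow[OF assms(2)]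
  show "(\<lambda>x\<in>carrier A. fst (k x)) \<in> dp_hom A D"
    using k by (intro restrict_dp_homI[OF assms(1)]) (auto simp: mem_Times_iff)
  show "dp_der A D (\<lambda>x. fst (k x)) (\<lambda>x. snd (k x))"
    using k by (auto simp: dp_der_def mem_Times_iff dact_def)
qed

lemma dp_der_compose:
  assumes "dp_der A B g \<delta>" "h \<in> dp_hom B D" "dp_algebra B" "\<And>x. x \<in> carrier A \<Longrightarrow> g x \<in> carrier B"
  shows "dp_der A D (\<lambda>x. h (g x)) (\<lambda>x. h (\<delta> x))"
proof -
  interpret dp_algebra B by fact
  show ?thesis
    using assms(4) dp_derD[OF assms(1)] unfolding dp_der_def
    by (auto simp: dp_hom_closed[OF assms(2)] dp_hom_add[OF assms(2)] dp_hom_scale[OF assms(2)]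
        dp_hom_mult[OF assms(2)] dp_hom_dpow[OF assms(2)])
qed

lemma dp_der_precompose:
  assumes "dp_der A B g \<delta>" "f \<in> dp_hom E A"
  shows "dp_der E B (\<lambda>x. g (f x)) (\<lambda>x. \<delta> (f x))"
  using dp_derD[OF assms(1)] unfolding dp_der_def
  by (auto simp: dp_hom_closed[OF assms(2)] dp_hom_add[OF assms(2)] dp_hom_scale[OF assms(2)]
      dp_hom_mult[OF assms(2)] dp_hom_dpow[OF assms(2)])

text \<open>Derivations along a fixed morphism form a vector space; the sum, negative and zero maps
  of the tangent structure come from its operations.\<close>

lemma dp_der_sum:
  assumes "dp_algebra D" "\<And>x. x \<in> carrier A \<Longrightarrow> g x \<in> carrier D" "dp_der A D g \<delta>" "dp_der A D g \<delta>'"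
  shows "dp_der A D g (\<lambda>x. \<delta> x \<oplus>\<^bsub>D\<^esub> \<delta>' x)"
proof -
  interpret dp_algebra D by fact
  show ?thesis
    unfolding dp_der_def
    using dp_derD[OF assms(3)] dp_derD[OF assms(4)] assms(2)
    by (auto simp: mult_add scale_add_right add_add_swap)
qed

lemma dp_der_scale:
  assumes "dp_algebra D" "\<And>x. x \<in> carrier A \<Longrightarrow> g x \<in> carrier D" "dp_der A D g \<delta>"
  shows "dp_der A D g (\<lambda>x. c \<cdot>\<^bsub>D\<^esub> \<delta> x)"
proof -
  interpret dp_algebra D by fact
  show ?thesis
    unfolding dp_der_def
    using dp_derD[OF assms(3)] assms(2)
    by (auto simp: mult_scale scale_add_right scale_scale mult.commute)
qed

lemma dp_der_zero:
  assumes "dp_algebra D" "\<And>x. x \<in> carrier A \<Longrightarrow> g x \<in> carrier D"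
  shows "dp_der A D g (\<lambda>x. \<zero>\<^bsub>D\<^esub>)"
proof -
  interpret dp_algebra D by fact
  show ?thesis
    unfolding dp_der_def using assms(2) by auto
qed

lemma dual_map_dp_hom:
  assumes "dp_algebra B" "h \<in> dp_hom B D"
  shows "(\<lambda>x\<in>carrier (dual B). (h (fst x), h (snd x))) \<in> dp_hom (dual B) (dual D)"
proof -
  interpret dp_algebra B by fact
  show ?thesis
    by (intro restrict_dp_homI dp_algebra_dual assms)
       (auto simp: dp_hom_closed[OF assms(2)] dp_hom_add[OF assms(2)] dp_hom_scale[OF assms(2)]
        dp_hom_mult[OF assms(2)] dp_hom_dpow[OF assms(2)] dp_hom_dact[OF assms(2) _ _ assms(1)])
qed

text \<open>The inner pairs are numbers in \<epsilon>, the outer pair is one in \<epsilon>', so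
  exchanging the two variables moves only the two middle coefficients.\<close>

lemma dual_swap_dp_hom:
  assumes "dp_algebra D"
  shows "(\<lambda>x\<in>carrier (dual (dual D)). ((fst (fst x), fst (snd x)), (snd (fst x), snd (snd x))))
      \<in> dp_hom (dual (dual D)) (dual (dual D))"
proof -
  interpret dp_algebra D by fact
  show ?thesis
    by (intro restrict_dp_homI dp_algebra_dual assms)
       (auto simp: add_ac mult_ac dact_def)
qed

text \<open>Like \<epsilon>, the product \<epsilon>\<epsilon>' has square zero and its multiples
  have no divided powers of index at least 2, so it may be substituted for \<epsilon>.\<close>

lemma dual_lift_dp_hom:
  assumes "dp_algebra D"
  shows "(\<lambda>x\<in>carrier (dual D). ((fst x, \<zero>\<^bsub>D\<^esub>), (\<zero>\<^bsub>D\<^esub>, snd x))) \<in> dp_hom (dual D) (dual (dual D))"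
proof -
  interpret dp_algebra D by fact
  show ?thesis
    by (intro restrict_dp_homI dp_algebra_dual assms) (auto simp: dact_def)
qed

section \<open>Subalgebras and transport of structure\<close>

lemma dp_subalgebra:
  assumes "dp_algebra B" "S \<subseteq> carrier B" "\<zero>\<^bsub>B\<^esub> \<in> S"
    and "\<And>x y. x \<in> S \<Longrightarrow> y \<in> S \<Longrightarrow> x \<oplus>\<^bsub>B\<^esub> y \<in> S"
    and "\<And>x k. x \<in> S \<Longrightarrow> k \<cdot>\<^bsub>B\<^esub> x \<in> S"
    and "\<And>x y. x \<in> S \<Longrightarrow> y \<in> S \<Longrightarrow> x \<star>\<^bsub>B\<^esub> y \<in> S"
    and "\<And>x n. n \<ge> 1 \<Longrightarrow> x \<in> S \<Longrightarrow> dpow B n x \<in> S"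
  shows "dp_algebra (B\<lparr>carrier := S\<rparr>)"
proof -
  have *: "(\<lambda>x\<in>S. x) \<in> dp_hom (B\<lparr>carrier := S\<rparr>) B"
    using assms by (auto simp: dp_hom_def)
  show ?thesis
    by (rule dp_algebra_jointly_monic[where K = "{(B, \<lambda>x\<in>S. x)}"]) (use assms * in auto)
qed

lemma dp_equalizer:
  assumes "dp_algebra B" "dp_algebra D" "f \<in> dp_hom B D" "g \<in> dp_hom B D"
  defines "S \<equiv> {x \<in> carrier B. f x = g x}"
  shows "dp_algebra (B\<lparr>carrier := S\<rparr>)"
proof -
  interpret dp_algebra B by fact
  show ?thesis
    by (rule dp_subalgebra;
        auto simp: S_def assms dp_hom_zero[OF assms(1,2,3)] dp_hom_zero[OF assms(1,2,4)]
          dp_hom_add[OF assms(3)] dp_hom_scale[OF assms(3)] dp_hom_mult[OF assms(3)] dp_hom_dpow[OF assms(3)]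
          dp_hom_add[OF assms(4)] dp_hom_scale[OF assms(4)] dp_hom_mult[OF assms(4)] dp_hom_dpow[OF assms(4)])
qed

text \<open>Brings algebras with carrier in another type, such as dual numbers, under universal
  properties that quantify over algebras on \<open>'u\<close> only.\<close>

lemma dp_algebra_transport:
  fixes D :: "('f::field, 'v) dpa" and e :: "'v \<Rightarrow> 'u"
  assumes "dp_algebra D" "inj e"
  obtains E :: "('f, 'u) dpa" and \<phi> \<psi> where "dp_algebra E" "\<phi> \<in> dp_hom D E" "\<psi> \<in> dp_hom E D"
    "\<And>x. x \<in> carrier D \<Longrightarrow> \<psi> (\<phi> x) = x" "\<And>y. y \<in> carrier E \<Longrightarrow> \<phi> (\<psi> y) = y"
proof -
  interpret dp_algebra D by fact
  let ?r = "inv_into UNIV e"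
  define E where "E = \<lparr>carrier = e ` carrier D, vzero = e \<zero>\<^bsub>D\<^esub>, vadd = (\<lambda>x y. e (?r x \<oplus>\<^bsub>D\<^esub> ?r y)),
     vscale = (\<lambda>k x. e (k \<cdot>\<^bsub>D\<^esub> ?r x)), amult = (\<lambda>x y. e (?r x \<star>\<^bsub>D\<^esub> ?r y)),
     dpow = (\<lambda>n x. e (dpow D n (?r x)))\<rparr>"
  have r [simp]: "?r (e x) = x" for x
    using assms(2) by simp
  have \<phi>: "(\<lambda>x\<in>carrier D. e x) \<in> dp_hom D E"
    by (rule restrict_dp_homI[OF assms(1)]) (auto simp: E_def)
  have \<psi>: "(\<lambda>x\<in>carrier E. ?r x) \<in> dp_hom E D"
    by (auto simp: dp_hom_def E_def)
  have "dp_algebra E"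
    by (rule dp_algebra_jointly_monic[where K = "{(D, \<lambda>x\<in>carrier E. ?r x)}"])
       (use assms(1) \<psi> in \<open>auto simp: E_def\<close>)
  then show thesis
    using \<phi> \<psi> by (rule that) (auto simp: E_def)
qed

section \<open>Algebras presented by families of valuations\<close>

text \<open>\<open>Divp n\<close> stands for the divided power of index n + 1, so no term mentions
  the meaningless index 0.\<close>

datatype ('f, 'x) dp_term =
  Gen 'x | Null | Plus "('f, 'x) dp_term" "('f, 'x) dp_term" | Scal 'f "('f, 'x) dp_term"
  | Times "('f, 'x) dp_term" "('f, 'x) dp_term" | Divp nat "('f, 'x) dp_term"

fun eval_term :: "('f::field, 'v) dpa \<Rightarrow> ('x \<Rightarrow> 'v) \<Rightarrow> ('f, 'x) dp_term \<Rightarrow> 'v" where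
  "eval_term D v (Gen x) = v x"
| "eval_term D v Null = \<zero>\<^bsub>D\<^esub>"
| "eval_term D v (Plus s t) = eval_term D v s \<oplus>\<^bsub>D\<^esub> eval_term D v t"
| "eval_term D v (Scal k t) = k \<cdot>\<^bsub>D\<^esub> eval_term D v t"
| "eval_term D v (Times s t) = eval_term D v s \<star>\<^bsub>D\<^esub> eval_term D v t"
| "eval_term D v (Divp n t) = dpow D (Suc n) (eval_term D v t)"

lemma eval_term_closed:
  assumes "dp_algebra D" "range v \<subseteq> carrier D"
  shows "eval_term D v t \<in> carrier D"
proof -
  interpret dp_algebra D by fact
  show ?thesis
    using assms(2) by (induction t) auto
qed

text \<open>The values of \<open>m\<close> serve both as tags that tell the constructors apart and
  as codes for indices of divided powers; \<open>c\<close> packs pairs, \<open>e\<close> codes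
  scalars and \<open>g\<close> codes generators.\<close>

fun code_term :: "('u \<times> 'u \<Rightarrow> 'u) \<Rightarrow> (nat \<Rightarrow> 'u) \<Rightarrow> ('f \<Rightarrow> 'u) \<Rightarrow> ('x \<Rightarrow> 'u) \<Rightarrow> ('f, 'x) dp_term \<Rightarrow> 'u" where
  "code_term c m e g (Gen x) = c (m 0, g x)"
| "code_term c m e g Null = c (m 1, m 0)"
| "code_term c m e g (Plus s t) = c (m 2, c (code_term c m e g s, code_term c m e g t))"
| "code_term c m e g (Scal k t) = c (m 3, c (e k, code_term c m e g t))"
| "code_term c m e g (Times s t) = c (m 4, c (code_term c m e g s, code_term c m e g t))"
| "code_term c m e g (Divp n t) = c (m 5, c (m n, code_term c m e g t))"

lemma inj_code_term:
  assumes "inj c" "inj m" "inj e" "inj g"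
  shows "inj (code_term c m e g)"
proof -
  note [simp] = inj_eq[OF assms(1)] inj_eq[OF assms(2)] inj_eq[OF assms(3)] inj_eq[OF assms(4)]
  have "code_term c m e g s = code_term c m e g t \<Longrightarrow> s = t" for s t
  proof (induction s arbitrary: t)
    case (Plus s1 s2)
    then show ?case by (cases t) auto
  next
    case (Scal k s)
    then show ?case by (cases t) auto
  next
    case (Times s1 s2)
    then show ?case by (cases t) auto
  next
    case (Divp n s)
    then show ?case by (cases t) auto
  qed (case_tac t; simp)+
  then show ?thesis by (rule injI)
qed

text \<open>An infinite type has room for pairs of its elements and for the natural numbers.
  Together with codes for scalars this embeds all terms over the generators used below into the
  universe, so algebras presented by such terms exist on it.\<close>

locale large_universe =
  fixes e :: "'f::field \<Rightarrow> 'u"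
  assumes infinite_universe: "infinite (UNIV :: 'u set)"
    and inj_scalar: "inj e"
begin

lemma ex_inj_pair: "\<exists>c :: 'u \<times> 'u \<Rightarrow> 'u. inj c"
proof -
  have "(card_of (UNIV :: ('u \<times> 'u) set), card_of (UNIV :: 'u set)) \<in> ordLeq"
    using card_of_Times_same_infinite[OF infinite_universe] by (simp add: ordIso_iff_ordLeq)
  then show ?thesis
    by (simp flip: card_of_ordLeq)
qed

lemma ex_inj_nat: "\<exists>m :: nat \<Rightarrow> 'u. inj m"
  using infinite_countable_subset[OF infinite_universe] by blast

lemma ex_inj_nat_pair: "\<exists>m :: nat \<times> 'u \<Rightarrow> 'u. inj m"
proof -
  obtain c :: "'u \<times> 'u \<Rightarrow> 'u" and m :: "nat \<Rightarrow> 'u" where "inj c" "inj m"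
    using ex_inj_pair ex_inj_nat by blast
  then have "inj (c \<circ> map_prod m id)"
    by (intro inj_compose prod.inj_map) auto
  then show ?thesis by blast
qed

text \<open>The algebra is the quotient of the terms by the joint kernel of the valuations in \<open>K\<close>, so it satisfies
  the identities that hold under all of them; a class is represented by the code of a chosen member.\<close>

lemma presented_dp_algebra:
  fixes K :: "(('f, 'u) dpa \<times> ('x \<Rightarrow> 'u)) set" and g :: "'x \<Rightarrow> 'u"
  assumes K: "\<And>D v. (D, v) \<in> K \<Longrightarrow> dp_algebra D \<and> range v \<subseteq> carrier D"
    and "inj g"
  obtains F :: "('f, 'u) dpa" and \<iota> :: "'x \<Rightarrow> 'u" where "dp_algebra F" "range \<iota> \<subseteq> carrier F"
    "\<And>D v. (D, v) \<in> K \<Longrightarrow> \<exists>h \<in> dp_hom F D. \<forall>x. h (\<iota> x) = v x"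
    "\<And>x y. x \<in> carrier F \<Longrightarrow> y \<in> carrier F \<Longrightarrow>
       (\<And>D v h. (D, v) \<in> K \<Longrightarrow> h \<in> dp_hom F D \<Longrightarrow> (\<And>x. h (\<iota> x) = v x) \<Longrightarrow> h x = h y) \<Longrightarrow> x = y"
    "\<And>(B :: ('f, 'u) dpa) f h. dp_algebra B \<Longrightarrow> f \<in> dp_hom F B \<Longrightarrow> h \<in> dp_hom F B \<Longrightarrow>
       (\<And>x. f (\<iota> x) = h (\<iota> x)) \<Longrightarrow> f = h"
proof -
  obtain code :: "('f, 'x) dp_term \<Rightarrow> 'u" where code: "inj code"
    using ex_inj_pair ex_inj_nat inj_code_term inj_scalar assms(2) by metis
  define equiv where "equiv s t \<longleftrightarrow> (\<forall>(D, v) \<in> K. eval_term D v s = eval_term D v t)" for s t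
  define nf where "nf t = code (SOME s. equiv s t)" for t
  have nf_eq: "nf s = nf t \<longleftrightarrow> equiv s t" for s t
  proof
    assume "nf s = nf t"
    then have *: "(SOME u. equiv u s) = (SOME u. equiv u t)"
      using code by (simp add: nf_def inj_eq)
    have "equiv (SOME u. equiv u s) s" "equiv (SOME u. equiv u t) t"
      by (rule someI[where P = "\<lambda>u. equiv u s" and x = s], simp add: equiv_def)
         (rule someI[where P = "\<lambda>u. equiv u t" and x = t], simp add: equiv_def)
    with * show "equiv s t"
      by (fastforce simp: equiv_def)
  next
    assume "equiv s t"
    then have "equiv u s \<longleftrightarrow> equiv u t" for u
      by (fastforce simp: equiv_def)
    then show "nf s = nf t" by (simp add: nf_def)
  qed
  \<comment> \<open>\<open>tm\<close> need not recover the original term, only an equivalent one,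
    and evaluation under the valuations in \<open>K\<close> cannot tell the two apart.\<close>
  define tm where "tm x = (SOME t. nf t = x)" for x
  have nf_tm: "nf (tm (nf t)) = nf t" for t
    unfolding tm_def by (rule someI[where x = t]) simp
  have ev: "eval_term D v (tm (nf t)) = eval_term D v t" if "(D, v) \<in> K" for D v t
    using nf_tm[of t] that by (auto simp: nf_eq equiv_def)
  define F :: "('f, 'u) dpa" where "F = \<lparr>carrier = range nf, vzero = nf Null, vadd = (\<lambda>x y. nf (Plus (tm x) (tm y))),
     vscale = (\<lambda>k x. nf (Scal k (tm x))), amult = (\<lambda>x y. nf (Times (tm x) (tm y))),
     dpow = (\<lambda>n x. nf (Divp (n - 1) (tm x)))\<rparr>"
  have hom: "(\<lambda>x\<in>carrier F. eval_term D v (tm x)) \<in> dp_hom F D" if "(D, v) \<in> K" for D v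
    using that K[OF that] by (auto simp: dp_hom_def F_def ev intro: eval_term_closed)
  have F: "dp_algebra F"
  proof (rule dp_algebra_jointly_monic[where K = "(\<lambda>(D, v). (D, \<lambda>x\<in>carrier F. eval_term D v (tm x))) ` K"])
    fix D h assume "(D, h) \<in> (\<lambda>(D, v). (D, \<lambda>x\<in>carrier F. eval_term D v (tm x))) ` K"
    then show "dp_algebra D \<and> h \<in> dp_hom F D \<and> h \<zero>\<^bsub>F\<^esub> = \<zero>\<^bsub>D\<^esub>"
      using K hom by (auto simp: F_def ev)
  next
    fix x y assume "x \<in> carrier F" "y \<in> carrier F" and
      eq: "\<And>D h. (D, h) \<in> (\<lambda>(D, v). (D, \<lambda>x\<in>carrier F. eval_term D v (tm x))) ` K \<Longrightarrow> h x = h y"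
    then obtain s t where st: "x = nf s" "y = nf t" by (auto simp: F_def)
    have "eval_term D v s = eval_term D v t" if "(D, v) \<in> K" for D v
      using eq[of D "\<lambda>x\<in>carrier F. eval_term D v (tm x)"] that ev[OF that] st
      by (force simp: F_def)
    then show "x = y"
      by (auto simp: st nf_eq equiv_def)
  qed (auto simp: F_def)
  define \<iota> where "\<iota> x = nf (Gen x)" for x
  have ops: "nf (Plus s t) = nf s \<oplus>\<^bsub>F\<^esub> nf t" "nf (Scal k t) = k \<cdot>\<^bsub>F\<^esub> nf t" "nf (Times s t) = nf s \<star>\<^bsub>F\<^esub> nf t"
    "nf (Divp n t) = dpow F (Suc n) (nf t)" "nf Null = \<zero>\<^bsub>F\<^esub>" for s t k n
    by (auto simp: F_def nf_eq equiv_def ev)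
  \<comment> \<open>Every element is the normal form of a term, and \<open>nf\<close> turns term
    constructors into the operations of \<open>F\<close>; so agreement on generators spreads by
    induction on terms.\<close>
  have gen: "f (nf t) = h (nf t)"
    if "dp_algebra B" "f \<in> dp_hom F B" "h \<in> dp_hom F B" "\<And>x. f (\<iota> x) = h (\<iota> x)"
    for B :: "('f, 'u) dpa" and f h t
  proof (induction t)
    case (Gen x)
    then show ?case using that(4) by (simp add: \<iota>_def)
  next
    case Null
    then show ?case using dp_hom_zero[OF F that(1,2)] dp_hom_zero[OF F that(1,3)] by (simp add: ops)
  qed (simp_all add: ops dp_hom_add[OF that(2)] dp_hom_add[OF that(3)] dp_hom_scale[OF that(2)]
      dp_hom_scale[OF that(3)] dp_hom_mult[OF that(2)] dp_hom_mult[OF that(3)]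
      dp_hom_dpow[OF that(2)] dp_hom_dpow[OF that(3)] F_def[THEN arg_cong, of carrier, simplified])
  show thesis
  proof (rule that[of F \<iota>])
    show "range \<iota> \<subseteq> carrier F"
      by (auto simp: \<iota>_def F_def)
    show "\<exists>h \<in> dp_hom F D. \<forall>x. h (\<iota> x) = v x" if "(D, v) \<in> K" for D v
      using hom[OF that] by (rule rev_bexI) (auto simp: \<iota>_def F_def ev[OF that])
    show "x = y" if xy: "x \<in> carrier F" "y \<in> carrier F"
       and eq: "\<And>D v h. (D, v) \<in> K \<Longrightarrow> h \<in> dp_hom F D \<Longrightarrow> (\<And>x. h (\<iota> x) = v x) \<Longrightarrow> h x = h y" for x y
    proof -
      obtain s t where st: "x = nf s" "y = nf t" using xy by (auto simp: F_def)
      have "eval_term D v s = eval_term D v t" if "(D, v) \<in> K" for D v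
        using eq[OF that hom[OF that]] ev[OF that] st by (simp add: F_def \<iota>_def)
      then show "x = y"
        by (auto simp: st nf_eq equiv_def)
    qed
    show "f = h" if "dp_algebra B" "f \<in> dp_hom F B" "h \<in> dp_hom F B" "\<And>x. f (\<iota> x) = h (\<iota> x)"
      for B :: "('f, 'u) dpa" and f h
      using gen[OF that] by (intro dp_hom_eqI[OF that(2,3)]) (auto simp: F_def)
  qed (rule F)
qed

end

section \<open>Quotients of modules\<close>

lemma umoduleI:
  assumes "comm_nalg A" "vect M"
    and "\<And>a m. a \<in> carrier A \<Longrightarrow> m \<in> carrier M \<Longrightarrow> act M a m \<in> carrier M"
    and "\<And>a a' m. a \<in> carrier A \<Longrightarrow> a' \<in> carrier A \<Longrightarrow> m \<in> carrier M
          \<Longrightarrow> act M (a \<star>\<^bsub>A\<^esub> a') m = act M a (act M a' m)"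
    and "\<And>a a' m. a \<in> carrier A \<Longrightarrow> a' \<in> carrier A \<Longrightarrow> m \<in> carrier M
          \<Longrightarrow> act M (a \<oplus>\<^bsub>A\<^esub> a') m = act M a m \<oplus>\<^bsub>M\<^esub> act M a' m"
    and "\<And>a m m'. a \<in> carrier A \<Longrightarrow> m \<in> carrier M \<Longrightarrow> m' \<in> carrier M
          \<Longrightarrow> act M a (m \<oplus>\<^bsub>M\<^esub> m') = act M a m \<oplus>\<^bsub>M\<^esub> act M a m'"
    and "\<And>a k m. a \<in> carrier A \<Longrightarrow> m \<in> carrier M \<Longrightarrow> act M (k \<cdot>\<^bsub>A\<^esub> a) m = k \<cdot>\<^bsub>M\<^esub> act M a m"
    and "\<And>a k m. a \<in> carrier A \<Longrightarrow> m \<in> carrier M \<Longrightarrow> act M a (k \<cdot>\<^bsub>M\<^esub> m) = k \<cdot>\<^bsub>M\<^esub> act M a m"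
  shows "umodule A M"
  using assms by (simp add: umodule_def umodule_axioms_def)

lemma umod_homD:
  assumes "h \<in> umod_hom A M N"
  shows "x \<in> carrier M \<Longrightarrow> h x \<in> carrier N"
    and "x \<in> carrier M \<Longrightarrow> y \<in> carrier M \<Longrightarrow> h (x \<oplus>\<^bsub>M\<^esub> y) = h x \<oplus>\<^bsub>N\<^esub> h y"
    and "x \<in> carrier M \<Longrightarrow> h (k \<cdot>\<^bsub>M\<^esub> x) = k \<cdot>\<^bsub>N\<^esub> h x"
    and "a \<in> carrier A \<Longrightarrow> x \<in> carrier M \<Longrightarrow> h (act M a x) = act N a (h x)"
  using assms by (auto simp: umod_hom_def)

lemma umod_hom_eqI:
  "f \<in> umod_hom A M N \<Longrightarrow> g \<in> umod_hom A M N \<Longrightarrow> (\<And>x. x \<in> carrier M \<Longrightarrow> f x = g x) \<Longrightarrow> f = g"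
  by (auto simp: umod_hom_def intro: PiE_ext)

lemma umod_hom_zero:
  assumes "vect M" "vect N" "h \<in> umod_hom A M N"
  shows "h \<zero>\<^bsub>M\<^esub> = \<zero>\<^bsub>N\<^esub>"
proof -
  interpret M: vect M by fact
  interpret N: vect N by fact
  show ?thesis
    using umod_homD(1,3)[OF assms(3), of "\<zero>\<^bsub>M\<^esub>"] by (metis M.scale_zero M.zero_closed N.zero_scale)
qed

lemma umod_hom_minus:
  assumes "vect M" "vect N" "h \<in> umod_hom A M N" "x \<in> carrier M" "y \<in> carrier M"
  shows "h (vminus M x y) = vminus N (h x) (h y)"
proof -
  interpret M: vect M by fact
  interpret N: vect N by fact
  show ?thesis
    using assms(4,5) umod_homD[OF assms(3)] by (simp add: vminus_def M.neg_eq_scale N.neg_eq_scale)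
qed

lemma is_submoduleD:
  assumes "is_submodule A M N"
  shows "N \<subseteq> carrier M" "\<zero>\<^bsub>M\<^esub> \<in> N" "x \<in> N \<Longrightarrow> y \<in> N \<Longrightarrow> x \<oplus>\<^bsub>M\<^esub> y \<in> N" "x \<in> N \<Longrightarrow> k \<cdot>\<^bsub>M\<^esub> x \<in> N"
    "a \<in> carrier A \<Longrightarrow> x \<in> N \<Longrightarrow> act M a x \<in> N"
  using assms by (auto simp: is_submodule_def)

text \<open>Replaces an induction over generators: two module maps that agree on generators agree on
  a submodule containing them, hence everywhere.\<close>

lemma umod_hom_equalizer:
  assumes "umodule A M" "umodule A L" "f \<in> umod_hom A M L" "g \<in> umod_hom A M L"
  shows "is_submodule A M {x \<in> carrier M. f x = g x}"
proof -
  interpret umodule A M by fact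
  interpret L: umodule A L by fact
  show ?thesis
    using umod_homD[OF assms(3)] umod_homD[OF assms(4)]
      umod_hom_zero[OF M.vect_axioms L.M.vect_axioms assms(3)]
      umod_hom_zero[OF M.vect_axioms L.M.vect_axioms assms(4)]
    by (auto simp: is_submodule_def act_closed)
qed

lemma umod_hom_kernel:
  assumes "umodule A M" "umodule A L" "f \<in> umod_hom A M L"
  shows "is_submodule A M {x \<in> carrier M. f x = \<zero>\<^bsub>L\<^esub>}"
proof -
  interpret umodule A M by fact
  interpret L: umodule A L by fact
  have "act L a \<zero>\<^bsub>L\<^esub> = \<zero>\<^bsub>L\<^esub>" if "a \<in> carrier A" for a
    using L.act_scale_right[OF that L.M.zero_closed, of 0] L.act_closed[OF that L.M.zero_closed] by simp
  then show ?thesis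
    using umod_homD[OF assms(3)] umod_hom_zero[OF M.vect_axioms L.M.vect_axioms assms(3)]
    by (auto simp: is_submodule_def act_closed)
qed

text \<open>Serves to pull the locus where two maps on differentials agree back along the quotient
  maps to the free module, whose generators are explicit.\<close>

lemma submodule_preimage:
  assumes "umodule A M" "umodule A L" "f \<in> umod_hom A M L" "is_submodule A L N"
  shows "is_submodule A M {x \<in> carrier M. f x \<in> N}"
proof -
  interpret umodule A M by fact
  interpret L: umodule A L by fact
  show ?thesis
    using umod_homD[OF assms(3)] umod_hom_zero[OF M.vect_axioms L.M.vect_axioms assms(3)]
      is_submoduleD[OF assms(4)]
    by (auto simp: is_submodule_def act_closed)
qed

lemma submodule_generated_minimal:
  "is_submodule A M N \<Longrightarrow> R \<subseteq> N \<Longrightarrow> submodule_generated A M R \<subseteq> N"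
  by (auto simp: submodule_generated_def)

context umodule
begin

lemma carrier_is_submodule: "is_submodule A M (carrier M)"
  by (auto simp: is_submodule_def act_closed)

lemma submodule_generated_is_submodule:
  assumes "R \<subseteq> carrier M"
  shows "is_submodule A M (submodule_generated A M R)"
  using submodule_generated_minimal[OF carrier_is_submodule assms]
  by (auto simp: is_submodule_def submodule_generated_def)

lemma submodule_is_subgroup:
  assumes "is_submodule A M N"
  shows "subgroup N (additive M)"
proof -
  note N = is_submoduleD[OF assms]
  have "inv\<^bsub>additive M\<^esub> x \<in> N" if "x \<in> N" for x
    using M.neg_eq_scale[of x] N(1) N(4)[OF that, of "- 1"] that by (auto simp: vneg_def)
  then show ?thesis
    using N by (intro subgroup.intro) auto
qed

lemma residue_class_eq_iff:
  assumes "is_submodule A M N" "x \<in> carrier M" "y \<in> carrier M"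
  shows "residue_class M N x = residue_class M N y \<longleftrightarrow> vminus M x y \<in> N"
proof -
  have eq: "n \<oplus>\<^bsub>M\<^esub> y = x \<longleftrightarrow> n = vminus M x y" if "n \<in> carrier M" for n
    unfolding vminus_def using that assms
    by (auto simp: M.add_assoc)
  have sub: "N \<subseteq> carrier M" using is_submoduleD(1)[OF assms(1)] .
  have "residue_class M N x = residue_class M N y \<longleftrightarrow> x \<in> N #>\<^bsub>additive M\<^esub> y"
    unfolding residue_class_def
    using M.ad.repr_independence[of x N y] M.ad.rcos_self[of x N] submodule_is_subgroup[OF assms(1)] assms(2,3)
    by auto
  also have "\<dots> \<longleftrightarrow> (\<exists>n\<in>N. n \<oplus>\<^bsub>M\<^esub> y = x)"
    by (auto simp: r_coset_def)
  also have "\<dots> \<longleftrightarrow> (\<exists>n\<in>N. n = vminus M x y)"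
    using eq sub by blast
  also have "\<dots> \<longleftrightarrow> vminus M x y \<in> N"
    by simp
  finally show ?thesis .
qed

lemma quotient_umod_simps:
  assumes N: "is_submodule A M N"
  shows "carrier (quotient_umod M N) = residue_class M N ` carrier M"
    and "\<zero>\<^bsub>quotient_umod M N\<^esub> = residue_class M N \<zero>\<^bsub>M\<^esub>"
    and "x \<in> carrier M \<Longrightarrow> y \<in> carrier M \<Longrightarrow>
      residue_class M N x \<oplus>\<^bsub>quotient_umod M N\<^esub> residue_class M N y = residue_class M N (x \<oplus>\<^bsub>M\<^esub> y)"
    and "x \<in> carrier M \<Longrightarrow>
      k \<cdot>\<^bsub>quotient_umod M N\<^esub> residue_class M N x = residue_class M N (k \<cdot>\<^bsub>M\<^esub> x)"
    and "a \<in> carrier A \<Longrightarrow> x \<in> carrier M \<Longrightarrow>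
      act (quotient_umod M N) a (residue_class M N x) = residue_class M N (act M a x)"
proof -
  have sg: "subgroup N (additive M)" by (rule submodule_is_subgroup[OF N])
  interpret normal N "additive M"
    using sg M.ad.subgroup_imp_normal by blast
  show "carrier (quotient_umod M N) = residue_class M N ` carrier M"
    by (auto simp: quotient_umod_def FactGroup_def RCOSETS_def residue_class_def)
  show "\<zero>\<^bsub>quotient_umod M N\<^esub> = residue_class M N \<zero>\<^bsub>M\<^esub>"
    using M.ad.coset_mult_one[of N] is_submoduleD(1)[OF N]
    by (simp add: quotient_umod_def FactGroup_def residue_class_def)
  show "residue_class M N x \<oplus>\<^bsub>quotient_umod M N\<^esub> residue_class M N y = residue_class M N (x \<oplus>\<^bsub>M\<^esub> y)"
    if "x \<in> carrier M" "y \<in> carrier M"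
    using rcos_sum[of x y] that by (simp add: quotient_umod_def FactGroup_def residue_class_def)
  \<comment> \<open>Scaling and action on the quotient are unions over all representatives. An
    additive map preserving \<open>N\<close> sends the representatives of a class into one class, so
    all sets in such a union coincide.\<close>
  have UN: "(\<Union>y\<in>residue_class M N x. residue_class M N (h y)) = residue_class M N (h x)"
    if x: "x \<in> carrier M" and h: "\<And>y. y \<in> carrier M \<Longrightarrow> h y \<in> carrier M"
      "\<And>y z. y \<in> carrier M \<Longrightarrow> z \<in> carrier M \<Longrightarrow> h (y \<oplus>\<^bsub>M\<^esub> z) = h y \<oplus>\<^bsub>M\<^esub> h z"
      "\<And>y. y \<in> N \<Longrightarrow> h y \<in> N" for x h
  proof -
    have "residue_class M N (h y) = residue_class M N (h x)" if y: "y \<in> residue_class M N x" for y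
    proof -
      obtain n where n: "n \<in> N" "y = n \<oplus>\<^bsub>M\<^esub> x"
        using y by (auto simp: residue_class_def r_coset_def)
      have "n \<in> carrier M" using n is_submoduleD(1)[OF N] by auto
      then have "h y \<in> N #>\<^bsub>additive M\<^esub> h x"
        using n x h by (auto simp: r_coset_def)
      then show ?thesis
        unfolding residue_class_def using M.ad.repr_independence[of "h y" N "h x"] sg x h by simp
    qed
    moreover have "x \<in> residue_class M N x"
      unfolding residue_class_def using M.ad.rcos_self[of x N] sg x by simp
    ultimately show ?thesis by blast
  qed
  show "k \<cdot>\<^bsub>quotient_umod M N\<^esub> residue_class M N x = residue_class M N (k \<cdot>\<^bsub>M\<^esub> x)"
    if "x \<in> carrier M"
    using UN[OF that, of "\<lambda>x. k \<cdot>\<^bsub>M\<^esub> x"] is_submoduleD[OF N] M.scale_add_right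
    by (simp add: quotient_umod_def)
  show "act (quotient_umod M N) a (residue_class M N x) = residue_class M N (act M a x)"
    if "a \<in> carrier A" "x \<in> carrier M"
    using UN[OF that(2), of "act M a"] is_submoduleD[OF N] that act_add_right act_closed
    by (simp add: quotient_umod_def)
qed

lemma umodule_quotient:
  assumes N: "is_submodule A M N"
  shows "umodule A (quotient_umod M N)"
proof -
  note q = quotient_umod_simps[OF N]
  have "vect (quotient_umod M N)"
    by (rule vectI)
       (auto simp: q M.add_ac M.scale_scale M.scale_add_left M.scale_add_right)
  then show ?thesis
    by (rule umoduleI[OF comm_nalg_axioms])
       (auto simp: q act_closed act_act act_add_left act_add_right act_scale_left act_scale_right)
qed

lemma residue_class_hom:
  assumes N: "is_submodule A M N"
  shows "restrict (residue_class M N) (carrier M) \<in> umod_hom A M (quotient_umod M N)"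
  using quotient_umod_simps[OF N] by (auto simp: umod_hom_def act_closed)

lemma quotient_umod_factor:
  assumes N: "is_submodule A M N" and L: "umodule A L" and f: "f \<in> umod_hom A M L"
    and ker: "\<And>x. x \<in> N \<Longrightarrow> f x = \<zero>\<^bsub>L\<^esub>"
  shows "\<exists>h \<in> umod_hom A (quotient_umod M N) L. \<forall>x\<in>carrier M. h (residue_class M N x) = f x"
proof -
  interpret L: umodule A L by fact
  note q = quotient_umod_simps[OF N]
  let ?r = "residue_class M N"
  \<comment> \<open>An arbitrary representative may be chosen, because two of them differ by an
    element of \<open>N\<close>, which \<open>f\<close> kills.\<close>
  define h where "h X = f (SOME x. x \<in> carrier M \<and> ?r x = X)" for X
  have h: "h (?r x) = f x" if x: "x \<in> carrier M" for x
  proof -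
    let ?y = "SOME y. y \<in> carrier M \<and> ?r y = ?r x"
    have y: "?y \<in> carrier M \<and> ?r ?y = ?r x"
      by (rule someI[of _ x]) (use x in simp)
    then have "f (vminus M ?y x) = \<zero>\<^bsub>L\<^esub>"
      using ker x residue_class_eq_iff[OF N] by blast
    then have "f ?y = f x"
      using y x umod_homD(1)[OF f] by (simp add: umod_hom_minus[OF M.vect_axioms L.M.vect_axioms f] L.M.minus_eq_zero_iff)
    then show ?thesis by (simp add: h_def)
  qed
  have "restrict h (carrier (quotient_umod M N)) \<in> umod_hom A (quotient_umod M N) L"
    using umod_homD[OF f] by (auto simp: umod_hom_def q h act_closed)
  then show ?thesis
    by (rule rev_bexI) (simp add: h q(1))
qed

end

section \<open>Free modules\<close>

lemma free_umod_simps: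
  "v \<in> carrier (free_umod A S) \<longleftrightarrow>
     (\<forall>s. snd (v s) \<in> carrier A) \<and> finite {s. v s \<noteq> (0, \<zero>\<^bsub>A\<^esub>)} \<and> {s. v s \<noteq> (0, \<zero>\<^bsub>A\<^esub>)} \<subseteq> S"
  "\<zero>\<^bsub>free_umod A S\<^esub> = (\<lambda>s. (0, \<zero>\<^bsub>A\<^esub>))"
  "v \<oplus>\<^bsub>free_umod A S\<^esub> w = (\<lambda>s. (fst (v s) + fst (w s), snd (v s) \<oplus>\<^bsub>A\<^esub> snd (w s)))"
  "k \<cdot>\<^bsub>free_umod A S\<^esub> v = (\<lambda>s. (k * fst (v s), k \<cdot>\<^bsub>A\<^esub> snd (v s)))"
  "act (free_umod A S) a v = (\<lambda>s. (0, fst (v s) \<cdot>\<^bsub>A\<^esub> a \<oplus>\<^bsub>A\<^esub> a \<star>\<^bsub>A\<^esub> snd (v s)))"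
  by (simp_all add: free_umod_def)

lemma umodule_free:
  assumes "comm_nalg A"
  shows "umodule A (free_umod A S)"
proof -
  interpret comm_nalg A by fact
  let ?F = "free_umod A S"
  \<comment> \<open>Each operation sends zero coordinates to zero, so the support of the result lies
    in the union of the supports of the arguments and stays finite and inside
    \<open>S\<close>.\<close>
  have sub: "w \<in> carrier ?F"
    if "\<And>s. snd (w s) \<in> carrier A" "v \<in> carrier ?F" "v' \<in> carrier ?F"
      "\<And>s. v s = (0, \<zero>\<^bsub>A\<^esub>) \<Longrightarrow> v' s = (0, \<zero>\<^bsub>A\<^esub>) \<Longrightarrow> w s = (0, \<zero>\<^bsub>A\<^esub>)" for v v' w
  proof -
    have "{s. w s \<noteq> (0, \<zero>\<^bsub>A\<^esub>)} \<subseteq> {s. v s \<noteq> (0, \<zero>\<^bsub>A\<^esub>)} \<union> {s. v' s \<noteq> (0, \<zero>\<^bsub>A\<^esub>)}"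
      using that(4) by blast
    with that(1-3) show ?thesis
      unfolding free_umod_simps(1) by (meson finite_UnI finite_subset le_sup_iff subset_trans)
  qed
  have 1: "\<zero>\<^bsub>?F\<^esub> \<in> carrier ?F"
    by (simp add: free_umod_simps)
  have 2: "v \<oplus>\<^bsub>?F\<^esub> w \<in> carrier ?F" if "v \<in> carrier ?F" "w \<in> carrier ?F" for v w
    by (rule sub[OF _ that]) (use that in \<open>auto simp: free_umod_simps\<close>)
  have 3: "k \<cdot>\<^bsub>?F\<^esub> v \<in> carrier ?F" if "v \<in> carrier ?F" for v k
    by (rule sub[OF _ that that]) (use that in \<open>auto simp: free_umod_simps\<close>)
  have 4: "act ?F a v \<in> carrier ?F" if "v \<in> carrier ?F" "a \<in> carrier A" for v a
    by (rule sub[OF _ that(1) that(1)]) (use that in \<open>auto simp: free_umod_simps\<close>)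
  have snd: "snd (v s) \<in> carrier A" if "v \<in> carrier ?F" for v s
    using that by (simp add: free_umod_simps)
  note rules = free_umod_simps(2-5) fun_eq_iff prod_eq_iff snd
  have vect: "vect ?F"
    by (rule vectI; (rule 1 2 3; assumption)?)
       (auto simp: rules add_ac scale_scale scale_add_left scale_add_right algebra_simps)
  show ?thesis
    by (rule umoduleI[OF assms vect]; (rule 4; assumption)?)
       (auto simp: rules mult_add add_mult mult_ac add_ac scale_scale scale_mult mult_scale
         scale_add_left scale_add_right mult.commute)
qed

lemma free_gen_closed: "comm_nalg A \<Longrightarrow> s \<in> S \<Longrightarrow> free_gen A s \<in> carrier (free_umod A S)"
  using vect.zero_closed[of A] by (auto simp: free_umod_simps free_gen_def comm_nalg_def)

text \<open>Induction on a finite set containing the support. A coordinate (k, r) at s splits off as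
  k times the generator at s plus r acting on that generator, k coming from the scalar part of the
  unitalization.\<close>

lemma free_umod_generated:
  assumes "comm_nalg A" "is_submodule A (free_umod A S) N" "\<And>s. s \<in> S \<Longrightarrow> free_gen A s \<in> N"
  shows "carrier (free_umod A S) \<subseteq> N"
proof -
  interpret comm_nalg A by fact
  let ?F = "free_umod A S" and ?supp = "\<lambda>v. {s. v s \<noteq> (0, \<zero>\<^bsub>A\<^esub>)}"
  note N = is_submoduleD[OF assms(2)]
  have "v \<in> N" if "finite T" "T \<subseteq> S" "\<And>s. snd (v s) \<in> carrier A" "?supp v \<subseteq> T" for T v
    using that
  proof (induction T arbitrary: v)
    case empty
    then have "v = \<zero>\<^bsub>?F\<^esub>" by (auto simp: free_umod_simps)
    then show ?case using N(2) by simp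
  next
    case (insert s T)
    have "v(s := (0, \<zero>\<^bsub>A\<^esub>)) \<in> N"
      using insert.prems by (intro insert.IH) auto
    moreover have "fst (v s) \<cdot>\<^bsub>?F\<^esub> free_gen A s \<oplus>\<^bsub>?F\<^esub> act ?F (snd (v s)) (free_gen A s) \<in> N"
      using insert.prems N(3-5) assms(3) by simp
    moreover have "v = v(s := (0, \<zero>\<^bsub>A\<^esub>)) \<oplus>\<^bsub>?F\<^esub>
        (fst (v s) \<cdot>\<^bsub>?F\<^esub> free_gen A s \<oplus>\<^bsub>?F\<^esub> act ?F (snd (v s)) (free_gen A s))"
      using insert.prems(2) by (auto simp: free_umod_simps free_gen_def fun_eq_iff prod_eq_iff)
    ultimately show ?case using N(3) by metis
  qed
  then show ?thesis by (auto simp: free_umod_simps(1))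
qed

lemma free_umod_extend:
  fixes A :: "('f::field, 'r, 'z) nalg_scheme" and L :: "('f, 'r, 'a) umod"
  assumes "umodule A L" "\<And>s. s \<in> S \<Longrightarrow> \<delta> s \<in> carrier L"
  shows "\<exists>h \<in> umod_hom A (free_umod A S) L. \<forall>s\<in>S. h (free_gen A s) = \<delta> s"
proof -
  interpret L: umodule A L by fact
  let ?F = "free_umod A S" and ?supp = "\<lambda>v. {s. v s \<noteq> (0, \<zero>\<^bsub>A\<^esub>)}"
  interpret F: umodule A ?F by (rule umodule_free) unfold_locales
  have act0: "act L \<zero>\<^bsub>A\<^esub> m = \<zero>\<^bsub>L\<^esub>" if "m \<in> carrier L" for m
    using L.act_scale_left[OF L.zero_closed that, of 0] L.act_closed[OF L.zero_closed that] by simp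
  define t where "t v s = fst (v s) \<cdot>\<^bsub>L\<^esub> \<delta> s \<oplus>\<^bsub>L\<^esub> act L (snd (v s)) (\<delta> s)" for v s
  define h where "h v = finprod (additive L) (t v) (?supp v)" for v
  have t: "t v s \<in> carrier L" if "v \<in> carrier ?F" "s \<in> S" for v s
    using that assms(2) by (simp add: t_def free_umod_simps(1) L.act_closed)
  \<comment> \<open>The sum may run over any finite set containing the support, since zero
    coordinates contribute zero. Thus v, w and their sum can be compared over one index set.\<close>
  have h: "h v = finprod (additive L) (t v) T"
    if "v \<in> carrier ?F" "finite T" "T \<subseteq> S" "?supp v \<subseteq> T" for v T
    unfolding h_def
    using that assms(2) t
    by (intro L.M.ad.finprod_mono_neutral_cong_left) (auto simp: t_def act0)
  have fin: "finite (?supp v)" "?supp v \<subseteq> S" if "v \<in> carrier ?F" for v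
    using that by (auto simp: free_umod_simps(1))
  have hc: "h v \<in> carrier L" if "v \<in> carrier ?F" for v
    unfolding h_def using that fin[OF that] t[OF that] by (intro L.M.finprod_in_carrier) auto
  have add: "h (v \<oplus>\<^bsub>?F\<^esub> w) = h v \<oplus>\<^bsub>L\<^esub> h w" if vw: "v \<in> carrier ?F" "w \<in> carrier ?F" for v w
  proof -
    let ?T = "?supp v \<union> ?supp w"
    have T: "finite ?T" "?T \<subseteq> S" using fin vw by auto
    have "h (v \<oplus>\<^bsub>?F\<^esub> w) = finprod (additive L) (t (v \<oplus>\<^bsub>?F\<^esub> w)) ?T"
      using vw T by (intro h F.M.add_closed) (auto simp: free_umod_simps(3))
    also have "\<dots> = finprod (additive L) (\<lambda>s. t v s \<oplus>\<^bsub>L\<^esub> t w s) ?T"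
    proof (rule L.M.ad.finprod_cong')
      fix s assume "s \<in> ?T"
      then have "\<delta> s \<in> carrier L" using T assms(2) by auto
      then show "t (v \<oplus>\<^bsub>?F\<^esub> w) s = t v s \<oplus>\<^bsub>L\<^esub> t w s"
        using vw by (simp add: t_def free_umod_simps(1,3) L.act_add_left L.M.scale_add_left L.act_closed L.M.add_ac)
    qed (use vw t T in auto)
    also have "\<dots> = finprod (additive L) (t v) ?T \<oplus>\<^bsub>L\<^esub> finprod (additive L) (t w) ?T"
      using vw t T by (intro L.M.finprod_add) auto
    also have "\<dots> = h v \<oplus>\<^bsub>L\<^esub> h w"
      using vw T by (subst (1 2) h[symmetric]) auto
    finally show ?thesis .
  qed
  have scale: "h (k \<cdot>\<^bsub>?F\<^esub> v) = k \<cdot>\<^bsub>L\<^esub> h v" if v: "v \<in> carrier ?F" for v k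
  proof -
    note T = fin[OF v]
    have "h (k \<cdot>\<^bsub>?F\<^esub> v) = finprod (additive L) (t (k \<cdot>\<^bsub>?F\<^esub> v)) (?supp v)"
      using v T by (intro h F.M.scale_closed) (auto simp: free_umod_simps(4))
    also have "\<dots> = finprod (additive L) (\<lambda>s. k \<cdot>\<^bsub>L\<^esub> t v s) (?supp v)"
    proof (rule L.M.ad.finprod_cong')
      fix s assume "s \<in> ?supp v"
      then have "\<delta> s \<in> carrier L" using T assms(2) by auto
      then show "t (k \<cdot>\<^bsub>?F\<^esub> v) s = k \<cdot>\<^bsub>L\<^esub> t v s"
        using v by (simp add: t_def free_umod_simps(1,4) L.act_scale_left L.M.scale_add_right L.M.scale_scale L.act_closed)
    qed (use v t T in auto)
    also have "\<dots> = k \<cdot>\<^bsub>L\<^esub> h v"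
      unfolding h_def using v t T
      by (intro additive_map_finprod[OF L.M.vect_axioms L.M.vect_axioms, symmetric]) (auto simp: L.M.scale_add_right)
    finally show ?thesis .
  qed
  have act: "h (act ?F a v) = act L a (h v)" if v: "v \<in> carrier ?F" and a: "a \<in> carrier A" for v a
  proof -
    note T = fin[OF v]
    have "h (act ?F a v) = finprod (additive L) (t (act ?F a v)) (?supp v)"
      using v T a by (intro h F.act_closed) (auto simp: free_umod_simps(5))
    also have "\<dots> = finprod (additive L) (\<lambda>s. act L a (t v s)) (?supp v)"
    proof (rule L.M.ad.finprod_cong')
      fix s assume "s \<in> ?supp v"
      then have "\<delta> s \<in> carrier L" using T assms(2) by auto
      then show "t (act ?F a v) s = act L a (t v s)"
        using v a by (simp add: t_def free_umod_simps(1,5) L.act_scale_left L.act_scale_right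
            L.act_add_left L.act_add_right L.act_act L.act_closed)
    qed (use v a t T L.act_closed in auto)
    also have "\<dots> = act L a (h v)"
      unfolding h_def using v t T a
      by (intro additive_map_finprod[OF L.M.vect_axioms L.M.vect_axioms, symmetric])
         (auto simp: L.act_add_right L.act_closed)
    finally show ?thesis .
  qed
  have gen: "h (free_gen A s) = \<delta> s" if "s \<in> S" for s
  proof -
    have "h (free_gen A s) = finprod (additive L) (t (free_gen A s)) {s}"
      using that by (intro h free_gen_closed) (auto simp: free_gen_def, unfold_locales)
    then show ?thesis
      using assms(2)[OF that] act0 by (simp add: t_def free_gen_def)
  qed
  have "restrict h (carrier ?F) \<in> umod_hom A ?F L"
    by (auto simp: umod_hom_def hc add scale act F.act_closed)
  then show ?thesis
    by (rule rev_bexI) (simp add: gen free_gen_closed[OF L.comm_nalg_axioms])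
qed


section \<open>Strongly abelian differentials\<close>

locale generated_quotient = umodule +
  fixes R
  assumes relations_closed: "R \<subseteq> carrier M"
begin

abbreviation "gen_sub \<equiv> submodule_generated A M R"

abbreviation "gen_class \<equiv> residue_class M gen_sub"

lemmas gen_sub_is_submodule = submodule_generated_is_submodule[OF relations_closed]
lemmas gen_simps = quotient_umod_simps[OF gen_sub_is_submodule]
lemmas gen_umodule = umodule_quotient[OF gen_sub_is_submodule]

lemma gen_class_eqI:
  assumes "vminus M x y \<in> R" "x \<in> carrier M" "y \<in> carrier M"
  shows "gen_class x = gen_class y"
  using assms by (subst residue_class_eq_iff[OF gen_sub_is_submodule]) (auto simp: submodule_generated_def)

text \<open>The kernel of f is a submodule containing \<open>R\<close>, hence it contains the
  submodule that \<open>R\<close> generates.\<close>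

lemma gen_factor:
  assumes L: "umodule A L" and f: "f \<in> umod_hom A M L" and R: "\<And>x. x \<in> R \<Longrightarrow> f x = \<zero>\<^bsub>L\<^esub>"
  shows "\<exists>h \<in> umod_hom A (quotient_umod M gen_sub) L. \<forall>x\<in>carrier M. h (gen_class x) = f x"
proof (rule quotient_umod_factor[OF gen_sub_is_submodule L f])
  have "gen_sub \<subseteq> {x \<in> carrier M. f x = \<zero>\<^bsub>L\<^esub>}"
    using relations_closed R
    by (intro submodule_generated_minimal umod_hom_kernel[OF umodule_axioms L f]) auto
  then show "f x = \<zero>\<^bsub>L\<^esub>" if "x \<in> gen_sub" for x
    using that by auto
qed

end

text \<open>The derivations represented by \<open>Omega1\<close>. For the module
  \<open>as_module D g\<close> they become the derivations \<open>dp_der A D g\<close> along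
  g.\<close>

definition umod_der :: "('f::field, 'r) dpa \<Rightarrow> ('f, 'r, 'a) umod \<Rightarrow> ('r \<Rightarrow> 'a) \<Rightarrow> bool" where
  "umod_der A M \<delta> \<longleftrightarrow>
     (\<forall>x\<in>carrier A. \<delta> x \<in> carrier M) \<and>
     (\<forall>x\<in>carrier A. \<forall>y\<in>carrier A. \<delta> (x \<oplus>\<^bsub>A\<^esub> y) = \<delta> x \<oplus>\<^bsub>M\<^esub> \<delta> y) \<and>
     (\<forall>k. \<forall>x\<in>carrier A. \<delta> (k \<cdot>\<^bsub>A\<^esub> x) = k \<cdot>\<^bsub>M\<^esub> \<delta> x) \<and>
     (\<forall>x\<in>carrier A. \<forall>y\<in>carrier A. \<delta> (x \<star>\<^bsub>A\<^esub> y) = act M x (\<delta> y) \<oplus>\<^bsub>M\<^esub> act M y (\<delta> x)) \<and>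
     (\<forall>n\<ge>2. \<forall>x\<in>carrier A. \<delta> (dpow A n x) = act M (dpow A (n - 1) x) (\<delta> x))"

lemma as_module_simps [simp]:
  "carrier (as_module B f) = carrier B" "\<zero>\<^bsub>as_module B f\<^esub> = \<zero>\<^bsub>B\<^esub>"
  "x \<oplus>\<^bsub>as_module B f\<^esub> y = x \<oplus>\<^bsub>B\<^esub> y" "k \<cdot>\<^bsub>as_module B f\<^esub> x = k \<cdot>\<^bsub>B\<^esub> x"
  "act (as_module B f) a x = f a \<star>\<^bsub>B\<^esub> x"
  by (simp_all add: as_module_def)

lemma umodule_as_module:
  assumes "dp_algebra A" "dp_algebra B" "f \<in> dp_hom A B"
  shows "umodule A (as_module B f)"
proof -
  interpret A: dp_algebra A by fact
  interpret B: dp_algebra B by fact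
  have v: "vect (as_module B f)"
    by (rule vectI) (auto simp: B.add_ac B.scale_scale B.scale_add_left B.scale_add_right)
  show ?thesis
    by (rule umoduleI[OF A.comm_nalg_axioms v])
       (auto simp: dp_hom_closed[OF assms(3)] dp_hom_add[OF assms(3)] dp_hom_scale[OF assms(3)]
         dp_hom_mult[OF assms(3)] B.mult_assoc B.mult_add B.add_mult B.scale_mult B.mult_scale)
qed

lemma umod_der_as_module_iff:
  assumes "dp_algebra A" "g \<in> dp_hom A D"
  shows "umod_der A (as_module D g) \<delta> \<longleftrightarrow> dp_der A D g \<delta>"
  by (auto simp: umod_der_def dp_der_def dp_hom_dpow[OF assms(2)])

context dp_algebra
begin

abbreviation "free_d \<equiv> free_umod A (carrier A)"

lemma kaehler_quotient: "generated_quotient A free_d (kaehler_relations A)"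
proof -
  interpret F: umodule A free_d by (rule umodule_free) unfold_locales
  have gen: "free_gen A x \<in> carrier free_d" if "x \<in> carrier A" for x
    using that by (rule free_gen_closed[OF comm_nalg_axioms])
  show ?thesis
    by unfold_locales (auto simp: kaehler_relations_def Let_def F.M.minus_closed gen F.act_closed)
qed

sublocale kaehler: generated_quotient A free_d "kaehler_relations A"
  by (rule kaehler_quotient)

lemma kaehler_umodule: "umodule A (kaehler A)"
  unfolding kaehler_def by (rule kaehler.gen_umodule)

lemma free_gen_closed': "x \<in> carrier A \<Longrightarrow> free_gen A x \<in> carrier free_d"
  by (rule free_gen_closed) unfold_locales

lemma kaehler_d_closed: "x \<in> carrier A \<Longrightarrow> kaehler_d A x \<in> carrier (kaehler A)"
  unfolding kaehler_def kaehler_d_def by (auto simp: kaehler.gen_simps free_gen_closed')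

lemma kaehler_d_lin:
  assumes "x \<in> carrier A" "y \<in> carrier A"
  shows "kaehler_d A (x \<oplus> k \<cdot> y) = kaehler_d A x \<oplus>\<^bsub>kaehler A\<^esub> k \<cdot>\<^bsub>kaehler A\<^esub> kaehler_d A y"
proof -
  have "kaehler.gen_class (free_gen A (x \<oplus> k \<cdot> y)) = kaehler.gen_class (free_gen A x \<oplus>\<^bsub>free_d\<^esub> k \<cdot>\<^bsub>free_d\<^esub> free_gen A y)"
    using assms by (intro kaehler.gen_class_eqI kaehler.M.add_closed kaehler.M.scale_closed free_gen_closed')
       (auto simp: kaehler_relations_def Let_def)
  then show ?thesis
    using assms by (simp add: kaehler_def kaehler_d_def kaehler.gen_simps free_gen_closed' kaehler.M.scale_closed)
qed

lemma kaehler_d_mult: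
  assumes "x \<in> carrier A" "y \<in> carrier A"
  shows "kaehler_d A (x \<star> y)
    = act (kaehler A) x (kaehler_d A y) \<oplus>\<^bsub>kaehler A\<^esub> act (kaehler A) y (kaehler_d A x)"
proof -
  have "kaehler.gen_class (free_gen A (x \<star> y))
      = kaehler.gen_class (act free_d x (free_gen A y) \<oplus>\<^bsub>free_d\<^esub> act free_d y (free_gen A x))"
    using assms by (intro kaehler.gen_class_eqI kaehler.M.add_closed kaehler.act_closed free_gen_closed')
       (auto simp: kaehler_relations_def Let_def)
  then show ?thesis
    using assms by (simp add: kaehler_def kaehler_d_def kaehler.gen_simps free_gen_closed' kaehler.act_closed)
qed

lemma Omega1_quotient: "generated_quotient A (kaehler A) (Omega1_relations A)"
proof -
  interpret F: umodule A "kaehler A" by (rule kaehler_umodule)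
  show ?thesis
    by unfold_locales (auto simp: Omega1_relations_def intro!: F.M.minus_closed kaehler_d_closed F.act_closed)
qed

sublocale Omega: generated_quotient A "kaehler A" "Omega1_relations A"
  by (rule Omega1_quotient)

lemma Omega1_umodule: "umodule A (Omega1 A)"
  unfolding Omega1_def by (rule Omega.gen_umodule)

lemma Omega1_d_closed: "x \<in> carrier A \<Longrightarrow> Omega1_d A x \<in> carrier (Omega1 A)"
  unfolding Omega1_def Omega1_d_def by (auto simp: Omega.gen_simps kaehler_d_closed)

lemma Omega1_d_lin:
  assumes "x \<in> carrier A" "y \<in> carrier A"
  shows "Omega1_d A (x \<oplus> k \<cdot> y) = Omega1_d A x \<oplus>\<^bsub>Omega1 A\<^esub> k \<cdot>\<^bsub>Omega1 A\<^esub> Omega1_d A y"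
  using assms by (simp add: Omega1_def Omega1_d_def kaehler_d_lin Omega.gen_simps kaehler_d_closed)

lemma Omega1_d_der: "umod_der A (Omega1 A) (Omega1_d A)"
proof -
  interpret W: umodule A "Omega1 A" by (rule Omega1_umodule)
  note cl = Omega1_d_closed
  \<comment> \<open>The defining relation treats x + k y at once: k = 1 gives additivity, from which
    d 0 = 0, and then x = 0 gives compatibility with scalars.\<close>
  have add: "Omega1_d A (x \<oplus> y) = Omega1_d A x \<oplus>\<^bsub>Omega1 A\<^esub> Omega1_d A y"
    if "x \<in> carrier A" "y \<in> carrier A" for x y
    using Omega1_d_lin[OF that, of 1] that cl by simp
  have zero: "Omega1_d A \<zero> = \<zero>\<^bsub>Omega1 A\<^esub>"
    using add[of \<zero> \<zero>] cl[of \<zero>] by (intro W.M.double_eq_self) simp_all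
  have scale: "Omega1_d A (k \<cdot> x) = k \<cdot>\<^bsub>Omega1 A\<^esub> Omega1_d A x" if "x \<in> carrier A" for x k
    using Omega1_d_lin[of \<zero> x k] that cl zero by simp
  have mult: "Omega1_d A (x \<star> y) = act (Omega1 A) x (Omega1_d A y) \<oplus>\<^bsub>Omega1 A\<^esub> act (Omega1 A) y (Omega1_d A x)"
    if "x \<in> carrier A" "y \<in> carrier A" for x y
    using that by (simp add: Omega1_def Omega1_d_def kaehler_d_mult Omega.gen_simps kaehler_d_closed Omega.act_closed)
  have dpow: "Omega1_d A (dpow A n x) = act (Omega1 A) (dpow A (n - 1) x) (Omega1_d A x)"
    if "n \<ge> 2" "x \<in> carrier A" for n x
  proof -
    have "Omega.gen_class (kaehler_d A (dpow A n x)) = Omega.gen_class (act (kaehler A) (dpow A (n - 1) x) (kaehler_d A x))"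
      using that by (intro Omega.gen_class_eqI Omega.act_closed kaehler_d_closed) (auto simp: Omega1_relations_def)
    then show ?thesis
      using that by (simp add: Omega1_def Omega1_d_def Omega.gen_simps kaehler_d_closed)
  qed
  show ?thesis
    by (simp add: umod_der_def cl add scale mult dpow)
qed

text \<open>The submodule where f and g agree is pulled back through both quotient maps to the free
  module. There it contains the generators, so it is everything, and the quotient maps are
  onto.\<close>

lemma Omega1_hom_eqI:
  assumes "umodule A L" "f \<in> umod_hom A (Omega1 A) L" "g \<in> umod_hom A (Omega1 A) L"
    and eq: "\<And>x. x \<in> carrier A \<Longrightarrow> f (Omega1_d A x) = g (Omega1_d A x)"
  shows "f = g"
proof -
  let ?E = "{x \<in> carrier (Omega1 A). f x = g x}"
  have E: "is_submodule A (Omega1 A) ?E"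
    by (rule umod_hom_equalizer[OF Omega1_umodule assms(1-3)])
  let ?r = "restrict kaehler.gen_class (carrier free_d)" and ?r' = "restrict Omega.gen_class (carrier (kaehler A))"
  have r: "?r \<in> umod_hom A free_d (kaehler A)"
    unfolding kaehler_def by (rule kaehler.residue_class_hom[OF kaehler.gen_sub_is_submodule])
  have r': "?r' \<in> umod_hom A (kaehler A) (Omega1 A)"
    unfolding Omega1_def by (rule Omega.residue_class_hom[OF Omega.gen_sub_is_submodule])
  have "is_submodule A free_d {v \<in> carrier free_d. ?r v \<in> {w \<in> carrier (kaehler A). ?r' w \<in> ?E}}"
    by (intro submodule_preimage[OF kaehler.umodule_axioms Omega.umodule_axioms r]
        submodule_preimage[OF Omega.umodule_axioms Omega1_umodule r'] E)
  then have "carrier free_d \<subseteq> {v \<in> carrier free_d. ?r v \<in> {w \<in> carrier (kaehler A). ?r' w \<in> ?E}}"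
    using kaehler_d_closed Omega1_d_closed eq
    by (intro free_umod_generated[OF comm_nalg_axioms])
       (auto simp: free_gen_closed' kaehler_d_def Omega1_d_def)
  then have free: "v \<in> carrier free_d \<Longrightarrow> f (Omega.gen_class (kaehler.gen_class v)) = g (Omega.gen_class (kaehler.gen_class v))" for v
    by auto
  show ?thesis
  proof (rule umod_hom_eqI[OF assms(2,3)])
    fix x assume "x \<in> carrier (Omega1 A)"
    then obtain w where w: "w \<in> carrier (kaehler A)" "x = Omega.gen_class w"
      unfolding Omega1_def by (auto simp: Omega.gen_simps)
    then obtain v where "v \<in> carrier free_d" "w = kaehler.gen_class v"
      unfolding kaehler_def by (auto simp: kaehler.gen_simps)
    then show "f x = g x" using w free by simp
  qed
qed

lemma Omega1_extend:
  assumes L: "umodule A L" and "umod_der A L \<delta>"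
  shows "\<exists>h \<in> umod_hom A (Omega1 A) L. \<forall>x\<in>carrier A. h (Omega1_d A x) = \<delta> x"
proof -
  interpret L: umodule A L by fact
  have \<delta>: "x \<in> carrier A \<Longrightarrow> \<delta> x \<in> carrier L"
    "x \<in> carrier A \<Longrightarrow> y \<in> carrier A \<Longrightarrow> \<delta> (x \<oplus> y) = \<delta> x \<oplus>\<^bsub>L\<^esub> \<delta> y"
    "x \<in> carrier A \<Longrightarrow> \<delta> (k \<cdot> x) = k \<cdot>\<^bsub>L\<^esub> \<delta> x"
    "x \<in> carrier A \<Longrightarrow> y \<in> carrier A \<Longrightarrow> \<delta> (x \<star> y) = act L x (\<delta> y) \<oplus>\<^bsub>L\<^esub> act L y (\<delta> x)"
    "n \<ge> 2 \<Longrightarrow> x \<in> carrier A \<Longrightarrow> \<delta> (dpow A n x) = act L (dpow A (n - 1) x) (\<delta> x)" for x y k n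
    using assms(2) by (auto simp: umod_der_def)
  obtain h where h: "h \<in> umod_hom A free_d L" "\<And>x. x \<in> carrier A \<Longrightarrow> h (free_gen A x) = \<delta> x"
    using free_umod_extend[OF L, of "carrier A" \<delta>] \<delta>(1) by blast
  note hD = umod_homD[OF h(1)]
  have "h v = \<zero>\<^bsub>L\<^esub>" if "v \<in> kaehler_relations A" for v
    using that
    by (auto simp: kaehler_relations_def Let_def umod_hom_minus[OF kaehler.M.vect_axioms L.M.vect_axioms h(1)]
        free_gen_closed' kaehler.act_closed L.M.minus_eq_zero_iff hD h(2) \<delta> L.act_closed)
  then obtain h' where h': "h' \<in> umod_hom A (kaehler A) L"
      "\<And>v. v \<in> carrier free_d \<Longrightarrow> h' (kaehler.gen_class v) = h v"
    using kaehler.gen_factor[OF L h(1)] unfolding kaehler_def by blast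
  have h'd: "h' (kaehler_d A x) = \<delta> x" if "x \<in> carrier A" for x
    using that by (simp add: kaehler_d_def h' free_gen_closed' h)
  note h'D = umod_homD[OF h'(1)]
  have "h' v = \<zero>\<^bsub>L\<^esub>" if "v \<in> Omega1_relations A" for v
    using that
    by (auto simp: Omega1_relations_def umod_hom_minus[OF Omega.M.vect_axioms L.M.vect_axioms h'(1)]
        kaehler_d_closed Omega.act_closed L.M.minus_eq_zero_iff h'D h'd \<delta>(1,5) L.act_closed)
  then obtain k where k: "k \<in> umod_hom A (Omega1 A) L"
      "\<And>v. v \<in> carrier (kaehler A) \<Longrightarrow> k (Omega.gen_class v) = h' v"
    using Omega.gen_factor[OF L h'(1)] unfolding Omega1_def by blast
  show ?thesis
    using k by (intro bexI[of _ k]) (simp_all add: Omega1_d_def kaehler_d_closed h'd)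
qed

lemma umod_hom_der:
  assumes L: "umodule A L" and h: "h \<in> umod_hom A (Omega1 A) L"
  shows "umod_der A L (\<lambda>x. h (Omega1_d A x))"
proof -
  interpret W: umodule A "Omega1 A" by (rule Omega1_umodule)
  show ?thesis
    using Omega1_d_der umod_homD[OF h] W.act_closed by (auto simp: umod_der_def)
qed

end

section \<open>The tangent algebra\<close>

context large_universe
begin

lemma free_dp_algebra_Omega1_exists:
  fixes A :: "('f, 'u) dpa"
  assumes A: "dp_algebra A"
  shows "\<exists>B i \<eta>. is_free_dp_algebra A (Omega1 A) B i \<eta>"
proof -
  interpret A: dp_algebra A by fact
  \<comment> \<open>The generator (0, a) stands for a and (1, a) for da. Valuations have to be
    total, so larger indices repeat da and symbols outside the carrier go to zero.\<close>
  define val where "val D g \<delta> = (\<lambda>(j :: nat, x). if x \<in> carrier A then if j = 0 then g x else \<delta> x else \<zero>\<^bsub>D\<^esub>)"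
    for D :: "('f, 'u) dpa" and g \<delta> :: "'u \<Rightarrow> 'u"
  define K where "K = {(D, val D g \<delta>) | D g \<delta>. dp_algebra D \<and> g \<in> dp_hom A D \<and> dp_der A D g \<delta>}"
  have K: "dp_algebra D \<and> range v \<subseteq> carrier D" if "(D, v) \<in> K" for D v
    using that by (auto simp: K_def val_def dp_hom_closed dp_derD(1) intro: vect.zero_closed[OF dp_algebra_vect])
  obtain c :: "nat \<times> 'u \<Rightarrow> 'u" where c: "inj c"
    using ex_inj_nat_pair by blast
  obtain F :: "('f, 'u) dpa" and \<iota> where F: "dp_algebra F" "range \<iota> \<subseteq> carrier F"
    and ext: "\<And>D v. (D, v) \<in> K \<Longrightarrow> \<exists>h \<in> dp_hom F D. \<forall>x. h (\<iota> x) = v x"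
    and monic: "\<And>x y. x \<in> carrier F \<Longrightarrow> y \<in> carrier F \<Longrightarrow>
       (\<And>D v h. (D, v) \<in> K \<Longrightarrow> h \<in> dp_hom F D \<Longrightarrow> (\<And>x. h (\<iota> x) = v x) \<Longrightarrow> h x = h y) \<Longrightarrow> x = y"
    and gen: "\<And>(B :: ('f, 'u) dpa) f h. dp_algebra B \<Longrightarrow> f \<in> dp_hom F B \<Longrightarrow> h \<in> dp_hom F B \<Longrightarrow>
       (\<And>x. f (\<iota> x) = h (\<iota> x)) \<Longrightarrow> f = h"
    using presented_dp_algebra[OF K c] by blast
  interpret F: dp_algebra F by fact
  have \<iota> [simp]: "\<iota> x \<in> carrier F" for x using F(2) by auto
  define i where "i = (\<lambda>a. \<iota> (0, a))"
  define d where "d = (\<lambda>a. \<iota> (1, a))"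
  have [simp]: "i x \<in> carrier F" "d x \<in> carrier F" for x by (simp_all add: i_def d_def)
  have monic': "x = y" if "x \<in> carrier F" "y \<in> carrier F"
    and "\<And>(D :: ('f, 'u) dpa) h g \<delta>. dp_algebra D \<Longrightarrow> g \<in> dp_hom A D \<Longrightarrow> dp_der A D g \<delta> \<Longrightarrow> h \<in> dp_hom F D \<Longrightarrow>
      (\<And>a. a \<in> carrier A \<Longrightarrow> h (i a) = g a) \<Longrightarrow> (\<And>a. a \<in> carrier A \<Longrightarrow> h (d a) = \<delta> a) \<Longrightarrow>
      (\<And>a j. a \<notin> carrier A \<Longrightarrow> h (\<iota> (j, a)) = \<zero>\<^bsub>D\<^esub>) \<Longrightarrow> h x = h y" for x y
  proof (rule monic[OF that(1,2)])
    fix D v h assume Dvh: "(D, v) \<in> K" "h \<in> dp_hom F D" "\<And>x. h (\<iota> x) = v x"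
    then obtain g \<delta> where g\<delta>: "v = val D g \<delta>" "dp_algebra D" "g \<in> dp_hom A D" "dp_der A D g \<delta>"
      by (auto simp: K_def)
    show "h x = h y"
      by (rule that(3)[of D g \<delta> h]) (simp_all add: g\<delta> Dvh val_def i_def d_def)
  qed
  note hr = dp_hom_closed dp_hom_add dp_hom_scale dp_hom_mult dp_hom_dpow dp_derD
  \<comment> \<open>No relation is imposed by hand: the laws making \<open>i\<close> a morphism and
    \<open>d\<close> a derivation hold in \<open>F\<close> because every valuation in
    \<open>K\<close> comes from such a pair.\<close>
  have i: "restrict i (carrier A) \<in> dp_hom A F"
    by (rule restrict_dp_homI[OF A]; (rule monic')?) (simp_all add: hr)
  have d: "dp_der A F (restrict i (carrier A)) d"
    unfolding dp_der_def
    by (intro conjI ballI allI impI; (rule monic')?) (simp_all add: hr)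
  have zero: "\<iota> (j, a) = \<zero>\<^bsub>F\<^esub>" if "a \<notin> carrier A" for j a
    by (rule monic') (simp_all add: that dp_hom_zero[OF F(1)])
  let ?i = "restrict i (carrier A)"
  have L: "umodule A (as_module F ?i)"
    by (rule umodule_as_module[OF A F(1) i])
  obtain \<eta> where \<eta>: "\<eta> \<in> umod_hom A (Omega1 A) (as_module F ?i)"
      "\<And>x. x \<in> carrier A \<Longrightarrow> \<eta> (Omega1_d A x) = d x"
    using A.Omega1_extend[OF L] d umod_der_as_module_iff[OF A i] by blast
  interpret W: umodule A "Omega1 A" by (rule A.Omega1_umodule)
  have "is_free_dp_algebra A (Omega1 A) F ?i \<eta>"
    unfolding is_free_dp_algebra_def
  proof (intro conjI allI impI F(1) i \<eta>(1))
    fix D :: "('f, 'u) dpa" and g \<theta>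
    assume "dp_algebra D \<and> g \<in> dp_hom A D \<and> \<theta> \<in> umod_hom A (Omega1 A) (as_module D g)"
    then have D: "dp_algebra D" and g: "g \<in> dp_hom A D" and \<theta>: "\<theta> \<in> umod_hom A (Omega1 A) (as_module D g)"
      by auto
    have LD: "umodule A (as_module D g)"
      by (rule umodule_as_module[OF A D g])
    let ?\<delta> = "\<lambda>x. \<theta> (Omega1_d A x)"
    have "dp_der A D g ?\<delta>"
      using A.umod_hom_der[OF LD \<theta>] umod_der_as_module_iff[OF A g] by blast
    then have "(D, val D g ?\<delta>) \<in> K"
      using D g by (auto simp: K_def)
    from ext[OF this] obtain h where h: "h \<in> dp_hom F D" "\<And>x. h (\<iota> x) = val D g ?\<delta> x"
      by blast
    \<comment> \<open>\<open>h\<close> is prescribed on the generators of \<open>F\<close> only.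
      Composed with \<eta> it is a module map, and module maps out of \<open>Omega1\<close> are
      determined by the differentials, where it agrees with \<theta>.\<close>
    have h\<eta>: "restrict (\<lambda>m. h (\<eta> m)) (carrier (Omega1 A)) \<in> umod_hom A (Omega1 A) (as_module D g)"
      using umod_homD[OF \<eta>(1)]
      by (auto simp: umod_hom_def dp_hom_closed[OF h(1)] dp_hom_add[OF h(1)] dp_hom_scale[OF h(1)] dp_hom_mult[OF h(1)]
          W.act_closed h(2) val_def i_def)
    have "restrict (\<lambda>m. h (\<eta> m)) (carrier (Omega1 A)) = \<theta>"
      by (rule A.Omega1_hom_eqI[OF LD h\<eta> \<theta>])
         (simp add: A.Omega1_d_closed \<eta>(2) d_def h(2) val_def)
    then have h\<theta>: "h (\<eta> m) = \<theta> m" if "m \<in> carrier (Omega1 A)" for m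
      using that by (metis restrict_apply')
    have hg: "h (?i a) = g a" if "a \<in> carrier A" for a
      using that by (simp add: i_def h(2) val_def)
    have uniq: "h' = h" if h': "h' \<in> dp_hom F D" "\<forall>a\<in>carrier A. h' (?i a) = g a"
      "\<forall>m\<in>carrier (Omega1 A). h' (\<eta> m) = \<theta> m" for h'
    proof (rule gen[OF D h'(1) h(1)])
      fix x :: "nat \<times> 'u"
      obtain j a where x: "x = (j, a)" by fastforce
      \<comment> \<open>All labels other than 0 give the same element, as no valuation distinguishes
        them.\<close>
      have "\<iota> (j, a) = d a" if "a \<in> carrier A" "j \<noteq> 0"
        unfolding d_def
      proof (rule monic)
        fix D v k assume "(D, v) \<in> K" and k: "\<And>x. k (\<iota> x) = v x"
        then obtain g \<delta> where "v = val D g \<delta>" by (auto simp: K_def)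
        then show "k (\<iota> (j, a)) = k (\<iota> (1, a))"
          using that by (simp add: k val_def)
      qed simp_all
      moreover have "h' (d a) = h (d a)" if "a \<in> carrier A"
        using that h'(3)[rule_format, OF A.Omega1_d_closed[OF that]] \<eta>(2)[OF that] by (simp add: d_def h(2) val_def)
      moreover have "h' (\<iota> (0, a)) = h (\<iota> (0, a))" if "a \<in> carrier A"
        using that h'(2) by (simp add: i_def h(2) val_def)
      moreover have "h' (\<iota> (j, a)) = h (\<iota> (j, a))" if "a \<notin> carrier A"
        using zero[OF that] dp_hom_zero[OF F(1) D h'(1)] dp_hom_zero[OF F(1) D h(1)] by simp
      ultimately show "h' (\<iota> x) = h (\<iota> x)"
        unfolding x by (cases "a \<in> carrier A"; cases "j = 0") simp_all
    qed
    show "\<exists>!h. h \<in> dp_hom F D \<and> (\<forall>a\<in>carrier A. h (?i a) = g a) \<and>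
        (\<forall>m\<in>carrier (Omega1 A). h (\<eta> m) = \<theta> m)"
      by (rule ex1I[of _ h]) (use h(1) hg h\<theta> in blast, use uniq in blast)
  qed
  then show ?thesis by blast
qed

lemma tan_free:
  fixes A :: "('f, 'u) dpa"
  assumes "dp_algebra A"
  shows "is_free_dp_algebra A (Omega1 A) (tan_ob A) (tan_in A) (tan_unit A)"
proof -
  let ?P = "\<lambda>(B, i, \<eta>). is_free_dp_algebra A (Omega1 A) B i \<eta>"
  obtain B i \<eta> where "?P (B, i, \<eta>)"
    using free_dp_algebra_Omega1_exists[OF assms] by auto
  then have "?P (Gamma_plus A (Omega1 A))"
    unfolding Gamma_plus_def by (rule someI[where P = ?P])
  then show ?thesis
    by (simp add: tan_ob_def tan_in_def tan_unit_def case_prod_beta)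
qed

context
  fixes A :: "('f, 'u) dpa"
  assumes A: "dp_algebra A"
begin

lemma tan_ob_dp_algebra [simp]: "dp_algebra (tan_ob A)"
  using tan_free[OF A] by (simp add: is_free_dp_algebra_def)

lemma tan_in_hom: "tan_in A \<in> dp_hom A (tan_ob A)"
  using tan_free[OF A] by (simp add: is_free_dp_algebra_def)

lemma tan_d_der: "dp_der A (tan_ob A) (tan_in A) (tan_d A)"
proof -
  interpret A: dp_algebra A by (rule A)
  have "tan_unit A \<in> umod_hom A (Omega1 A) (as_module (tan_ob A) (tan_in A))"
    using tan_free[OF A] by (simp add: is_free_dp_algebra_def)
  from A.umod_hom_der[OF umodule_as_module[OF A tan_ob_dp_algebra tan_in_hom] this]
  show ?thesis
    unfolding umod_der_as_module_iff[OF A tan_in_hom] tan_d_def[abs_def] .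
qed

text \<open>A module map out of \<open>Omega1\<close> and a derivation are the same datum, both
  being given by the values on differentials; this removes the module from the universal
  property.\<close>

lemma tan_universal:
  fixes D :: "('f, 'u) dpa"
  assumes D: "dp_algebra D" and g: "g \<in> dp_hom A D" and \<delta>: "dp_der A D g \<delta>"
  shows "\<exists>!h. h \<in> dp_hom (tan_ob A) D \<and> (\<forall>a\<in>carrier A. h (tan_in A a) = g a \<and> h (tan_d A a) = \<delta> a)"
proof -
  interpret A: dp_algebra A by (rule A)
  note L = umodule_as_module[OF A D g]
  interpret W: umodule A "Omega1 A" by (rule A.Omega1_umodule)
  obtain \<theta> where \<theta>: "\<theta> \<in> umod_hom A (Omega1 A) (as_module D g)" "\<And>x. x \<in> carrier A \<Longrightarrow> \<theta> (Omega1_d A x) = \<delta> x"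
    using A.Omega1_extend[OF L] \<delta> umod_der_as_module_iff[OF A g] by blast
  have unit: "tan_unit A \<in> umod_hom A (Omega1 A) (as_module (tan_ob A) (tan_in A))"
    using tan_free[OF A] by (simp add: is_free_dp_algebra_def)
  have iff: "(\<forall>m\<in>carrier (Omega1 A). h (tan_unit A m) = \<theta> m) \<longleftrightarrow> (\<forall>a\<in>carrier A. h (tan_d A a) = \<delta> a)"
    if h: "h \<in> dp_hom (tan_ob A) D" "\<forall>a\<in>carrier A. h (tan_in A a) = g a" for h
  proof
    assume "\<forall>m\<in>carrier (Omega1 A). h (tan_unit A m) = \<theta> m"
    then show "\<forall>a\<in>carrier A. h (tan_d A a) = \<delta> a"
      using A.Omega1_d_closed \<theta>(2) by (simp add: tan_d_def)
  next
    assume d: "\<forall>a\<in>carrier A. h (tan_d A a) = \<delta> a"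
    have hm: "restrict (\<lambda>m. h (tan_unit A m)) (carrier (Omega1 A)) \<in> umod_hom A (Omega1 A) (as_module D g)"
      using umod_homD[OF unit] h(2) dp_hom_closed[OF tan_in_hom]
      by (auto simp: umod_hom_def dp_hom_closed[OF h(1)] dp_hom_add[OF h(1)] dp_hom_scale[OF h(1)]
          dp_hom_mult[OF h(1)] W.act_closed)
    have "restrict (\<lambda>m. h (tan_unit A m)) (carrier (Omega1 A)) = \<theta>"
      by (rule A.Omega1_hom_eqI[OF L hm \<theta>(1)]) (use d \<theta>(2) in \<open>simp add: A.Omega1_d_closed tan_d_def\<close>)
    then show "\<forall>m\<in>carrier (Omega1 A). h (tan_unit A m) = \<theta> m"
      by (metis restrict_apply')
  qed
  have "\<exists>!h. h \<in> dp_hom (tan_ob A) D \<and> (\<forall>a\<in>carrier A. h (tan_in A a) = g a) \<and>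
      (\<forall>m\<in>carrier (Omega1 A). h (tan_unit A m) = \<theta> m)"
    using tan_free[OF A] D g \<theta>(1) by (simp add: is_free_dp_algebra_def)
  moreover have "(h \<in> dp_hom (tan_ob A) D \<and> (\<forall>a\<in>carrier A. h (tan_in A a) = g a) \<and>
      (\<forall>m\<in>carrier (Omega1 A). h (tan_unit A m) = \<theta> m)) \<longleftrightarrow>
    (h \<in> dp_hom (tan_ob A) D \<and> (\<forall>a\<in>carrier A. h (tan_in A a) = g a \<and> h (tan_d A a) = \<delta> a))" for h
    using iff[of h] by blast
  ultimately show ?thesis by simp
qed

lemma tan_in_closed [simp]: "a \<in> carrier A \<Longrightarrow> tan_in A a \<in> carrier (tan_ob A)"
  by (rule dp_hom_closed[OF tan_in_hom])

lemma tan_d_closed [simp]: "a \<in> carrier A \<Longrightarrow> tan_d A a \<in> carrier (tan_ob A)"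
  by (rule dp_derD(1)[OF tan_d_der])

text \<open>The target may have any carrier type, which the universal property does not cover. But
  the subalgebra where f and g agree lies in the universe and contains all generators; the map into
  it extending them is, as an endomorphism of \<open>tan_ob A\<close>, the identity by uniqueness,
  so the subalgebra is everything.\<close>

lemma tan_hom_eqI:
  fixes D :: "('f, 'v) dpa"
  assumes "dp_algebra D" "f \<in> dp_hom (tan_ob A) D" "g \<in> dp_hom (tan_ob A) D"
    and "\<And>a. a \<in> carrier A \<Longrightarrow> f (tan_in A a) = g (tan_in A a)"
    and "\<And>a. a \<in> carrier A \<Longrightarrow> f (tan_d A a) = g (tan_d A a)"
  shows "f = g"
proof -
  define S where "S = {x \<in> carrier (tan_ob A). f x = g x}"
  let ?B = "(tan_ob A)\<lparr>carrier := S\<rparr>"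
  have B: "dp_algebra ?B"
    using dp_equalizer[OF tan_ob_dp_algebra assms(1-3)] unfolding S_def .
  have "tan_in A \<in> dp_hom A ?B" "dp_der A ?B (tan_in A) (tan_d A)"
    using tan_in_hom tan_d_der assms(4,5) by (auto simp: dp_hom_def dp_der_def S_def)
  from tan_universal[OF B this] obtain h where h: "h \<in> dp_hom (tan_ob A) ?B"
      "\<And>a. a \<in> carrier A \<Longrightarrow> h (tan_in A a) = tan_in A a \<and> h (tan_d A a) = tan_d A a"
    by blast
  have hS: "h x \<in> S" if "x \<in> carrier (tan_ob A)" for x
    using dp_hom_closed[OF h(1) that] by simp
  have h': "h \<in> dp_hom (tan_ob A) (tan_ob A)"
    using h(1) by (auto simp: dp_hom_def S_def)
  have "h = (\<lambda>x\<in>carrier (tan_ob A). x)"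
    using tan_universal[OF tan_ob_dp_algebra tan_in_hom tan_d_der] h h' id_dp_hom[OF tan_ob_dp_algebra]
    by (metis (no_types, lifting) restrict_apply' tan_in_closed tan_d_closed)
  then have "x \<in> S" if "x \<in> carrier (tan_ob A)" for x
    using hS[OF that] that by simp
  then show ?thesis
    by (intro dp_hom_eqI[OF assms(2,3)]) (auto simp: S_def)
qed

text \<open>The universal property is applied to a copy of D on the universe type, and the result is
  carried back. Existence is enough here, uniqueness being \<open>tan_hom_eqI\<close>.\<close>

lemma tan_extend:
  fixes D :: "('f, 'v) dpa" and c :: "'v \<Rightarrow> 'u"
  assumes D: "dp_algebra D" "inj c" and g: "g \<in> dp_hom A D" and \<delta>: "dp_der A D g \<delta>"
  shows "\<exists>h \<in> dp_hom (tan_ob A) D. \<forall>a\<in>carrier A. h (tan_in A a) = g a \<and> h (tan_d A a) = \<delta> a"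
proof -
  obtain E :: "('f, 'u) dpa" and \<phi> \<psi> where E: "dp_algebra E" "\<phi> \<in> dp_hom D E" "\<psi> \<in> dp_hom E D"
    "\<And>x. x \<in> carrier D \<Longrightarrow> \<psi> (\<phi> x) = x"
    using dp_algebra_transport[OF D] by metis
  have "dp_der A E (compose (carrier A) \<phi> g) (\<lambda>x. \<phi> (\<delta> x)) = dp_der A E (\<lambda>x. \<phi> (g x)) (\<lambda>x. \<phi> (\<delta> x))"
    by (rule dp_der_cong[OF A]) (auto simp: compose_def)
  then have "dp_der A E (compose (carrier A) \<phi> g) (\<lambda>x. \<phi> (\<delta> x))"
    using dp_der_compose[OF \<delta> E(2) D(1)] dp_hom_closed[OF g] by blast
  from tan_universal[OF E(1) compose_dp_hom[OF A g E(2)] this]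
  obtain h where h: "h \<in> dp_hom (tan_ob A) E"
    "\<And>a. a \<in> carrier A \<Longrightarrow> h (tan_in A a) = compose (carrier A) \<phi> g a \<and> h (tan_d A a) = \<phi> (\<delta> a)"
    by blast
  show ?thesis
    using h E(4) dp_hom_closed[OF g] dp_derD(1)[OF \<delta>]
    by (intro bexI[OF _ compose_dp_hom[OF tan_ob_dp_algebra h(1) E(3)]]) (auto simp: compose_def)
qed

lemma tan_extend_dual:
  fixes D :: "('f, 'v) dpa" and c :: "'v \<Rightarrow> 'u"
  assumes D: "dp_algebra D" "inj c" and k: "k \<in> dp_hom A (dual D)"
  shows "\<exists>h \<in> dp_hom (tan_ob A) D. \<forall>a\<in>carrier A. h (tan_in A a) = fst (k a) \<and> h (tan_d A a) = snd (k a)"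
proof -
  have "dp_der A D (\<lambda>x\<in>carrier A. fst (k x)) (\<lambda>x. snd (k x))"
    using snd_dual_dp_der[OF A k] dp_der_cong[OF A, of "\<lambda>x\<in>carrier A. fst (k x)" "\<lambda>x. fst (k x)"] by simp
  from tan_extend[OF D fst_dual_dp_hom[OF A k] this] show ?thesis by simp
qed

text \<open>Transposition under the adjunction with dual numbers; \<open>tan_extend_dual\<close>
  goes the other way.\<close>

lemma tan_pair_hom:
  assumes D: "dp_algebra D" and f: "f \<in> dp_hom (tan_ob A) D"
  shows "(\<lambda>x\<in>carrier A. (f (tan_in A x), f (tan_d A x))) \<in> dp_hom A (dual D)"
proof -
  let ?g = "\<lambda>x\<in>carrier A. f (tan_in A x)"
  have g: "?g \<in> dp_hom A D"
    using compose_dp_hom[OF A tan_in_hom f] by (simp add: compose_def)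
  have "dp_der A D (\<lambda>x. f (tan_in A x)) (\<lambda>x. f (tan_d A x))"
    by (rule dp_der_compose[OF tan_d_der f tan_ob_dp_algebra]) simp
  then have "dp_der A D ?g (\<lambda>x. f (tan_d A x))"
    using dp_der_cong[OF A, of ?g "\<lambda>x. f (tan_in A x)"] by simp
  then have "(\<lambda>x\<in>carrier A. (?g x, f (tan_d A x))) \<in> dp_hom A (dual D)"
    by (simp only: dp_der_iff_dual[OF A g])
  also have "(\<lambda>x\<in>carrier A. (?g x, f (tan_d A x))) = (\<lambda>x\<in>carrier A. (f (tan_in A x), f (tan_d A x)))"
    by auto
  finally show ?thesis .
qed

end

text \<open>Transposing the outer application gives two maps from \<open>tan_ob A\<close> to dual
  numbers. Their agreement on a and da is agreement on all four kinds of generators, and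
  \<open>tan_hom_eqI\<close> applies because it admits targets on pairs.\<close>

lemma tan_tan_hom_eqI:
  fixes A :: "('f, 'u) dpa" and D :: "('f, 'v) dpa"
  assumes A: "dp_algebra A" and D: "dp_algebra D"
    and f: "f \<in> dp_hom (tan_ob (tan_ob A)) D" and g: "g \<in> dp_hom (tan_ob (tan_ob A)) D"
    and "\<And>a. a \<in> carrier A \<Longrightarrow> f (tan_in (tan_ob A) (tan_in A a)) = g (tan_in (tan_ob A) (tan_in A a))"
    and "\<And>a. a \<in> carrier A \<Longrightarrow> f (tan_in (tan_ob A) (tan_d A a)) = g (tan_in (tan_ob A) (tan_d A a))"
    and "\<And>a. a \<in> carrier A \<Longrightarrow> f (tan_d (tan_ob A) (tan_in A a)) = g (tan_d (tan_ob A) (tan_in A a))"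
    and "\<And>a. a \<in> carrier A \<Longrightarrow> f (tan_d (tan_ob A) (tan_d A a)) = g (tan_d (tan_ob A) (tan_d A a))"
  shows "f = g"
proof -
  let ?T = "tan_ob A"
  note T = tan_ob_dp_algebra[OF A]
  have "(\<lambda>x\<in>carrier ?T. (f (tan_in ?T x), f (tan_d ?T x))) = (\<lambda>x\<in>carrier ?T. (g (tan_in ?T x), g (tan_d ?T x)))"
    by (rule tan_hom_eqI[OF A dp_algebra_dual[OF D] tan_pair_hom[OF T D f] tan_pair_hom[OF T D g]])
       (simp_all add: A assms(5-8))
  then have "f (tan_in ?T x) = g (tan_in ?T x)" "f (tan_d ?T x) = g (tan_d ?T x)" if "x \<in> carrier ?T" for x
    using that by (auto dest!: fun_cong[of _ _ x])
  then show ?thesis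
    by (intro tan_hom_eqI[OF T D f g])
qed

lemma tan3_hom_eqI:
  fixes A :: "('f, 'u) dpa" and D :: "('f, 'v) dpa"
  assumes A: "dp_algebra A" and D: "dp_algebra D"
    and f: "f \<in> dp_hom (tan_ob (tan_ob (tan_ob A))) D" and g: "g \<in> dp_hom (tan_ob (tan_ob (tan_ob A))) D"
    and eq: "\<And>a d1 d2 d3. a \<in> carrier A \<Longrightarrow> d1 \<in> {tan_in A, tan_d A} \<Longrightarrow>
      d2 \<in> {tan_in (tan_ob A), tan_d (tan_ob A)} \<Longrightarrow>
      d3 \<in> {tan_in (tan_ob (tan_ob A)), tan_d (tan_ob (tan_ob A))} \<Longrightarrow> f (d3 (d2 (d1 a))) = g (d3 (d2 (d1 a)))"
  shows "f = g"
proof -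
  let ?T = "tan_ob (tan_ob A)"
  note T' = tan_ob_dp_algebra[OF A]
  note T = tan_ob_dp_algebra[OF T']
  have "(\<lambda>x\<in>carrier ?T. (f (tan_in ?T x), f (tan_d ?T x))) = (\<lambda>x\<in>carrier ?T. (g (tan_in ?T x), g (tan_d ?T x)))"
    by (rule tan_tan_hom_eqI[OF A dp_algebra_dual[OF D] tan_pair_hom[OF T D f] tan_pair_hom[OF T D g]])
       (simp_all add: A T' eq)
  then have "f (tan_in ?T x) = g (tan_in ?T x)" "f (tan_d ?T x) = g (tan_d ?T x)" if "x \<in> carrier ?T" for x
    using that by (auto dest!: fun_cong[of _ _ x])
  then show ?thesis
    by (intro tan_hom_eqI[OF T D f g])
qed

text \<open>Two transpositions in a row: k prescribes the values ((a, d'a), (da, d'da)), the outer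
  pair belonging to d and the inner pairs to d'.\<close>

lemma tan_tan_extend:
  fixes A D :: "('f, 'u) dpa"
  assumes A: "dp_algebra A" and D: "dp_algebra D" and k: "k \<in> dp_hom A (dual (dual D))"
  shows "\<exists>h \<in> dp_hom (tan_ob (tan_ob A)) D. \<forall>a\<in>carrier A.
    h (tan_in (tan_ob A) (tan_in A a)) = fst (fst (k a)) \<and> h (tan_in (tan_ob A) (tan_d A a)) = fst (snd (k a)) \<and>
    h (tan_d (tan_ob A) (tan_in A a)) = snd (fst (k a)) \<and> h (tan_d (tan_ob A) (tan_d A a)) = snd (snd (k a))"
proof -
  obtain c :: "'u \<times> 'u \<Rightarrow> 'u" where c: "inj c" using ex_inj_pair by blast
  obtain k' where k': "k' \<in> dp_hom (tan_ob A) (dual D)"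
      "\<forall>a\<in>carrier A. k' (tan_in A a) = fst (k a) \<and> k' (tan_d A a) = snd (k a)"
    using tan_extend_dual[OF A dp_algebra_dual[OF D] c k] by blast
  obtain h where "h \<in> dp_hom (tan_ob (tan_ob A)) D"
      "\<forall>x\<in>carrier (tan_ob A). h (tan_in (tan_ob A) x) = fst (k' x) \<and> h (tan_d (tan_ob A) x) = snd (k' x)"
    using tan_extend_dual[OF tan_ob_dp_algebra[OF A] D inj_on_id k'(1)] by blast
  then show ?thesis
    using k'(2) by (intro bexI[of _ h]) (simp_all add: A)
qed

end

section \<open>The category of divided power algebras\<close>

lemma opposite_simps [simp]:
  "ob (opposite C) = ob C" "ar (opposite C) = ar C" "src (opposite C) = trg C" "trg (opposite C) = src C"
  "idn (opposite C) = idn C" "cmp (opposite C) g f = cmp C f g" "hom_set (opposite C) A B = hom_set C B A"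
  by (auto simp: opposite_def hom_set_def)

lemma category_opposite:
  assumes "category C"
  shows "category (opposite C)"
proof -
  interpret category C by fact
  show ?thesis
    by (rule category.intro)
       (auto simp: src_ob trg_ob id_hom comp_id_left comp_id_right comp_assoc[symmetric] intro: comp_hom)
qed

lemma is_fibre_power_opposite:
  assumes "p \<in> ar C" "is_coproduct_under C (src C p) n (\<lambda>j. p) P b q"
  shows "is_fibre_power (opposite C) p n P b q"
  using assms by (simp add: is_fibre_power_def is_coproduct_under_def)

abbreviation cod :: "('f, 'u) dp_arrow \<Rightarrow> ('f, 'u) dpa" where
  "cod f \<equiv> snd (snd f)"

lemma Gamma_alg_simps [simp]:
  "ob Gamma_alg = {A. dp_algebra A}" "src Gamma_alg f = fst f" "trg Gamma_alg f = cod f"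
  "hom_set Gamma_alg A B = {f \<in> ar Gamma_alg. fst f = A \<and> cod f = B}"
  "idn Gamma_alg A = (A, \<lambda>x\<in>carrier A. x, A)"
  by (simp_all add: Gamma_alg_def hom_set_def)

lemma in_ar_iff: "f \<in> ar Gamma_alg \<longleftrightarrow> dp_algebra (fst f) \<and> dp_algebra (cod f) \<and> fn f \<in> dp_hom (fst f) (cod f)"
  by (auto simp: Gamma_alg_def)

lemma arD:
  assumes "f \<in> ar Gamma_alg"
  shows "dp_algebra (fst f)" "dp_algebra (cod f)" "fn f \<in> dp_hom (fst f) (cod f)"
  using assms by (auto simp: in_ar_iff)

lemma cmp_simps [simp]:
  "fst (cmp Gamma_alg g f) = fst f" "cod (cmp Gamma_alg g f) = cod g"
  "x \<in> carrier (fst f) \<Longrightarrow> fn (cmp Gamma_alg g f) x = fn g (fn f x)"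
  by (simp_all add: Gamma_alg_def compose_def)

lemma cmp_ar [simp]:
  "f \<in> ar Gamma_alg \<Longrightarrow> g \<in> ar Gamma_alg \<Longrightarrow> cod f = fst g \<Longrightarrow> cmp Gamma_alg g f \<in> ar Gamma_alg"
  using compose_dp_hom[of "fst f" "fn f" "cod f" "fn g" "cod g"]
  by (auto simp: in_ar_iff Gamma_alg_def)

lemma idn_ar [simp]: "dp_algebra A \<Longrightarrow> (A, \<lambda>x\<in>carrier A. x, A) \<in> ar Gamma_alg"
  by (simp add: in_ar_iff id_dp_hom)

lemma arrow_eqI:
  assumes "f \<in> ar Gamma_alg" "g \<in> ar Gamma_alg" "fst f = fst g" "cod f = cod g"
    and "\<And>x. x \<in> carrier (fst f) \<Longrightarrow> fn f x = fn g x"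
  shows "f = g"
  using assms dp_hom_eqI[of "fn f" "fst f" "cod f" "fn g"]
  by (simp add: in_ar_iff prod_eq_iff)

lemma arrow_closed [simp]:
  "f \<in> ar Gamma_alg \<Longrightarrow> cod f = B \<Longrightarrow> x \<in> carrier (fst f) \<Longrightarrow> fn f x \<in> carrier B"
  by (auto simp: in_ar_iff intro: dp_hom_closed)

lemma arrow_add [simp]:
  "f \<in> ar Gamma_alg \<Longrightarrow> fst f = A \<Longrightarrow> x \<in> carrier A \<Longrightarrow> y \<in> carrier A \<Longrightarrow>
    fn f (x \<oplus>\<^bsub>A\<^esub> y) = fn f x \<oplus>\<^bsub>cod f\<^esub> fn f y"
  by (auto simp: in_ar_iff dp_hom_add)

lemma arrow_zero [simp]:
  "f \<in> ar Gamma_alg \<Longrightarrow> fst f = A \<Longrightarrow> fn f \<zero>\<^bsub>A\<^esub> = \<zero>\<^bsub>cod f\<^esub>"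
  by (auto simp: in_ar_iff dp_hom_zero)

lemma arrow_neg [simp]:
  assumes "f \<in> ar Gamma_alg" "fst f = A" "x \<in> carrier A"
  shows "fn f (vneg A x) = vneg (cod f) (fn f x)"
proof -
  have A: "vect A" and B: "vect (cod f)"
    using assms by (auto simp: in_ar_iff intro: dp_algebra_vect)
  show ?thesis
    using assms by (simp add: vect.neg_eq_scale[OF A] vect.neg_eq_scale[OF B] in_ar_iff dp_hom_scale)
qed

lemma category_Gamma_alg: "category (Gamma_alg :: (('f::field, 'u) dpa, ('f, 'u) dp_arrow) cat)"
  by (rule category.intro; (simp add: arD; fail)?; (rule arrow_eqI; simp add: arD)?)

lemma is_coproduct_underD:
  assumes "is_coproduct_under Gamma_alg A n X P b \<iota>"
  shows "dp_algebra A" "b \<in> ar Gamma_alg" "fst b = A" "cod b = P"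
    "j \<in> {1..n} \<Longrightarrow> X j \<in> ar Gamma_alg" "j \<in> {1..n} \<Longrightarrow> fst (X j) = A"
    "j \<in> {1..n} \<Longrightarrow> \<iota> j \<in> ar Gamma_alg" "j \<in> {1..n} \<Longrightarrow> fst (\<iota> j) = cod (X j)"
    "j \<in> {1..n} \<Longrightarrow> cod (\<iota> j) = P"
    "j \<in> {1..n} \<Longrightarrow> a \<in> carrier A \<Longrightarrow> fn (\<iota> j) (fn (X j) a) = fn b a"
  using assms cmp_simps(3)[of a "X j" "\<iota> j"] by (auto simp: is_coproduct_under_def)

lemma coproduct_under_universal:
  assumes "is_coproduct_under Gamma_alg A n X P b \<iota>"
    and "r \<in> ar Gamma_alg" "fst r = A" "cod r = Y"
    and "\<And>j. j \<in> {1..n} \<Longrightarrow> u j \<in> ar Gamma_alg \<and> fst (u j) = cod (X j) \<and> cod (u j) = Y"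
    and "\<And>j a. j \<in> {1..n} \<Longrightarrow> a \<in> carrier A \<Longrightarrow> fn (u j) (fn (X j) a) = fn r a"
  shows "\<exists>!h. (h \<in> ar Gamma_alg \<and> fst h = P \<and> cod h = Y) \<and> cmp Gamma_alg h b = r \<and>
      (\<forall>j\<in>{1..n}. cmp Gamma_alg h (\<iota> j) = u j)"
proof -
  have "cmp Gamma_alg (u j) (X j) = r" if "j \<in> {1..n}" for j
    using assms that is_coproduct_underD[OF assms(1)] by (intro arrow_eqI) auto
  then have "r \<in> hom_set Gamma_alg A Y \<and>
      (\<forall>j\<in>{1..n}. u j \<in> hom_set Gamma_alg (trg Gamma_alg (X j)) Y \<and> cmp Gamma_alg (u j) (X j) = r)"
    using assms(2-5) by simp
  then have "\<exists>!h. h \<in> hom_set Gamma_alg P Y \<and> cmp Gamma_alg h b = r \<and> (\<forall>j\<in>{1..n}. cmp Gamma_alg h (\<iota> j) = u j)"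
    using assms(1)[unfolded is_coproduct_under_def] by blast
  then show ?thesis by simp
qed

lemma coproduct_under_eqI:
  assumes P: "is_coproduct_under Gamma_alg A n X P b \<iota>"
    and f: "f \<in> ar Gamma_alg" "fst f = P" and g: "g \<in> ar Gamma_alg" "fst g = P" "cod g = cod f"
    and b: "\<And>a. a \<in> carrier A \<Longrightarrow> fn f (fn b a) = fn g (fn b a)"
    and \<iota>: "\<And>j x. j \<in> {1..n} \<Longrightarrow> x \<in> carrier (cod (X j)) \<Longrightarrow> fn f (fn (\<iota> j) x) = fn g (fn (\<iota> j) x)"
  shows "f = g"
proof -
  note PD = is_coproduct_underD[OF P]
  have "\<exists>!h. (h \<in> ar Gamma_alg \<and> fst h = P \<and> cod h = cod f) \<and> cmp Gamma_alg h b = cmp Gamma_alg f b \<and>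
      (\<forall>j\<in>{1..n}. cmp Gamma_alg h (\<iota> j) = cmp Gamma_alg f (\<iota> j))"
    by (rule coproduct_under_universal[OF P]) (use f PD in auto)
  moreover have "cmp Gamma_alg g b = cmp Gamma_alg f b"
    by (rule arrow_eqI) (use f g b PD in auto)
  moreover have "cmp Gamma_alg g (\<iota> j) = cmp Gamma_alg f (\<iota> j)" if "j \<in> {1..n}" for j
    by (rule arrow_eqI) (use f g \<iota>[OF that] PD that in auto)
  ultimately show ?thesis
    using f g by (metis (no_types, lifting))
qed

lemma pairing_opposite:
  assumes P: "is_coproduct_under Gamma_alg A 2 X P b \<iota>"
    and u: "u \<in> ar Gamma_alg" "fst u = cod (X 1)" and v: "v \<in> ar Gamma_alg" "fst v = cod (X 2)" "cod v = cod u"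
    and eq: "\<And>a. a \<in> carrier A \<Longrightarrow> fn u (fn (X 1) a) = fn v (fn (X 2) a)"
  defines "h \<equiv> pairing (opposite Gamma_alg) (\<iota> 1) (\<iota> 2) u v"
  shows "h \<in> ar Gamma_alg" "fst h = P" "cod h = cod u"
    "\<And>x. x \<in> carrier (cod (X 1)) \<Longrightarrow> fn h (fn (\<iota> 1) x) = fn u x"
    "\<And>x. x \<in> carrier (cod (X 2)) \<Longrightarrow> fn h (fn (\<iota> 2) x) = fn v x"
proof -
  note PD = is_coproduct_underD[OF P]
  have j: "j \<in> {1..2} \<longleftrightarrow> j = 1 \<or> j = 2" for j :: nat by auto
  have two: "(1 :: nat) \<in> {1..2}" "(2 :: nat) \<in> {1..2}" by auto
  note PD1 = PD(5-10)[OF two(1)] and PD2 = PD(5-10)[OF two(2)]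
  let ?w = "\<lambda>j :: nat. if j = 1 then u else v"
  have r: "cmp Gamma_alg u (X 1) \<in> ar Gamma_alg" using u PD1 by simp
  have "\<exists>!h. (h \<in> ar Gamma_alg \<and> fst h = P \<and> cod h = cod u) \<and> cmp Gamma_alg h b = cmp Gamma_alg u (X 1) \<and>
      (\<forall>j\<in>{1..2}. cmp Gamma_alg h (\<iota> j) = ?w j)"
    by (rule coproduct_under_universal[OF P r]) (use u v eq PD1 PD2 in \<open>auto simp: j simp del: atLeastAtMost_iff One_nat_def\<close>)
  from ex1_implies_ex[OF this] obtain k where k0: "(k \<in> ar Gamma_alg \<and> fst k = P \<and> cod k = cod u) \<and>
      cmp Gamma_alg k b = cmp Gamma_alg u (X 1) \<and> (\<forall>j\<in>{1..2}. cmp Gamma_alg k (\<iota> j) = ?w j)"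
    by blast
  have k: "k \<in> ar Gamma_alg" "fst k = P" "cod k = cod u"
      "cmp Gamma_alg k (\<iota> 1) = u" "cmp Gamma_alg k (\<iota> 2) = v"
    using k0 k0[THEN conjunct2, THEN conjunct2, THEN bspec, OF two(1)]
      k0[THEN conjunct2, THEN conjunct2, THEN bspec, OF two(2)] by simp_all
  have "h = k"
    unfolding h_def pairing_def
  proof (rule the_equality)
    show "k \<in> hom_set (opposite Gamma_alg) (src (opposite Gamma_alg) u) (src (opposite Gamma_alg) (\<iota> 1)) \<and>
      cmp (opposite Gamma_alg) (\<iota> 1) k = u \<and> cmp (opposite Gamma_alg) (\<iota> 2) k = v"
      using k PD1 by simp
  next
    fix k' assume "k' \<in> hom_set (opposite Gamma_alg) (src (opposite Gamma_alg) u) (src (opposite Gamma_alg) (\<iota> 1)) \<and>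
      cmp (opposite Gamma_alg) (\<iota> 1) k' = u \<and> cmp (opposite Gamma_alg) (\<iota> 2) k' = v"
    then have k': "k' \<in> ar Gamma_alg" "fst k' = P" "cod k' = cod u"
        "cmp Gamma_alg k' (\<iota> 1) = u" "cmp Gamma_alg k' (\<iota> 2) = v"
      using PD1 by auto
    have e1: "fn k' (fn (\<iota> 1) x) = fn k (fn (\<iota> 1) x)" if "x \<in> carrier (cod (X 1))" for x
      using that PD1 k(4) k'(4) cmp_simps(3)[of x "\<iota> 1" k] cmp_simps(3)[of x "\<iota> 1" k'] by simp
    have e2: "fn k' (fn (\<iota> 2) x) = fn k (fn (\<iota> 2) x)" if "x \<in> carrier (cod (X 2))" for x
      using that PD2 k(5) k'(5) cmp_simps(3)[of x "\<iota> 2" k] cmp_simps(3)[of x "\<iota> 2" k'] by simp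
    \<comment> \<open>The base b factors through the first injection, so the condition on b in the
      universal property, which \<open>pairing\<close> does not mention, is automatic.\<close>
    have eb: "fn k' (fn b a) = fn k (fn b a)" if "a \<in> carrier A" for a
      using e1[of "fn (X 1) a"] that PD1 by simp
    show "k' = k"
      by (rule coproduct_under_eqI[OF P]) (use k k' e1 e2 eb in \<open>auto simp: j simp del: atLeastAtMost_iff One_nat_def\<close>)
  qed
  with k show "h \<in> ar Gamma_alg" "fst h = P" "cod h = cod u" by auto
  show "fn h (fn (\<iota> 1) x) = fn u x" if "x \<in> carrier (cod (X 1))" for x
    using that PD1 k(4) cmp_simps(3)[of x "\<iota> 1" k] by (simp add: \<open>h = k\<close>)
  show "fn h (fn (\<iota> 2) x) = fn v x" if "x \<in> carrier (cod (X 2))" for x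
    using that PD2 k(5) cmp_simps(3)[of x "\<iota> 2" k] by (simp add: \<open>h = k\<close>)
qed

section \<open>Existence of the copowers of the projection\<close>

context large_universe
begin

lemma tan_proj_simps [simp]:
  fixes A :: "('f, 'u) dpa"
  shows "fst (tan_proj A) = A" "cod (tan_proj A) = tan_ob A" "fn (tan_proj A) = tan_in A"
  by (simp_all add: tan_proj_def)

lemma tan_proj_ar [simp]: "dp_algebra A \<Longrightarrow> tan_proj (A :: ('f, 'u) dpa) \<in> ar Gamma_alg"
  by (simp add: in_ar_iff tan_in_hom)

lemma tan_copower_exists:
  fixes A :: "('f, 'u) dpa"
  assumes A: "dp_algebra A"
  shows "\<exists>P b \<iota>. is_coproduct_under Gamma_alg A k (\<lambda>j. tan_proj A) P b \<iota>"
proof -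
  let ?T = "tan_ob A"
  have T: "dp_algebra ?T" using A by simp
  \<comment> \<open>The label 0 is for the base A and the label j from 1 to k for the j-th copy of
    the tangent algebra. Having the base separately covers k = 0, where there are no copies and the
    coproduct under A is A.\<close>
  define val where "val D r u = (\<lambda>(j :: nat, x). if j = 0 then if x \<in> carrier A then r x else \<zero>\<^bsub>D\<^esub>
      else if j \<le> k \<and> x \<in> carrier ?T then u j x else \<zero>\<^bsub>D\<^esub>)"
    for D :: "('f, 'u) dpa" and r :: "'u \<Rightarrow> 'u" and u
  define K where "K = {(D, val D r u) | D r u. dp_algebra D \<and> r \<in> dp_hom A D \<and>
      (\<forall>j\<in>{1..k}. u j \<in> dp_hom ?T D \<and> (\<forall>a\<in>carrier A. u j (tan_in A a) = r a))}"
  have K: "dp_algebra D \<and> range v \<subseteq> carrier D" if "(D, v) \<in> K" for D v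
  proof -
    from that obtain r u where v: "v = val D r u" "dp_algebra D" "r \<in> dp_hom A D"
      "\<And>j. 1 \<le> j \<Longrightarrow> j \<le> k \<Longrightarrow> u j \<in> dp_hom ?T D"
      by (auto simp: K_def)
    have "v (j, x) \<in> carrier D" for j x
      using vect.zero_closed[OF dp_algebra_vect[OF v(2)]] dp_hom_closed[OF v(3)] dp_hom_closed[OF v(4)[of j]]
      by (auto simp: v(1) val_def)
    then show ?thesis using v(2) by auto
  qed
  obtain c :: "nat \<times> 'u \<Rightarrow> 'u" where c: "inj c"
    using ex_inj_nat_pair by blast
  obtain F :: "('f, 'u) dpa" and \<iota> where F: "dp_algebra F" "range \<iota> \<subseteq> carrier F"
    and ext: "\<And>D v. (D, v) \<in> K \<Longrightarrow> \<exists>h \<in> dp_hom F D. \<forall>x. h (\<iota> x) = v x"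
    and monic: "\<And>x y. x \<in> carrier F \<Longrightarrow> y \<in> carrier F \<Longrightarrow>
       (\<And>D v h. (D, v) \<in> K \<Longrightarrow> h \<in> dp_hom F D \<Longrightarrow> (\<And>x. h (\<iota> x) = v x) \<Longrightarrow> h x = h y) \<Longrightarrow> x = y"
    and gen: "\<And>(B :: ('f, 'u) dpa) f h. dp_algebra B \<Longrightarrow> f \<in> dp_hom F B \<Longrightarrow> h \<in> dp_hom F B \<Longrightarrow>
       (\<And>x. f (\<iota> x) = h (\<iota> x)) \<Longrightarrow> f = h"
    using presented_dp_algebra[OF K c] by blast
  interpret F: dp_algebra F by fact
  have \<iota> [simp]: "\<iota> x \<in> carrier F" for x using F(2) by auto
  have monic': "x = y" if "x \<in> carrier F" "y \<in> carrier F"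
    and "\<And>(D :: ('f, 'u) dpa) h r u. dp_algebra D \<Longrightarrow> r \<in> dp_hom A D \<Longrightarrow>
      (\<And>j. j \<in> {1..k} \<Longrightarrow> u j \<in> dp_hom ?T D) \<Longrightarrow>
      (\<And>j a. j \<in> {1..k} \<Longrightarrow> a \<in> carrier A \<Longrightarrow> u j (tan_in A a) = r a) \<Longrightarrow> h \<in> dp_hom F D \<Longrightarrow>
      (\<And>j x. h (\<iota> (j, x)) = val D r u (j, x)) \<Longrightarrow> h x = h y" for x y
  proof (rule monic[OF that(1,2)])
    fix D v h assume Dvh: "(D, v) \<in> K" "h \<in> dp_hom F D" "\<And>x. h (\<iota> x) = v x"
    then obtain r u where ru: "v = val D r u" "dp_algebra D" "r \<in> dp_hom A D"
      "\<And>j. j \<in> {1..k} \<Longrightarrow> u j \<in> dp_hom ?T D" "\<And>j a. j \<in> {1..k} \<Longrightarrow> a \<in> carrier A \<Longrightarrow> u j (tan_in A a) = r a"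
      by (auto simp: K_def)
    show "h x = h y"
      by (rule that(3)[OF ru(2,3,4,5) Dvh(2)]) (simp_all add: ru(1) Dvh(3))
  qed
  note hr = dp_hom_closed dp_hom_add dp_hom_scale dp_hom_mult dp_hom_dpow
  interpret A: dp_algebra A by fact
  interpret T: dp_algebra ?T by fact
  define b where "b = (A, \<lambda>a\<in>carrier A. \<iota> (0, a), F)"
  define inj where "inj j = (?T, \<lambda>x\<in>carrier ?T. \<iota> (j, x), F)" for j
  have "(\<lambda>a\<in>carrier A. \<iota> (0, a)) \<in> dp_hom A F"
    by (rule restrict_dp_homI[OF A]; (rule monic')?) (simp_all add: hr val_def)
  then have b: "b \<in> ar Gamma_alg" "fst b = A" "cod b = F" "\<And>a. a \<in> carrier A \<Longrightarrow> fn b a = \<iota> (0, a)"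
    by (simp_all add: in_ar_iff A F b_def)
  have "(\<lambda>x\<in>carrier ?T. \<iota> (j, x)) \<in> dp_hom ?T F" if "j \<in> {1..k}" for j
    by (rule restrict_dp_homI[OF T]; (rule monic')?) (use that in \<open>simp_all add: hr val_def\<close>)
  then have inj: "inj j \<in> ar Gamma_alg" "fst (inj j) = ?T" "cod (inj j) = F"
      "\<And>x. x \<in> carrier ?T \<Longrightarrow> fn (inj j) x = \<iota> (j, x)" if "j \<in> {1..k}" for j
    using that by (simp_all add: in_ar_iff T F inj_def)
  have inj_in: "\<iota> (j, tan_in A a) = \<iota> (0, a)" if "j \<in> {1..k}" "a \<in> carrier A" for j a
    by (rule monic') (use that A in \<open>simp_all add: val_def\<close>)
  have "is_coproduct_under Gamma_alg A k (\<lambda>j. tan_proj A) F b inj"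
    unfolding is_coproduct_under_def
  proof (intro conjI allI impI ballI)
    show "cmp Gamma_alg (inj j) (tan_proj A) = b" if "j \<in> {1..k}" for j
      using that A b inj[OF that] inj_in by (intro arrow_eqI) simp_all
  next
    fix Y :: "('f, 'u) dpa" and r and u :: "nat \<Rightarrow> ('f, 'u) dp_arrow"
    assume ru: "r \<in> hom_set Gamma_alg A Y \<and>
      (\<forall>j\<in>{1..k}. u j \<in> hom_set Gamma_alg (trg Gamma_alg (tan_proj A)) Y \<and> cmp Gamma_alg (u j) (tan_proj A) = r)"
    then have r: "r \<in> ar Gamma_alg" "fst r = A" "cod r = Y"
      and u: "\<And>j. j \<in> {1..k} \<Longrightarrow> u j \<in> ar Gamma_alg \<and> fst (u j) = ?T \<and> cod (u j) = Y" by auto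
    have ur: "fn (u j) (tan_in A a) = fn r a" if "j \<in> {1..k}" "a \<in> carrier A" for j a
      using ru that cmp_simps(3)[of a "tan_proj A" "u j"] by simp
    have Y: "dp_algebra Y" using arD(2)[OF r(1)] r by simp
    let ?v = "val Y (fn r) (\<lambda>j. fn (u j))"
    have "fn r \<in> dp_hom A Y" "\<And>j. j \<in> {1..k} \<Longrightarrow> fn (u j) \<in> dp_hom ?T Y"
      using arD(3)[OF r(1)] r(2,3) arD(3) u by (simp, metis)
    then have "(Y, ?v) \<in> K"
      unfolding K_def mem_Collect_eq using Y ur
      by (intro exI[of _ Y] exI[of _ "fn r"] exI[of _ "\<lambda>j. fn (u j)"]) simp
    from ext[OF this] obtain h where h: "h \<in> dp_hom F Y" "\<And>x. h (\<iota> x) = ?v x" by blast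
    show "\<exists>!h. h \<in> hom_set Gamma_alg F Y \<and> cmp Gamma_alg h b = r \<and>
        (\<forall>j\<in>{1..k}. cmp Gamma_alg h (inj j) = u j)"
    proof (rule ex1I[of _ "(F, h, Y)"])
      have har: "(F, h, Y) \<in> ar Gamma_alg" using F Y h by (simp add: in_ar_iff)
      have "cmp Gamma_alg (F, h, Y) b = r"
        by (rule arrow_eqI) (use har b r in \<open>simp_all add: h val_def\<close>)
      moreover have "cmp Gamma_alg (F, h, Y) (inj j) = u j" if "j \<in> {1..k}" for j
        by (rule arrow_eqI) (use har inj[OF that] u[OF that] that in \<open>simp_all add: h val_def\<close>)
      ultimately show "(F, h, Y) \<in> hom_set Gamma_alg F Y \<and> cmp Gamma_alg (F, h, Y) b = r \<and>
        (\<forall>j\<in>{1..k}. cmp Gamma_alg (F, h, Y) (inj j) = u j)"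
        using har by simp
    next
      fix g assume g: "g \<in> hom_set Gamma_alg F Y \<and> cmp Gamma_alg g b = r \<and>
        (\<forall>j\<in>{1..k}. cmp Gamma_alg g (inj j) = u j)"
      have gd: "fn g \<in> dp_hom F Y" using g by (auto simp: in_ar_iff)
      have "fn g = h"
      proof (rule gen[OF Y gd h(1)])
        fix x :: "nat \<times> 'u"
        obtain j y where x: "x = (j, y)" by fastforce
        consider "j = 0" "y \<in> carrier A" | "j \<in> {1..k}" "y \<in> carrier ?T"
          | "j = 0 \<Longrightarrow> y \<notin> carrier A" "j \<in> {1..k} \<Longrightarrow> y \<notin> carrier ?T"
          by fastforce
        then show "fn g (\<iota> x) = h (\<iota> x)"
        proof cases
          case 1
          then have "fn (cmp Gamma_alg g b) y = fn r y" using g by simp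
          then show ?thesis using 1 b by (simp add: x h val_def)
        next
          case 2
          then have "fn (cmp Gamma_alg g (inj j)) y = fn (u j) y" using g by simp
          then show ?thesis using 2 inj[OF 2(1)] by (simp add: x h val_def)
        next
          case 3
          \<comment> \<open>Symbols outside these ranges vanish in \<open>F\<close>, since every
            valuation sends them to zero.\<close>
          have "\<iota> (j, y) = \<zero>\<^bsub>F\<^esub>"
            by (rule monic') (use 3 in \<open>auto simp: val_def dp_hom_zero[OF F(1)]\<close>)
          then show ?thesis
            using dp_hom_zero[OF F(1) Y gd] dp_hom_zero[OF F(1) Y h(1)] by (simp add: x)
        qed
      qed
      then show "g = (F, h, Y)" using g by (auto simp: prod_eq_iff)
    qed
  qed (use A b inj in auto)
  then show ?thesis by blast
qed

end

section \<open>Preservation of coproducts\<close>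

context large_universe
begin

declare One_nat_def [simp del]

lemma tan_ex1:
  fixes A D :: "('f, 'u) dpa"
  assumes A: "dp_algebra A" and D: "dp_algebra D" and g: "restrict g (carrier A) \<in> dp_hom A D" and \<delta>: "dp_der A D g \<delta>"
  shows "\<exists>!h. h \<in> dp_hom (tan_ob A) D \<and> (\<forall>a\<in>carrier A. h (tan_in A a) = g a \<and> h (tan_d A a) = \<delta> a)"
proof -
  have "dp_der A D (restrict g (carrier A)) \<delta>"
    using \<delta> dp_der_cong[OF A, of "restrict g (carrier A)" g \<delta> \<delta>] by simp
  from tan_universal[OF A D g this] show ?thesis by simp
qed

lemma functor_ex1:
  fixes f :: "('f, 'u) dp_arrow"
  assumes f: "f \<in> ar Gamma_alg"
  shows "\<exists>!h. on_generators_functor f h"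
proof -
  note fD = arD[OF f]
  have "restrict (\<lambda>a. tan_in (cod f) (fn f a)) (carrier (fst f)) \<in> dp_hom (fst f) (tan_ob (cod f))"
    using compose_dp_hom[OF fD(1,3) tan_in_hom[OF fD(2)]] by (simp add: compose_def)
  from tan_ex1[OF fD(1) tan_ob_dp_algebra[OF fD(2)] this dp_der_precompose[OF tan_d_der[OF fD(2)] fD(3)]]
  show ?thesis
    by (simp add: on_generators_functor_def split_beta)
qed

lemma tan_ar_simps [simp]:
  fixes f :: "('f, 'u) dp_arrow"
  shows "fst (tan_ar f) = tan_ob (fst f)" "cod (tan_ar f) = tan_ob (cod f)"
  by (simp_all add: tan_ar_def)

lemma tan_ar_functor:
  fixes f :: "('f, 'u) dp_arrow"
  assumes "f \<in> ar Gamma_alg"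
  shows "on_generators_functor f (fn (tan_ar f))"
  using theI'[OF functor_ex1[OF assms]] by (simp add: tan_ar_def)

lemma tan_ar_ar [simp]: "f \<in> ar Gamma_alg \<Longrightarrow> tan_ar (f :: ('f, 'u) dp_arrow) \<in> ar Gamma_alg"
  using tan_ar_functor[of f] by (simp add: on_generators_functor_def split_beta in_ar_iff)

lemma tan_ar_values [simp]:
  fixes f :: "('f, 'u) dp_arrow"
  assumes "f \<in> ar Gamma_alg" "fst f = A" "a \<in> carrier A"
  shows "fn (tan_ar f) (tan_in A a) = tan_in (cod f) (fn f a)"
    "fn (tan_ar f) (tan_d A a) = tan_d (cod f) (fn f a)"
  using tan_ar_functor[OF assms(1)] assms by (auto simp: on_generators_functor_def split_beta)

lemma tan_arrow_eqI:
  fixes A :: "('f, 'u) dpa"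
  assumes A: "dp_algebra A" and f: "f \<in> ar Gamma_alg" "fst f = tan_ob A"
    and g: "g \<in> ar Gamma_alg" "fst g = tan_ob A" "cod g = cod f"
    and "\<And>a. a \<in> carrier A \<Longrightarrow> fn f (tan_in A a) = fn g (tan_in A a)"
    and "\<And>a. a \<in> carrier A \<Longrightarrow> fn f (tan_d A a) = fn g (tan_d A a)"
  shows "f = g"
proof -
  have "fn f = fn g"
    using arD[OF f(1)] arD[OF g(1)] f g assms(7,8) by (intro tan_hom_eqI[OF A, of "cod f"]) auto
  then show ?thesis using f g by (auto simp: prod_eq_iff)
qed

lemma tan_tan_arrow_eqI:
  fixes A :: "('f, 'u) dpa"
  assumes A: "dp_algebra A" and f: "f \<in> ar Gamma_alg" "fst f = tan_ob (tan_ob A)"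
    and g: "g \<in> ar Gamma_alg" "fst g = tan_ob (tan_ob A)" "cod g = cod f"
    and "\<And>a. a \<in> carrier A \<Longrightarrow> fn f (tan_in (tan_ob A) (tan_in A a)) = fn g (tan_in (tan_ob A) (tan_in A a))"
    and "\<And>a. a \<in> carrier A \<Longrightarrow> fn f (tan_in (tan_ob A) (tan_d A a)) = fn g (tan_in (tan_ob A) (tan_d A a))"
    and "\<And>a. a \<in> carrier A \<Longrightarrow> fn f (tan_d (tan_ob A) (tan_in A a)) = fn g (tan_d (tan_ob A) (tan_in A a))"
    and "\<And>a. a \<in> carrier A \<Longrightarrow> fn f (tan_d (tan_ob A) (tan_d A a)) = fn g (tan_d (tan_ob A) (tan_d A a))"
  shows "f = g"
proof -
  have "fn f = fn g"
    using arD[OF f(1)] arD[OF g(1)] f g assms(7-10) by (intro tan_tan_hom_eqI[OF A, of "cod f"]) auto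
  then show ?thesis using f g by (auto simp: prod_eq_iff)
qed

lemma tan3_arrow_eqI:
  fixes A :: "('f, 'u) dpa"
  assumes A: "dp_algebra A" and f: "f \<in> ar Gamma_alg" "fst f = tan_ob (tan_ob (tan_ob A))"
    and g: "g \<in> ar Gamma_alg" "fst g = tan_ob (tan_ob (tan_ob A))" "cod g = cod f"
    and eq: "\<And>a d1 d2 d3. a \<in> carrier A \<Longrightarrow> d1 \<in> {tan_in A, tan_d A} \<Longrightarrow>
      d2 \<in> {tan_in (tan_ob A), tan_d (tan_ob A)} \<Longrightarrow>
      d3 \<in> {tan_in (tan_ob (tan_ob A)), tan_d (tan_ob (tan_ob A))} \<Longrightarrow>
      fn f (d3 (d2 (d1 a))) = fn g (d3 (d2 (d1 a)))"
  shows "f = g"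
proof -
  have "fn f = fn g"
    using arD[OF f(1)] arD[OF g(1)] f g eq by (intro tan3_hom_eqI[OF A, of "cod f"]) auto
  then show ?thesis using f g by (auto simp: prod_eq_iff)
qed

text \<open>The functor \<open>tan_ob\<close> is left adjoint to the dual numbers, so it preserves coproducts.\<close>

lemma tan_preserves_coproduct:
  fixes A :: "('f, 'u) dpa"
  assumes P: "is_coproduct_under Gamma_alg A n (\<lambda>j. p) P b \<iota>" and p: "p \<in> ar Gamma_alg" "fst p = A"
  shows "is_coproduct_under Gamma_alg (tan_ob A) n (\<lambda>j. tan_ar p) (tan_ob P) (tan_ar b) (\<lambda>j. tan_ar (\<iota> j))"
proof -
  note PD = is_coproduct_underD[OF P]
  let ?X = "cod p"
  have A: "dp_algebra A" and X: "dp_algebra ?X" and Pa: "dp_algebra P"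
    using PD arD[OF p(1)] arD[OF PD(2)] by auto
  show ?thesis
    unfolding is_coproduct_under_def
  proof (intro conjI allI impI ballI)
    show "cmp Gamma_alg (tan_ar (\<iota> j)) (tan_ar p) = tan_ar b" if "j \<in> {1..n}" for j
      by (rule tan_arrow_eqI[OF A]) (use PD(2-4) PD(5-10)[OF that] p A in auto)
  next
    fix Y :: "('f, 'u) dpa" and r and u :: "nat \<Rightarrow> ('f, 'u) dp_arrow"
    assume ru: "r \<in> hom_set Gamma_alg (tan_ob A) Y \<and>
      (\<forall>j\<in>{1..n}. u j \<in> hom_set Gamma_alg (trg Gamma_alg (tan_ar p)) Y \<and> cmp Gamma_alg (u j) (tan_ar p) = r)"
    then have r: "r \<in> ar Gamma_alg" "fst r = tan_ob A" "cod r = Y"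
      and u: "\<And>j. j \<in> {1..n} \<Longrightarrow> u j \<in> ar Gamma_alg" "\<And>j. j \<in> {1..n} \<Longrightarrow> fst (u j) = tan_ob ?X"
        "\<And>j. j \<in> {1..n} \<Longrightarrow> cod (u j) = Y" "\<And>j. j \<in> {1..n} \<Longrightarrow> cmp Gamma_alg (u j) (tan_ar p) = r"
      by auto
    have Y: "dp_algebra Y" using arD(2)[OF r(1)] r by simp
    obtain c :: "'u \<times> 'u \<Rightarrow> 'u" where c: "inj c" using ex_inj_pair by blast
    \<comment> \<open>The given coproduct is universal only among algebras on \<open>'u\<close>, so
      the dual numbers over \<open>Y\<close> enter through a copy \<open>E\<close>.\<close>
    obtain E :: "('f, 'u) dpa" and \<phi> \<psi> where E: "dp_algebra E" "\<phi> \<in> dp_hom (dual Y) E" "\<psi> \<in> dp_hom E (dual Y)"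
      "\<And>x. x \<in> carrier (dual Y) \<Longrightarrow> \<psi> (\<phi> x) = x" "\<And>y. y \<in> carrier E \<Longrightarrow> \<phi> (\<psi> y) = y"
      using dp_algebra_transport[OF dp_algebra_dual[OF Y] c] by metis
    \<comment> \<open>\<open>tr\<close> is the transpose of an arrow from \<open>tan_ob B\<close> to
      \<open>Y\<close>, read as an arrow from \<open>B\<close> to \<open>E\<close>. The cocone on
      the tangent algebras becomes a cocone on the original diagram.\<close>
    define tr where "tr B h = (B, \<lambda>x\<in>carrier B. \<phi> (fn h (tan_in B x), fn h (tan_d B x)), E)"
      for B :: "('f, 'u) dpa" and h :: "('f, 'u) dp_arrow"
    have tr: "tr B h \<in> ar Gamma_alg" "fst (tr B h) = B" "cod (tr B h) = E"
        "\<And>x. x \<in> carrier B \<Longrightarrow> fn (tr B h) x = \<phi> (fn h (tan_in B x), fn h (tan_d B x))"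
      if "dp_algebra B" "h \<in> ar Gamma_alg" "fst h = tan_ob B" "cod h = Y" for B h
    proof -
      have "(\<lambda>x\<in>carrier B. (fn h (tan_in B x), fn h (tan_d B x))) \<in> dp_hom B (dual Y)"
        using that arD[OF that(2)] by (intro tan_pair_hom[OF that(1) Y]) simp
      from compose_dp_hom[OF that(1) this E(2)]
      have "(\<lambda>x\<in>carrier B. \<phi> (fn h (tan_in B x), fn h (tan_d B x))) \<in> dp_hom B E"
        by (simp add: compose_def cong: restrict_cong)
      then show "tr B h \<in> ar Gamma_alg"
        using that(1) E(1) by (simp add: tr_def in_ar_iff)
    qed (simp_all add: tr_def)
    have urel: "fn (u j) (tan_in ?X (fn p a)) = fn r (tan_in A a)" "fn (u j) (tan_d ?X (fn p a)) = fn r (tan_d A a)"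
      if "j \<in> {1..n}" "a \<in> carrier A" for j a
      using arg_cong[OF u(4)[OF that(1)], of "\<lambda>h. fn h (tan_in A a)"]
        arg_cong[OF u(4)[OF that(1)], of "\<lambda>h. fn h (tan_d A a)"] p that A by simp_all
    have ex1: "\<exists>!h. (h \<in> ar Gamma_alg \<and> fst h = P \<and> cod h = E) \<and> cmp Gamma_alg h b = tr A r \<and>
        (\<forall>j\<in>{1..n}. cmp Gamma_alg h (\<iota> j) = tr ?X (u j))"
      by (rule coproduct_under_universal[OF P])
         (use tr[OF A r] tr[OF X u(1-3)] PD p urel in auto)
    then obtain h where h: "h \<in> ar Gamma_alg" "fst h = P" "cod h = E" "cmp Gamma_alg h b = tr A r"
        "\<And>j. j \<in> {1..n} \<Longrightarrow> cmp Gamma_alg h (\<iota> j) = tr ?X (u j)"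
      by blast
    \<comment> \<open>The arrow obtained from the coproduct \<open>P\<close> is transposed back to
      an arrow out of \<open>tan_ob P\<close>.\<close>
    have "compose (carrier P) \<psi> (fn h) \<in> dp_hom P (dual Y)"
      using compose_dp_hom[OF Pa _ E(3)] arD(3)[OF h(1)] h(2,3) by simp
    from tan_extend_dual[OF Pa Y inj_on_id this]
    obtain k where k: "k \<in> dp_hom (tan_ob P) Y" "\<And>x. x \<in> carrier P \<Longrightarrow> k (tan_in P x) = fst (\<psi> (fn h x))"
        "\<And>x. x \<in> carrier P \<Longrightarrow> k (tan_d P x) = snd (\<psi> (fn h x))"
      by (auto simp: compose_def)
    let ?k = "(tan_ob P, k, Y)"
    have kar: "?k \<in> ar Gamma_alg" using k Pa Y by (simp add: in_ar_iff)
    have hb: "fn h (fn b a) = \<phi> (fn r (tan_in A a), fn r (tan_d A a))" if "a \<in> carrier A" for a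
      using arg_cong[OF h(4), of "\<lambda>h. fn h a"] that PD(3) tr(4)[OF A r] by simp
    have hi: "fn h (fn (\<iota> j) x) = \<phi> (fn (u j) (tan_in ?X x), fn (u j) (tan_d ?X x))"
      if "j \<in> {1..n}" "x \<in> carrier ?X" for j x
      using arg_cong[OF h(5)[OF that(1)], of "\<lambda>h. fn h x"] that PD(8)[OF that(1)] tr(4)[OF X u(1-3)[OF that(1)]]
      by simp
    show "\<exists>!h. h \<in> hom_set Gamma_alg (tan_ob P) Y \<and> cmp Gamma_alg h (tan_ar b) = r \<and>
        (\<forall>j\<in>{1..n}. cmp Gamma_alg h (tan_ar (\<iota> j)) = u j)"
    proof (rule ex1I[of _ ?k])
      have "cmp Gamma_alg ?k (tan_ar b) = r"
        by (rule tan_arrow_eqI[OF A]) (use kar PD(2-4) r A in \<open>simp_all add: k hb E(4)\<close>)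
      moreover have "cmp Gamma_alg ?k (tan_ar (\<iota> j)) = u j" if "j \<in> {1..n}" for j
        by (rule tan_arrow_eqI[OF X])
           (use kar PD(5-9)[OF that] u(1-3)[OF that] X hi[OF that] in \<open>simp_all add: k E(4)\<close>)
      ultimately show "?k \<in> hom_set Gamma_alg (tan_ob P) Y \<and> cmp Gamma_alg ?k (tan_ar b) = r \<and>
        (\<forall>j\<in>{1..n}. cmp Gamma_alg ?k (tan_ar (\<iota> j)) = u j)"
        using kar by simp
    next
      fix g assume "g \<in> hom_set Gamma_alg (tan_ob P) Y \<and> cmp Gamma_alg g (tan_ar b) = r \<and>
        (\<forall>j\<in>{1..n}. cmp Gamma_alg g (tan_ar (\<iota> j)) = u j)"
      then have g: "g \<in> ar Gamma_alg" "fst g = tan_ob P" "cod g = Y" "cmp Gamma_alg g (tan_ar b) = r"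
        "\<And>j. j \<in> {1..n} \<Longrightarrow> cmp Gamma_alg g (tan_ar (\<iota> j)) = u j" by auto
      note trg = tr[OF Pa g(1-3)]
      \<comment> \<open>Uniqueness: the transpose of any competitor solves the transposed problem,
        hence equals \<open>h\<close>, and this determines the competitor on generators.\<close>
      have "cmp Gamma_alg (tr P g) b = tr A r"
      proof (rule arrow_eqI)
        show "fn (cmp Gamma_alg (tr P g) b) x = fn (tr A r) x" if "x \<in> carrier (fst (cmp Gamma_alg (tr P g) b))" for x
          using that PD(2-4) trg tr[OF A r] A unfolding g(4)[symmetric] by simp
      qed (use PD(2-4) trg tr[OF A r] in simp_all)
      moreover have "cmp Gamma_alg (tr P g) (\<iota> j) = tr ?X (u j)" if "j \<in> {1..n}" for j
      proof (rule arrow_eqI)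
        show "fn (cmp Gamma_alg (tr P g) (\<iota> j)) x = fn (tr ?X (u j)) x"
          if "x \<in> carrier (fst (cmp Gamma_alg (tr P g) (\<iota> j)))" for x
          using that PD(5-9)[OF \<open>j \<in> {1..n}\<close>] trg tr[OF X u(1-3)[OF \<open>j \<in> {1..n}\<close>]] X
          unfolding g(5)[OF \<open>j \<in> {1..n}\<close>, symmetric] by simp
      qed (use PD(5-9)[OF that] trg tr[OF X u(1-3)[OF that]] in simp_all)
      ultimately have "tr P g = h"
        using ex1 trg h by blast
      then have e: "\<psi> (fn h x) = (fn g (tan_in P x), fn g (tan_d P x))" if "x \<in> carrier P" for x
        using trg(4)[OF that] that g Pa by (simp add: E(4))
      show "g = ?k"
        by (rule tan_arrow_eqI[OF Pa]) (use kar g k e in simp_all)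
    qed
  qed (use PD p A in auto)
qed

lemma tan_pow_preserves_coproduct:
  fixes A :: "('f, 'u) dpa"
  assumes "is_coproduct_under Gamma_alg A n (\<lambda>j. p) P b \<iota>" "p \<in> ar Gamma_alg" "fst p = A"
  shows "is_coproduct_under Gamma_alg ((tan_ob ^^ m) A) n (\<lambda>j. (tan_ar ^^ m) p) ((tan_ob ^^ m) P)
      ((tan_ar ^^ m) b) (\<lambda>j. (tan_ar ^^ m) (\<iota> j)) \<and>
    (tan_ar ^^ m) p \<in> ar Gamma_alg \<and> fst ((tan_ar ^^ m) p) = (tan_ob ^^ m) A"
  using assms by (induction m) (auto intro: tan_preserves_coproduct)

end

section \<open>The structure maps\<close>

context large_universe
begin

lemma tan_copower_spec:
  fixes A :: "('f, 'u) dpa"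
  assumes "dp_algebra A"
  shows "is_coproduct_under Gamma_alg A k (\<lambda>j. tan_proj A) (tan_n k A) (tan_n_base k A) (\<lambda>j. tan_n_inj k j A)"
proof -
  let ?P = "\<lambda>(P, b, \<iota>). is_coproduct_under Gamma_alg A k (\<lambda>j. tan_proj A) P b \<iota>"
  obtain P b \<iota> where "is_coproduct_under Gamma_alg A k (\<lambda>j. tan_proj A) P b \<iota>"
    using tan_copower_exists[OF assms] by blast
  then have "?P (P, b, \<iota>)" by simp
  then have "?P (tan_copower k A)"
    unfolding tan_copower_def by (rule someI[where P = ?P])
  then show ?thesis
    by (simp add: tan_n_def tan_n_base_def tan_n_inj_def case_prod_beta)
qed

context
  fixes A :: "('f, 'u) dpa"
  assumes A: "dp_algebra A"
begin

lemma tan_n_simps [simp]: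
  "dp_algebra (tan_n k A)"
  "tan_n_base k A \<in> ar Gamma_alg" "fst (tan_n_base k A) = A" "cod (tan_n_base k A) = tan_n k A"
  "1 \<le> j \<Longrightarrow> j \<le> k \<Longrightarrow> tan_n_inj k j A \<in> ar Gamma_alg"
  "1 \<le> j \<Longrightarrow> j \<le> k \<Longrightarrow> fst (tan_n_inj k j A) = tan_ob A"
  "1 \<le> j \<Longrightarrow> j \<le> k \<Longrightarrow> cod (tan_n_inj k j A) = tan_n k A"
  "a \<in> carrier A \<Longrightarrow> fn (tan_n_base k A) a = tan_n_in k A a"
  "1 \<le> j \<Longrightarrow> j \<le> k \<Longrightarrow> a \<in> carrier A \<Longrightarrow> fn (tan_n_inj k j A) (tan_in A a) = tan_n_in k A a"
  "a \<in> carrier A \<Longrightarrow> fn (tan_n_inj k j A) (tan_d A a) = tan_n_d k j A a"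
  using is_coproduct_underD[OF tan_copower_spec[OF A, of k]] arD(2)[of "tan_n_base k A"]
  by (auto simp: tan_n_in_def tan_n_d_def)

lemma tan_n_closed [simp]:
  "a \<in> carrier A \<Longrightarrow> tan_n_in k A a \<in> carrier (tan_n k A)"
  "1 \<le> j \<Longrightarrow> j \<le> k \<Longrightarrow> a \<in> carrier A \<Longrightarrow> tan_n_d k j A a \<in> carrier (tan_n k A)"
  using arrow_closed[of "tan_n_base k A" "tan_n k A" a] arrow_closed[of "tan_n_inj k j A" "tan_n k A" "tan_d A a"] A
  by auto

lemma tan_in_arith [simp]:
  "x \<in> carrier A \<Longrightarrow> y \<in> carrier A \<Longrightarrow> tan_in A (x \<oplus>\<^bsub>A\<^esub> y) = tan_in A x \<oplus>\<^bsub>tan_ob A\<^esub> tan_in A y"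
  "tan_in A \<zero>\<^bsub>A\<^esub> = \<zero>\<^bsub>tan_ob A\<^esub>"
  using dp_hom_add[OF tan_in_hom[OF A]] dp_hom_zero[OF A _ tan_in_hom[OF A]] A by auto

lemma tan_d_arith [simp]:
  "x \<in> carrier A \<Longrightarrow> y \<in> carrier A \<Longrightarrow> tan_d A (x \<oplus>\<^bsub>A\<^esub> y) = tan_d A x \<oplus>\<^bsub>tan_ob A\<^esub> tan_d A y"
  "tan_d A \<zero>\<^bsub>A\<^esub> = \<zero>\<^bsub>tan_ob A\<^esub>"
proof -
  interpret A: dp_algebra A by (rule A)
  interpret T: dp_algebra "tan_ob A" using A by simp
  show "x \<in> carrier A \<Longrightarrow> y \<in> carrier A \<Longrightarrow> tan_d A (x \<oplus>\<^bsub>A\<^esub> y) = tan_d A x \<oplus>\<^bsub>tan_ob A\<^esub> tan_d A y"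
    by (rule dp_derD(2)[OF tan_d_der[OF A]])
  show "tan_d A \<zero>\<^bsub>A\<^esub> = \<zero>\<^bsub>tan_ob A\<^esub>"
    using dp_derD(3)[OF tan_d_der[OF A], of "\<zero>\<^bsub>A\<^esub>" 0] A by simp
qed

lemma dp_arith [simp]:
  "\<zero>\<^bsub>A\<^esub> \<in> carrier A"
  "x \<in> carrier A \<Longrightarrow> y \<in> carrier A \<Longrightarrow> x \<oplus>\<^bsub>A\<^esub> y \<in> carrier A"
  "x \<in> carrier A \<Longrightarrow> vneg A x \<in> carrier A"
  "x \<in> carrier A \<Longrightarrow> x \<oplus>\<^bsub>A\<^esub> \<zero>\<^bsub>A\<^esub> = x"
  "x \<in> carrier A \<Longrightarrow> \<zero>\<^bsub>A\<^esub> \<oplus>\<^bsub>A\<^esub> x = x"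
  "x \<in> carrier A \<Longrightarrow> x \<oplus>\<^bsub>A\<^esub> vneg A x = \<zero>\<^bsub>A\<^esub>"
  "x \<in> carrier A \<Longrightarrow> y \<in> carrier A \<Longrightarrow> w \<in> carrier A \<Longrightarrow> x \<oplus>\<^bsub>A\<^esub> y \<oplus>\<^bsub>A\<^esub> w = x \<oplus>\<^bsub>A\<^esub> (y \<oplus>\<^bsub>A\<^esub> w)"
proof -
  interpret dp_algebra A by (rule A)
  show "\<zero>\<^bsub>A\<^esub> \<in> carrier A"
    "x \<in> carrier A \<Longrightarrow> y \<in> carrier A \<Longrightarrow> x \<oplus>\<^bsub>A\<^esub> y \<in> carrier A"
    "x \<in> carrier A \<Longrightarrow> vneg A x \<in> carrier A"
    "x \<in> carrier A \<Longrightarrow> x \<oplus>\<^bsub>A\<^esub> \<zero>\<^bsub>A\<^esub> = x"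
    "x \<in> carrier A \<Longrightarrow> \<zero>\<^bsub>A\<^esub> \<oplus>\<^bsub>A\<^esub> x = x"
    "x \<in> carrier A \<Longrightarrow> x \<oplus>\<^bsub>A\<^esub> vneg A x = \<zero>\<^bsub>A\<^esub>"
    "x \<in> carrier A \<Longrightarrow> y \<in> carrier A \<Longrightarrow> w \<in> carrier A \<Longrightarrow> x \<oplus>\<^bsub>A\<^esub> y \<oplus>\<^bsub>A\<^esub> w = x \<oplus>\<^bsub>A\<^esub> (y \<oplus>\<^bsub>A\<^esub> w)"
    by (simp_all add: add_assoc)
qed

lemma tan_n_arrow_eqI:
  assumes f: "f \<in> ar Gamma_alg" "fst f = tan_n k A"
    and g: "g \<in> ar Gamma_alg" "fst g = tan_n k A" "cod g = cod f"
    and "\<And>a. a \<in> carrier A \<Longrightarrow> fn f (tan_n_in k A a) = fn g (tan_n_in k A a)"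
    and "\<And>j a. 1 \<le> j \<Longrightarrow> j \<le> k \<Longrightarrow> a \<in> carrier A \<Longrightarrow> fn f (tan_n_d k j A a) = fn g (tan_n_d k j A a)"
  shows "f = g"
proof (rule coproduct_under_eqI[OF tan_copower_spec[OF A, of k] f g])
  show "fn f (fn (tan_n_base k A) a) = fn g (fn (tan_n_base k A) a)" if "a \<in> carrier A" for a
    using assms(6) that A by simp
  show "fn f (fn (tan_n_inj k j A) x) = fn g (fn (tan_n_inj k j A) x)"
    if j: "j \<in> {1..k}" and x: "x \<in> carrier (cod (tan_proj A))" for j x
  proof -
    have "cmp Gamma_alg f (tan_n_inj k j A) = cmp Gamma_alg g (tan_n_inj k j A)"
      by (rule tan_arrow_eqI[OF A]) (use f g j assms(6,7) A in simp_all)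
    from arg_cong[OF this, of "\<lambda>h. fn h x"] show ?thesis
      using f g j x A by simp
  qed
qed

text \<open>Read in the category of algebras, a pairing in its opposite is the arrow [u, v] out of
  the twofold coproduct.\<close>

abbreviation "copair u v \<equiv> pairing (opposite Gamma_alg) (tan_n_inj 2 1 A) (tan_n_inj 2 2 A) u v"

lemma copair:
  assumes u: "u \<in> ar Gamma_alg" "fst u = tan_ob A" and v: "v \<in> ar Gamma_alg" "fst v = tan_ob A" "cod v = cod u"
    and eq: "\<forall>a\<in>carrier A. fn u (tan_in A a) = fn v (tan_in A a)"
  shows "copair u v \<in> ar Gamma_alg" "fst (copair u v) = tan_n 2 A" "cod (copair u v) = cod u"
    "a \<in> carrier A \<Longrightarrow> fn (copair u v) (tan_n_in 2 A a) = fn u (tan_in A a)"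
    "a \<in> carrier A \<Longrightarrow> fn (copair u v) (tan_n_d 2 1 A a) = fn u (tan_d A a)"
    "a \<in> carrier A \<Longrightarrow> fn (copair u v) (tan_n_d 2 2 A a) = fn v (tan_d A a)"
proof -
  have c: "fst u = cod (tan_proj A)" "fst v = cod (tan_proj A)"
    "\<And>a. a \<in> carrier A \<Longrightarrow> fn u (fn (tan_proj A) a) = fn v (fn (tan_proj A) a)"
    using u v eq by simp_all
  note * = pairing_opposite[OF tan_copower_spec[OF A, of 2] u(1) c(1) v(1) c(2) v(3) c(3), simplified tan_proj_simps]
  show "copair u v \<in> ar Gamma_alg" "fst (copair u v) = tan_n 2 A" "cod (copair u v) = cod u"
    by (rule *; simp)+
  show "fn (copair u v) (tan_n_in 2 A a) = fn u (tan_in A a)"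
    "fn (copair u v) (tan_n_d 2 1 A a) = fn u (tan_d A a)"
    "fn (copair u v) (tan_n_d 2 2 A a) = fn v (tan_d A a)" if "a \<in> carrier A"
    using *(4)[of "tan_in A a"] *(4)[of "tan_d A a"] *(5)[of "tan_d A a"] that A by simp_all
qed

abbreviation "tan_copair u v \<equiv> pairing (opposite Gamma_alg) (tan_ar (tan_n_inj 2 1 A)) (tan_ar (tan_n_inj 2 2 A)) u v"

text \<open>By preservation, the tangent algebra of \<open>tan_n 2 A\<close> is again a coproduct,
  now under \<open>tan_ob A\<close>. The two conditions on u and v say that they agree on that base,
  which is generated by a and by the image d'a of da.\<close>

lemma tan_copair:
  assumes u: "u \<in> ar Gamma_alg" "fst u = tan_ob (tan_ob A)"
    and v: "v \<in> ar Gamma_alg" "fst v = tan_ob (tan_ob A)" "cod v = cod u"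
    and eq: "\<forall>a\<in>carrier A. fn u (tan_in (tan_ob A) (tan_in A a)) = fn v (tan_in (tan_ob A) (tan_in A a))"
       "\<forall>a\<in>carrier A. fn u (tan_d (tan_ob A) (tan_in A a)) = fn v (tan_d (tan_ob A) (tan_in A a))"
  shows "tan_copair u v \<in> ar Gamma_alg" "fst (tan_copair u v) = tan_ob (tan_n 2 A)" "cod (tan_copair u v) = cod u"
    "a \<in> carrier A \<Longrightarrow> fn (tan_copair u v) (tan_in (tan_n 2 A) (tan_n_in 2 A a)) = fn u (tan_in (tan_ob A) (tan_in A a))"
    "a \<in> carrier A \<Longrightarrow> fn (tan_copair u v) (tan_d (tan_n 2 A) (tan_n_in 2 A a)) = fn u (tan_d (tan_ob A) (tan_in A a))"
    "a \<in> carrier A \<Longrightarrow> fn (tan_copair u v) (tan_in (tan_n 2 A) (tan_n_d 2 1 A a)) = fn u (tan_in (tan_ob A) (tan_d A a))"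
    "a \<in> carrier A \<Longrightarrow> fn (tan_copair u v) (tan_d (tan_n 2 A) (tan_n_d 2 1 A a)) = fn u (tan_d (tan_ob A) (tan_d A a))"
    "a \<in> carrier A \<Longrightarrow> fn (tan_copair u v) (tan_in (tan_n 2 A) (tan_n_d 2 2 A a)) = fn v (tan_in (tan_ob A) (tan_d A a))"
    "a \<in> carrier A \<Longrightarrow> fn (tan_copair u v) (tan_d (tan_n 2 A) (tan_n_d 2 2 A a)) = fn v (tan_d (tan_ob A) (tan_d A a))"
proof -
  have "cmp Gamma_alg u (tan_ar (tan_proj A)) = cmp Gamma_alg v (tan_ar (tan_proj A))"
    by (rule tan_arrow_eqI[OF A]) (use u v eq A in simp_all)
  note e' = arg_cong[OF this, of "\<lambda>h. fn h x" for x]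
  have e: "fn u (fn (tan_ar (tan_proj A)) x) = fn v (fn (tan_ar (tan_proj A)) x)" if "x \<in> carrier (tan_ob A)" for x
    using e'[of x] that by simp
  have c: "fst u = cod (tan_ar (tan_proj A))" "fst v = cod (tan_ar (tan_proj A))"
    using u v by simp_all
  have P: "is_coproduct_under Gamma_alg (tan_ob A) 2 (\<lambda>j. tan_ar (tan_proj A)) (tan_ob (tan_n 2 A))
      (tan_ar (tan_n_base 2 A)) (\<lambda>j. tan_ar (tan_n_inj 2 j A))"
    using A by (intro tan_preserves_coproduct tan_copower_spec) simp_all
  note * = pairing_opposite[OF P u(1) c(1) v(1) c(2) v(3) e, simplified tan_proj_simps tan_ar_simps]
  show "tan_copair u v \<in> ar Gamma_alg" "fst (tan_copair u v) = tan_ob (tan_n 2 A)" "cod (tan_copair u v) = cod u"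
    by (rule *; simp)+
  let ?T = "tan_ob A"
  show "fn (tan_copair u v) (tan_in (tan_n 2 A) (tan_n_in 2 A a)) = fn u (tan_in (tan_ob A) (tan_in A a))"
    "fn (tan_copair u v) (tan_d (tan_n 2 A) (tan_n_in 2 A a)) = fn u (tan_d (tan_ob A) (tan_in A a))"
    "fn (tan_copair u v) (tan_in (tan_n 2 A) (tan_n_d 2 1 A a)) = fn u (tan_in (tan_ob A) (tan_d A a))"
    "fn (tan_copair u v) (tan_d (tan_n 2 A) (tan_n_d 2 1 A a)) = fn u (tan_d (tan_ob A) (tan_d A a))"
    "fn (tan_copair u v) (tan_in (tan_n 2 A) (tan_n_d 2 2 A a)) = fn v (tan_in (tan_ob A) (tan_d A a))"
    "fn (tan_copair u v) (tan_d (tan_n 2 A) (tan_n_d 2 2 A a)) = fn v (tan_d (tan_ob A) (tan_d A a))"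
    if "a \<in> carrier A"
    using *(4)[of "tan_in ?T (tan_in A a)"] *(4)[of "tan_d ?T (tan_in A a)"]
      *(4)[of "tan_in ?T (tan_d A a)"] *(4)[of "tan_d ?T (tan_d A a)"]
      *(5)[of "tan_in ?T (tan_d A a)"] *(5)[of "tan_d ?T (tan_d A a)"] that A by simp_all
qed

lemma zero_ex1: "\<exists>!h. on_generators_zero A h"
  unfolding on_generators_zero_def using A id_dp_hom[OF A] by (intro tan_ex1 dp_der_zero) simp_all

lemma neg_ex1: "\<exists>!h. on_generators_neg A h"
proof -
  interpret T: dp_algebra "tan_ob A" using A by simp
  have "dp_der A (tan_ob A) (tan_in A) (\<lambda>a. (- 1) \<cdot>\<^bsub>tan_ob A\<^esub> tan_d A a)"
    using A by (intro dp_der_scale tan_d_der) simp_all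
  moreover have "dp_der A (tan_ob A) (tan_in A) (\<lambda>a. (- 1) \<cdot>\<^bsub>tan_ob A\<^esub> tan_d A a)
      \<longleftrightarrow> dp_der A (tan_ob A) (tan_in A) (\<lambda>a. vneg (tan_ob A) (tan_d A a))"
    using A by (intro dp_der_cong) (simp_all add: T.neg_eq_scale)
  moreover note restrict_dp_hom[OF tan_in_hom[OF A]]
  ultimately show ?thesis
    unfolding on_generators_neg_def using A tan_in_hom[OF A] by (intro tan_ex1) simp_all
qed

text \<open>Both injections restrict to the same map on A, so \<open>d_1\<close> and
  \<open>d_2\<close> are derivations along one morphism and may be added.\<close>

lemma sum_ex1: "\<exists>!h. on_generators_sum A h"
proof -
  have g: "fn (tan_n_base 2 A) \<in> dp_hom A (tan_n 2 A)"
    using arD(3)[of "tan_n_base 2 A"] A by simp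
  then have r: "restrict (tan_n_in 2 A) (carrier A) \<in> dp_hom A (tan_n 2 A)"
    unfolding tan_n_in_def[abs_def] by (simp only: restrict_dp_hom)
  have d: "dp_der A (tan_n 2 A) (tan_n_in 2 A) (tan_n_d 2 j A)" if j: "1 \<le> j" "j \<le> 2" for j
  proof -
    have "fn (tan_n_inj 2 j A) \<in> dp_hom (tan_ob A) (tan_n 2 A)"
      using arD(3)[of "tan_n_inj 2 j A"] A j by simp
    from dp_der_compose[OF tan_d_der[OF A] this]
    have "dp_der A (tan_n 2 A) (\<lambda>a. fn (tan_n_inj 2 j A) (tan_in A a)) (\<lambda>a. fn (tan_n_inj 2 j A) (tan_d A a))"
      using A by simp
    moreover have "dp_der A (tan_n 2 A) (\<lambda>a. fn (tan_n_inj 2 j A) (tan_in A a)) (\<lambda>a. fn (tan_n_inj 2 j A) (tan_d A a))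
        \<longleftrightarrow> ?thesis"
      using A j by (intro dp_der_cong) simp_all
    ultimately show ?thesis by blast
  qed
  show ?thesis
    unfolding on_generators_sum_def using A r by (intro tan_ex1 dp_der_sum d) simp_all
qed

lemma tan_pair: "(\<lambda>x\<in>carrier A. (tan_in A x, tan_d A x)) \<in> dp_hom A (dual (tan_ob A))"
  using dp_der_iff_dual[OF A tan_in_hom[OF A]] tan_d_der[OF A] by blast

lemma lift_ex1: "\<exists>!h. on_generators_lift A h"
proof -
  have T: "dp_algebra (tan_ob A)" using A by simp
  \<comment> \<open>This map sends a to ((a, 0), (0, da)), the prescribed values of the
    lift.\<close>
  note k = compose_dp_hom[OF A tan_pair dual_lift_dp_hom[OF T]]
  show ?thesis
    unfolding on_generators_lift_def Let_def
    using tan_tan_extend[OF A T k] T A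
    by (intro ex_ex1I) (force simp: compose_def, auto intro: tan_tan_hom_eqI[OF A T])
qed

end

lemma flip_ex1:
  fixes A :: "('f, 'u) dpa"
  assumes A: "dp_algebra A"
  shows "\<exists>!h. on_generators_flip A h"
proof -
  have T: "dp_algebra (tan_ob A)" using A by simp
  have TT: "dp_algebra (tan_ob (tan_ob A))" using T by simp
  \<comment> \<open>The identity corresponds to ((a, d'a), (da, d'da)); exchanging the middle
    entries gives the prescribed values of the flip.\<close>
  note k = compose_dp_hom[OF A compose_dp_hom[OF A tan_pair[OF A] dual_map_dp_hom[OF T tan_pair[OF T]]]
      dual_swap_dp_hom[OF TT]]
  show ?thesis
    unfolding on_generators_flip_def Let_def
    using tan_tan_extend[OF A TT k] T TT A
    by (intro ex_ex1I) (force simp: compose_def, auto intro: tan_tan_hom_eqI[OF A TT])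
qed

context
  fixes A :: "('f, 'u) dpa"
  assumes A: "dp_algebra A"
begin

lemma tan_zero_simps [simp]:
  "fst (tan_zero A) = tan_ob A" "cod (tan_zero A) = A" "tan_zero A \<in> ar Gamma_alg"
  "a \<in> carrier A \<Longrightarrow> fn (tan_zero A) (tan_in A a) = a"
  "a \<in> carrier A \<Longrightarrow> fn (tan_zero A) (tan_d A a) = \<zero>\<^bsub>A\<^esub>"
  using theI'[OF zero_ex1[OF A]] A by (simp_all add: tan_zero_def on_generators_zero_def in_ar_iff)

lemma tan_neg_simps [simp]:
  "fst (tan_neg A) = tan_ob A" "cod (tan_neg A) = tan_ob A" "tan_neg A \<in> ar Gamma_alg"
  "a \<in> carrier A \<Longrightarrow> fn (tan_neg A) (tan_in A a) = tan_in A a"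
  "a \<in> carrier A \<Longrightarrow> fn (tan_neg A) (tan_d A a) = vneg (tan_ob A) (tan_d A a)"
  using theI'[OF neg_ex1[OF A]] A by (simp_all add: tan_neg_def on_generators_neg_def in_ar_iff)

lemma tan_sum_simps [simp]:
  "fst (tan_sum A) = tan_ob A" "cod (tan_sum A) = tan_n 2 A" "tan_sum A \<in> ar Gamma_alg"
  "a \<in> carrier A \<Longrightarrow> fn (tan_sum A) (tan_in A a) = tan_n_in 2 A a"
  "a \<in> carrier A \<Longrightarrow> fn (tan_sum A) (tan_d A a) = tan_n_d 2 1 A a \<oplus>\<^bsub>tan_n 2 A\<^esub> tan_n_d 2 2 A a"
  using theI'[OF sum_ex1[OF A]] A by (simp_all add: tan_sum_def on_generators_sum_def in_ar_iff)

lemma tan_lift_simps [simp]: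
  "fst (tan_lift A) = tan_ob (tan_ob A)" "cod (tan_lift A) = tan_ob A" "tan_lift A \<in> ar Gamma_alg"
  "a \<in> carrier A \<Longrightarrow> fn (tan_lift A) (tan_in (tan_ob A) (tan_in A a)) = tan_in A a"
  "a \<in> carrier A \<Longrightarrow> fn (tan_lift A) (tan_in (tan_ob A) (tan_d A a)) = \<zero>\<^bsub>tan_ob A\<^esub>"
  "a \<in> carrier A \<Longrightarrow> fn (tan_lift A) (tan_d (tan_ob A) (tan_in A a)) = \<zero>\<^bsub>tan_ob A\<^esub>"
  "a \<in> carrier A \<Longrightarrow> fn (tan_lift A) (tan_d (tan_ob A) (tan_d A a)) = tan_d A a"
  using theI'[OF lift_ex1[OF A]] A by (simp_all add: tan_lift_def on_generators_lift_def Let_def in_ar_iff)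

lemma tan_flip_simps [simp]:
  "fst (tan_flip A) = tan_ob (tan_ob A)" "cod (tan_flip A) = tan_ob (tan_ob A)" "tan_flip A \<in> ar Gamma_alg"
  "a \<in> carrier A \<Longrightarrow> fn (tan_flip A) (tan_in (tan_ob A) (tan_in A a)) = tan_in (tan_ob A) (tan_in A a)"
  "a \<in> carrier A \<Longrightarrow> fn (tan_flip A) (tan_in (tan_ob A) (tan_d A a)) = tan_d (tan_ob A) (tan_in A a)"
  "a \<in> carrier A \<Longrightarrow> fn (tan_flip A) (tan_d (tan_ob A) (tan_in A a)) = tan_in (tan_ob A) (tan_d A a)"
  "a \<in> carrier A \<Longrightarrow> fn (tan_flip A) (tan_d (tan_ob A) (tan_d A a)) = tan_d (tan_ob A) (tan_d A a)"
  using theI'[OF flip_ex1[OF A]] A by (simp_all add: tan_flip_def on_generators_flip_def Let_def in_ar_iff)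

end

end

section \<open>The tangent functor and universality of the vertical lift\<close>

context large_universe
begin

abbreviation Gop :: "(('f, 'u) dpa, ('f, 'u) dp_arrow) cat" where
  "Gop \<equiv> opposite Gamma_alg"

lemma tangent_endofunctor: "endofunctor Gop tan_ob tan_ar"
proof (rule endofunctor.intro[OF category_opposite[OF category_Gamma_alg]], unfold_locales)
  fix A :: "('f, 'u) dpa" assume "A \<in> ob Gop"
  then have A: "dp_algebra A" by simp
  show "tan_ob A \<in> ob Gop" using A by simp
  show "tan_ar (idn Gop A) = idn Gop (tan_ob A)"
    by (simp, rule tan_arrow_eqI[OF A]) (simp_all add: A)
next
  fix f and A B :: "('f, 'u) dpa" assume "f \<in> hom_set Gop A B"
  then show "tan_ar f \<in> hom_set Gop (tan_ob A) (tan_ob B)" by simp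
next
  fix f g and A B D :: "('f, 'u) dpa"
  assume "f \<in> hom_set Gop A B" "g \<in> hom_set Gop B D"
  then have fg: "f \<in> ar Gamma_alg" "g \<in> ar Gamma_alg" "cod g = fst f" "fst g = D" by auto
  have D: "dp_algebra D" using arD(1)[OF fg(2)] fg(4) by simp
  show "tan_ar (cmp Gop g f) = cmp Gop (tan_ar g) (tan_ar f)"
    by (simp, rule tan_arrow_eqI[OF D]) (use fg D in simp_all)
qed

lemma tan_sum_natural:
  assumes f: "f \<in> ar (Gamma_alg :: (('f, 'u) dpa, ('f, 'u) dp_arrow) cat)"
  shows "cmp Gamma_alg (pairing Gop (tan_n_inj 2 1 (fst f)) (tan_n_inj 2 2 (fst f))
          (cmp Gamma_alg (tan_n_inj 2 1 (cod f)) (tan_ar f)) (cmp Gamma_alg (tan_n_inj 2 2 (cod f)) (tan_ar f)))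
        (tan_sum (fst f))
     = cmp Gamma_alg (tan_sum (cod f)) (tan_ar f)"
proof -
  note AB [simp] = arD(1,2)[OF f] and f [simp]
  note [simp] = copair[OF AB(1)]
  show ?thesis
    by (rule tan_arrow_eqI[OF AB(1)]) simp_all
qed

text \<open>In the category of algebras the claim is a pushout. A cocone (u, v) amounts to v with
  two derivations along it, namely u(da) and u(d'da), and a map out of the twofold coproduct is the
  same data.\<close>

lemma tan_lift_universal:
  fixes A :: "('f, 'u) dpa"
  assumes A: "dp_algebra A"
  shows "is_pullback Gop (tan_ar (tan_proj A)) (tan_zero A) (tan_n 2 A)
            (cmp Gop (tan_ar (tan_sum A))
              (pairing Gop (tan_ar (tan_n_inj 2 1 A)) (tan_ar (tan_n_inj 2 2 A))
                (cmp Gop (tan_lift A) (tan_n_inj 2 1 A)) (cmp Gop (tan_zero (tan_ob A)) (tan_n_inj 2 2 A))))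
            (cmp Gop (tan_proj A) (tan_n_inj 2 1 A))"
proof -
  note [simp] = A
  let ?T = "tan_ob A"
  have T [simp]: "dp_algebra ?T" by simp
  define w where "w = pairing Gop (tan_ar (tan_n_inj 2 1 A)) (tan_ar (tan_n_inj 2 2 A))
      (cmp Gamma_alg (tan_n_inj 2 1 A) (tan_lift A)) (cmp Gamma_alg (tan_n_inj 2 2 A) (tan_zero ?T))"
  have w [simp]: "w \<in> ar Gamma_alg" "fst w = tan_ob (tan_n 2 A)" "cod w = tan_n 2 A"
    "a \<in> carrier A \<Longrightarrow> fn w (tan_in (tan_n 2 A) (tan_n_in 2 A a)) = tan_n_in 2 A a"
    "a \<in> carrier A \<Longrightarrow> fn w (tan_d (tan_n 2 A) (tan_n_in 2 A a)) = \<zero>\<^bsub>tan_n 2 A\<^esub>"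
    "a \<in> carrier A \<Longrightarrow> fn w (tan_in (tan_n 2 A) (tan_n_d 2 1 A a)) = \<zero>\<^bsub>tan_n 2 A\<^esub>"
    "a \<in> carrier A \<Longrightarrow> fn w (tan_d (tan_n 2 A) (tan_n_d 2 1 A a)) = tan_n_d 2 1 A a"
    "a \<in> carrier A \<Longrightarrow> fn w (tan_in (tan_n 2 A) (tan_n_d 2 2 A a)) = tan_n_d 2 2 A a"
    "a \<in> carrier A \<Longrightarrow> fn w (tan_d (tan_n 2 A) (tan_n_d 2 2 A a)) = \<zero>\<^bsub>tan_n 2 A\<^esub>" for a
    unfolding w_def by (simp_all add: tan_copair[OF A])
  \<comment> \<open>On generators: da goes to d_1 a + d_2 a and d'da to d'd_1 a + d'd_2 a by the
    sum; then \<open>w\<close> keeps only d_2 a from the former and d_1 a from the latter. The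
    copies thus appear in reversed order.\<close>
  define \<kappa> where "\<kappa> = cmp Gamma_alg w (tan_ar (tan_sum A))"
  have \<kappa> [simp]: "\<kappa> \<in> ar Gamma_alg" "fst \<kappa> = tan_ob ?T" "cod \<kappa> = tan_n 2 A"
    "a \<in> carrier A \<Longrightarrow> fn \<kappa> (tan_in ?T (tan_in A a)) = tan_n_in 2 A a"
    "a \<in> carrier A \<Longrightarrow> fn \<kappa> (tan_in ?T (tan_d A a)) = tan_n_d 2 2 A a"
    "a \<in> carrier A \<Longrightarrow> fn \<kappa> (tan_d ?T (tan_in A a)) = \<zero>\<^bsub>tan_n 2 A\<^esub>"
    "a \<in> carrier A \<Longrightarrow> fn \<kappa> (tan_d ?T (tan_d A a)) = tan_n_d 2 1 A a" for a
    unfolding \<kappa>_def by simp_all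
  define \<beta> where "\<beta> = cmp Gamma_alg (tan_n_inj 2 1 A) (tan_proj A)"
  have \<beta> [simp]: "\<beta> \<in> ar Gamma_alg" "fst \<beta> = A" "cod \<beta> = tan_n 2 A"
    "a \<in> carrier A \<Longrightarrow> fn \<beta> a = tan_n_in 2 A a" for a
    unfolding \<beta>_def by simp_all
  have "is_pullback Gop (tan_ar (tan_proj A)) (tan_zero A) (tan_n 2 A) \<kappa> \<beta>"
    unfolding is_pullback_def
  proof (intro conjI allI impI)
    show "cmp Gop (tan_ar (tan_proj A)) \<kappa> = cmp Gop (tan_zero A) \<beta>"
      by (simp, rule tan_arrow_eqI[OF A]) simp_all
  next
    fix Y :: "('f, 'u) dpa" and u v :: "('f, 'u) dp_arrow"
    assume uv: "u \<in> hom_set Gop Y (src Gop (tan_ar (tan_proj A))) \<and> v \<in> hom_set Gop Y (src Gop (tan_zero A)) \<and>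
      cmp Gop (tan_ar (tan_proj A)) u = cmp Gop (tan_zero A) v"
    then have u [simp]: "u \<in> ar Gamma_alg" "fst u = tan_ob ?T" "cod u = Y"
      and v [simp]: "v \<in> ar Gamma_alg" "fst v = A" "cod v = Y"
      and eq: "cmp Gamma_alg u (tan_ar (tan_proj A)) = cmp Gamma_alg v (tan_zero A)" by auto
    have Y [simp]: "dp_algebra Y" using arD(2)[OF u(1)] by simp
    \<comment> \<open>Evaluating the cocone equation at a identifies u(a) with v(a). At da it gives
      u(d'a) = 0, because the functor applied to the projection sends da to d'a and the zero map
      kills da.\<close>
    note eq' = arg_cong[OF eq, of "\<lambda>h. fn h x" for x]
    have uv_in [simp]: "fn u (tan_in ?T (tan_in A a)) = fn v a" if "a \<in> carrier A" for a
      using eq'[of "tan_in A a"] that by simp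
    have uv_d [simp]: "fn u (tan_d ?T (tan_in A a)) = \<zero>\<^bsub>Y\<^esub>" if "a \<in> carrier A" for a
      using eq'[of "tan_d A a"] that by simp
    have uh: "fn u \<in> dp_hom (tan_ob ?T) Y" and vh: "fn v \<in> dp_hom A Y"
      using arD(3)[OF u(1)] arD(3)[OF v(1)] by simp_all
    interpret Y: dp_algebra Y by fact
    interpret A: dp_algebra A by fact
    interpret T: dp_algebra ?T by fact
    interpret TT: dp_algebra "tan_ob ?T" by simp
    note tD = dp_derD[OF tan_d_der[OF A]] and TD = dp_derD[OF tan_d_der[OF T]]
      and hT = dp_hom_add[OF uh] dp_hom_scale[OF uh] dp_hom_mult[OF uh] dp_hom_dpow[OF uh]
      and hin = dp_hom_add[OF tan_in_hom[OF T]] dp_hom_scale[OF tan_in_hom[OF T]] dp_hom_mult[OF tan_in_hom[OF T]]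
        dp_hom_dpow[OF tan_in_hom[OF T]]
      and iA = dp_hom_dpow[OF tan_in_hom[OF A], symmetric]
    \<comment> \<open>Expanding d'd of a product or of a divided power produces cross terms. Each
      has a factor d' of an element of A, which u sends to zero, so only the terms with d'd of an
      element survive.\<close>
    have der: "dp_der A Y (fn v) (\<lambda>a. fn u (tan_d ?T (tan_d A a)))"
      unfolding dp_der_def
    proof (intro conjI ballI allI impI)
      fix x y n k assume [simp]: "x \<in> carrier A"
      show "fn u (tan_d ?T (tan_d A x)) \<in> carrier Y" by simp
      show "fn u (tan_d ?T (tan_d A (k \<cdot>\<^bsub>A\<^esub> x))) = k \<cdot>\<^bsub>Y\<^esub> fn u (tan_d ?T (tan_d A x))"
        by (simp add: tD TD hT)
      show "fn u (tan_d ?T (tan_d A (dpow A n x))) = dpow Y (n - 1) (fn v x) \<star>\<^bsub>Y\<^esub> fn u (tan_d ?T (tan_d A x))"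
        if n: "2 \<le> n"
      proof -
        have n1: "1 \<le> n - 1" using n by simp
        have [simp]: "dpow A (n - 1) x \<in> carrier A" using A.dpow_closed[OF n1] by simp
        have "fn u (tan_d ?T (tan_d A (dpow A n x)))
            = fn u (tan_d ?T (tan_in A (dpow A (n - 1) x) \<star>\<^bsub>?T\<^esub> tan_d A x))"
          using n1 by (simp add: tD(5)[OF n] iA)
        also have "\<dots> = fn u (tan_in ?T (tan_in A (dpow A (n - 1) x)) \<star>\<^bsub>tan_ob ?T\<^esub> tan_d ?T (tan_d A x)
            \<oplus>\<^bsub>tan_ob ?T\<^esub> tan_in ?T (tan_d A x) \<star>\<^bsub>tan_ob ?T\<^esub> tan_d ?T (tan_in A (dpow A (n - 1) x)))"
          by (simp add: TD(4))
        also have "\<dots> = fn v (dpow A (n - 1) x) \<star>\<^bsub>Y\<^esub> fn u (tan_d ?T (tan_d A x))"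
          by (simp add: hT(1,3))
        finally show ?thesis using n1 by (simp add: dp_hom_dpow[OF vh])
      qed
      assume [simp]: "y \<in> carrier A"
      show "fn u (tan_d ?T (tan_d A (x \<oplus>\<^bsub>A\<^esub> y))) = fn u (tan_d ?T (tan_d A x)) \<oplus>\<^bsub>Y\<^esub> fn u (tan_d ?T (tan_d A y))"
        by simp
      show "fn u (tan_d ?T (tan_d A (x \<star>\<^bsub>A\<^esub> y)))
          = fn v x \<star>\<^bsub>Y\<^esub> fn u (tan_d ?T (tan_d A y)) \<oplus>\<^bsub>Y\<^esub> fn v y \<star>\<^bsub>Y\<^esub> fn u (tan_d ?T (tan_d A x))"
        by (simp add: tD(4) TD(4) hT(3))
    qed
    have "restrict (fn v) (carrier A) \<in> dp_hom A Y"
      using vh by (simp add: restrict_dp_hom)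
    from ex1_implies_ex[OF tan_ex1[OF A Y this der]]
    obtain k where k: "k \<in> dp_hom ?T Y" "\<And>a. a \<in> carrier A \<Longrightarrow> k (tan_in A a) = fn v a"
        "\<And>a. a \<in> carrier A \<Longrightarrow> k (tan_d A a) = fn u (tan_d ?T (tan_d A a))"
      by auto
    define u1 where "u1 = (?T, k, Y)"
    have u1 [simp]: "u1 \<in> ar Gamma_alg" "fst u1 = ?T" "cod u1 = Y"
      "a \<in> carrier A \<Longrightarrow> fn u1 (tan_in A a) = fn v a"
      "a \<in> carrier A \<Longrightarrow> fn u1 (tan_d A a) = fn u (tan_d ?T (tan_d A a))" for a
      using k by (simp_all add: u1_def in_ar_iff)
    \<comment> \<open>The other derivation, u(da), needs no separate construction: it is part of the
      restriction of \<open>u\<close> to the inner tangent algebra.\<close>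
    define u2 where "u2 = cmp Gamma_alg u (tan_proj ?T)"
    have u2 [simp]: "u2 \<in> ar Gamma_alg" "fst u2 = ?T" "cod u2 = Y"
      "x \<in> carrier ?T \<Longrightarrow> fn u2 x = fn u (tan_in ?T x)" for x
      by (simp_all add: u2_def)
    define h where "h = pairing Gop (tan_n_inj 2 1 A) (tan_n_inj 2 2 A) u1 u2"
    have h [simp]: "h \<in> ar Gamma_alg" "fst h = tan_n 2 A" "cod h = Y"
      "a \<in> carrier A \<Longrightarrow> fn h (tan_n_in 2 A a) = fn v a"
      "a \<in> carrier A \<Longrightarrow> fn h (tan_n_d 2 1 A a) = fn u (tan_d ?T (tan_d A a))"
      "a \<in> carrier A \<Longrightarrow> fn h (tan_n_d 2 2 A a) = fn u (tan_in ?T (tan_d A a))" for a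
      unfolding h_def by (simp_all add: copair[OF A])
    show "\<exists>!h. h \<in> hom_set Gop Y (tan_n 2 A) \<and> cmp Gop \<kappa> h = u \<and> cmp Gop \<beta> h = v"
    proof (rule ex1I[of _ h])
      have "cmp Gamma_alg h \<kappa> = u"
        by (rule tan_tan_arrow_eqI[OF A]) simp_all
      moreover have "cmp Gamma_alg h \<beta> = v"
        by (rule arrow_eqI) simp_all
      ultimately show "h \<in> hom_set Gop Y (tan_n 2 A) \<and> cmp Gop \<kappa> h = u \<and> cmp Gop \<beta> h = v"
        by simp
    next
      fix g assume "g \<in> hom_set Gop Y (tan_n 2 A) \<and> cmp Gop \<kappa> g = u \<and> cmp Gop \<beta> g = v"
      then have g [simp]: "g \<in> ar Gamma_alg" "fst g = tan_n 2 A" "cod g = Y"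
        and gu: "cmp Gamma_alg g \<kappa> = u" and gv: "cmp Gamma_alg g \<beta> = v" by auto
      \<comment> \<open>Uniqueness: every generator of the twofold coproduct is hit, a by \<beta>,
        d_1 a and d_2 a by \<kappa>.\<close>
      note gu' = arg_cong[OF gu, of "\<lambda>h. fn h x" for x] and gv' = arg_cong[OF gv, of "\<lambda>h. fn h x" for x]
      show "g = h"
      proof (rule tan_n_arrow_eqI[OF A, of _ 2])
        fix a assume a: "a \<in> carrier A"
        show "fn g (tan_n_in 2 A a) = fn h (tan_n_in 2 A a)" using gv'[of a] a by simp
        fix j :: nat assume "1 \<le> j" "j \<le> 2"
        then consider "j = 1" | "j = 2" by linarith
        then show "fn g (tan_n_d 2 j A a) = fn h (tan_n_d 2 j A a)"
          using gu'[of "tan_d ?T (tan_d A a)"] gu'[of "tan_in ?T (tan_d A a)"] a by cases simp_all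
      qed simp_all
    qed
  qed simp_all
  then show ?thesis by (simp add: \<kappa>_def \<beta>_def w_def)
qed

end

section \<open>Verification of the tangent structure axioms\<close>

context large_universe
begin

lemma tangent_structure:
  "rosicky_tangent_structure Gop tan_ob tan_ar tan_proj tan_n tan_n_base tan_n_inj
    tan_sum tan_zero tan_lift tan_flip tan_neg"
proof (rule rosicky_tangent_structure.intro[OF tangent_endofunctor],
    rule rosicky_tangent_structure_axioms.intro, goal_cases)
  case 1
  have "cmp Gamma_alg (tan_ar f) (tan_proj (fst f)) = cmp Gamma_alg (tan_proj (cod f)) f"
    if f: "f \<in> ar Gamma_alg" for f :: "('f, 'u) dp_arrow"
    using f arD[OF f] by (intro arrow_eqI) simp_all
  then show ?case by (simp add: nat_transf_def)
next
  case (2 A k)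
  then show ?case
    by (intro is_fibre_power_opposite) (simp_all add: tan_copower_spec)
next
  case (3 A m k)
  then have A: "dp_algebra A" by simp
  from tan_pow_preserves_coproduct[OF tan_copower_spec[OF A, of k], of m] A
  show ?case by (intro is_fibre_power_opposite) simp_all
next
  case 4
  show ?case
    using tan_sum_natural by (simp add: nat_transf_def)
next
  case 5
  have "cmp Gamma_alg f (tan_zero (fst f)) = cmp Gamma_alg (tan_zero (cod f)) (tan_ar f)"
    if f: "f \<in> ar Gamma_alg" for f :: "('f, 'u) dp_arrow"
    using f arD[OF f] by (intro tan_arrow_eqI[of "fst f"]) simp_all
  then show ?case by (simp add: nat_transf_def)
next
  case 6
  have "cmp Gamma_alg (tan_ar f) (tan_lift (fst f)) = cmp Gamma_alg (tan_lift (cod f)) (tan_ar (tan_ar f))"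
    if f: "f \<in> ar Gamma_alg" for f :: "('f, 'u) dp_arrow"
    using f arD[OF f] by (intro tan_tan_arrow_eqI[of "fst f"]) simp_all
  then show ?case by (simp add: nat_transf_def)
next
  case 7
  have "cmp Gamma_alg (tan_ar (tan_ar f)) (tan_flip (fst f)) = cmp Gamma_alg (tan_flip (cod f)) (tan_ar (tan_ar f))"
    if f: "f \<in> ar Gamma_alg" for f :: "('f, 'u) dp_arrow"
    using f arD[OF f] by (intro tan_tan_arrow_eqI[of "fst f"]) simp_all
  then show ?case by (simp add: nat_transf_def)
next
  case 8
  have "cmp Gamma_alg (tan_ar f) (tan_neg (fst f)) = cmp Gamma_alg (tan_neg (cod f)) (tan_ar f)"
    if f: "f \<in> ar Gamma_alg" for f :: "('f, 'u) dp_arrow"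
    using f arD[OF f] by (intro tan_arrow_eqI[of "fst f"]) simp_all
  then show ?case by (simp add: nat_transf_def)
next
  case (9 A)
  then have [simp]: "dp_algebra A" by simp
  show ?case unfolding opposite_simps by (rule arrow_eqI) simp_all
next
  case (10 A)
  then have [simp]: "dp_algebra A" by simp
  show ?case unfolding opposite_simps by (rule arrow_eqI) simp_all
next
  case (11 A)
  then have A [simp]: "dp_algebra A" by simp
  show ?case unfolding opposite_simps by (rule tan_arrow_eqI[OF A]) (simp_all add: copair[OF A])
next
  case (12 A)
  then have A [simp]: "dp_algebra A" by simp
  have "vect (tan_n 2 A)" by (simp add: dp_algebra_vect)
  from vect.add_comm[OF this]
  show ?case unfolding opposite_simps by (intro tan_arrow_eqI[OF A]) (simp_all add: copair[OF A])
next
  case (13 A)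
  then have A [simp]: "dp_algebra A" by simp
  show ?case unfolding opposite_simps by (rule tan_arrow_eqI[OF A]) (simp_all add: copair[OF A])
next
  case (14 A)
  then have [simp]: "dp_algebra A" by simp
  show ?case unfolding opposite_simps by (rule arrow_eqI) simp_all
next
  case (15 A)
  then have A [simp]: "dp_algebra A" by simp
  show ?case unfolding opposite_simps by (rule tan_arrow_eqI[OF A]) (simp_all add: copair[OF A])
next
  case (16 A)
  then have A [simp]: "dp_algebra A" by simp
  show ?case unfolding opposite_simps by (rule tan_arrow_eqI[OF A]) simp_all
next
  case (17 A)
  then have A [simp]: "dp_algebra A" by simp
  show ?case unfolding opposite_simps by (rule tan_tan_arrow_eqI[OF A]) (simp_all add: tan_copair[OF A])
next
  case (18 A)
  then have A [simp]: "dp_algebra A" by simp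
  show ?case unfolding opposite_simps by (rule tan_tan_arrow_eqI[OF A]) simp_all
next
  case (19 A)
  then have A [simp]: "dp_algebra A" by simp
  show ?case unfolding opposite_simps by (rule tan_arrow_eqI[OF A]) simp_all
next
  case (20 A)
  then have A [simp]: "dp_algebra A" by simp
  have T [simp]: "dp_algebra (tan_ob A)" by simp
  let ?u = "\<lambda>j. cmp Gamma_alg (tan_ar (tan_n_inj 2 j A)) (tan_flip A)"
  \<comment> \<open>Here the coproduct is taken under \<open>tan_ob A\<close>, so the two legs must
    agree on all its elements. An equality of arrows out of \<open>tan_ob A\<close> reduces this to
    the generators a and da.\<close>
  have "cmp Gamma_alg (?u 1) (tan_proj (tan_ob A)) = cmp Gamma_alg (?u 2) (tan_proj (tan_ob A))"
    by (rule tan_arrow_eqI[OF A]) simp_all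
  note e = arg_cong[OF this, of "\<lambda>h. fn h x" for x]
  have "\<forall>x\<in>carrier (tan_ob A). fn (?u 1) (tan_in (tan_ob A) x) = fn (?u 2) (tan_in (tan_ob A) x)"
  proof
    fix x assume "x \<in> carrier (tan_ob A)"
    then show "fn (?u 1) (tan_in (tan_ob A) x) = fn (?u 2) (tan_in (tan_ob A) x)"
      using e[of x] by simp
  qed
  note cp = copair[OF T _ _ _ _ _ this]
  show ?case unfolding opposite_simps by (rule tan_tan_arrow_eqI[OF A]) (simp_all add: cp)
next
  case (21 A)
  then have A [simp]: "dp_algebra A" by simp
  show ?case unfolding opposite_simps by (rule tan_tan_arrow_eqI[OF A]) simp_all
next
  case (22 A)
  then have A [simp]: "dp_algebra A" by simp
  show ?case unfolding opposite_simps by (rule tan_tan_arrow_eqI[OF A]) simp_all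
next
  case (23 A)
  then have A [simp]: "dp_algebra A" by simp
  show ?case unfolding opposite_simps by (rule tan_tan_arrow_eqI[OF A]) simp_all
next
  case (24 A)
  then have A [simp]: "dp_algebra A" by simp
  show ?case unfolding opposite_simps
    by (rule tan3_arrow_eqI[OF A]; (elim insertE emptyE)?; simp)
next
  case (25 A)
  then have A [simp]: "dp_algebra A" by simp
  show ?case unfolding opposite_simps
    by (rule tan3_arrow_eqI[OF A]; (elim insertE emptyE)?; simp)
next
  case (26 A)
  then have A [simp]: "dp_algebra A" by simp
  show ?case unfolding opposite_simps
    by (rule tan3_arrow_eqI[OF A]; (elim insertE emptyE)?; simp)
next
  case (27 A)
  then have "dp_algebra A" by simp
  from tan_lift_universal[OF this] show ?case .
qed

end

text \<open>The structure is defined with \<open>SOME\<close> and \<open>THE\<close>. The clauses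
  after the first certify these choices: the tangent algebra is the free one, the powers are
  coproducts under A, and the stated values on generators determine exactly one morphism in each
  case.\<close>

theorem theorem2:
  fixes p :: nat
  assumes "CHAR('f::field) = p" and "p > 0"
    and "infinite (UNIV :: 'u set)" and "\<exists>e :: 'f \<Rightarrow> 'u. inj e"
  shows "rosicky_tangent_structure (opposite (Gamma_alg :: (('f, 'u) dpa, ('f, 'u) dp_arrow) cat))
           tan_ob tan_ar tan_proj tan_n tan_n_base tan_n_inj tan_sum tan_zero tan_lift tan_flip tan_neg
       \<and> (\<forall>A \<in> ob (Gamma_alg :: (('f, 'u) dpa, ('f, 'u) dp_arrow) cat).
            is_free_dp_algebra A (Omega1 A) (tan_ob A) (tan_in A) (tan_unit A)
          \<and> (\<forall>k. is_coproduct_under Gamma_alg A k (\<lambda>j. tan_proj A)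
                   (tan_n k A) (tan_n_base k A) (\<lambda>j. tan_n_inj k j A))
          \<and> (\<exists>!h. on_generators_sum A h)
          \<and> (\<exists>!h. on_generators_zero A h)
          \<and> (\<exists>!h. on_generators_lift A h)
          \<and> (\<exists>!h. on_generators_flip A h)
          \<and> (\<exists>!h. on_generators_neg A h))
       \<and> (\<forall>f \<in> ar (Gamma_alg :: (('f, 'u) dpa, ('f, 'u) dp_arrow) cat).
            \<exists>!h. on_generators_functor f h)"
proof -
  obtain e :: "'f \<Rightarrow> 'u" where "inj e" using assms(4) by blast
  then interpret large_universe e
    using assms(3) by unfold_locales
  show ?thesis
  proof (intro conjI ballI allI)
    fix A :: "('f, 'u) dpa" and k assume "A \<in> ob Gamma_alg"
    then have A: "dp_algebra A" by simp
    show "is_free_dp_algebra A (Omega1 A) (tan_ob A) (tan_in A) (tan_unit A)"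
      by (rule tan_free[OF A])
    show "is_coproduct_under Gamma_alg A k (\<lambda>j. tan_proj A) (tan_n k A) (tan_n_base k A) (\<lambda>j. tan_n_inj k j A)"
      by (rule tan_copower_spec[OF A])
    show "\<exists>!h. on_generators_sum A h" by (rule sum_ex1[OF A])
    show "\<exists>!h. on_generators_zero A h" by (rule zero_ex1[OF A])
    show "\<exists>!h. on_generators_lift A h" by (rule lift_ex1[OF A])
    show "\<exists>!h. on_generators_flip A h" by (rule flip_ex1[OF A])
    show "\<exists>!h. on_generators_neg A h" by (rule neg_ex1[OF A])
  qed (rule tangent_structure functor_ex1; assumption?)+
qed

end
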